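(* Let $r_1,r_2\in(0,1)$, $s\ge 2\max\{r_1,r_2\}$, and let $\{W(t):t\in\mathbb R\}$ be the unitary group on $L^2(\mathbb R^2)$ given by $W(t)v_0(x,y)=\big(e^{it(\xi^3+\xi\eta^2)}\widehat v_0(\xi,\eta)\big)^{\vee}(x,y)$. Suppose $$u_0\in Z_{s,(r_1,r_2)}=H^s(\mathbb R^2)\cap L^2\big((|x|^{2r_1}+|y|^{2r_2})\,dx\,dy\big).$$ Then for all $t\in\mathbb R$ and almost every $(x,y)\in\mathbb R^2$, $$|x|^{r_1}W(t)u_0(x,y)=W(t)(|x|^{r_1}u_0)(x,y)+W(t)\{\Phi_{1,t,r_1}(\widehat u_0)(\xi,\eta)\}^{\vee}(x,y),$$ $$|y|^{r_2}W(t)u_0(x,y)=W(t)(|y|^{r_2}u_0)(x,y)+W(t)\{\Phi_{2,t,r_2}(\widehat u_0)(\xi,\eta)\}^{\vee}(x,y),$$ with, for $j=1,2$, $$\|\{\Phi_{j,t,r_j}(\widehat u_0)(\xi,\eta)\}^{\vee}\|_2\le c(1+|t|)\big(\|u_0\|_2+\|D_x^su_0\|_2+\|D_y^su_0\|_2\big).$$ Moreover, if in addition for some $\beta\in(0,\min\{r_1,r_2\})$ one has $$D^\beta(|x|^{r_1}u_0),\ D^\beta(|y|^{r_2}u_0)\in L^2(\mathbb R^2)\quad\text{and}\quad u_0\in H^{\beta+s}(\mathbb R^2),$$ then for all $t\in\mathbb R$ and almost every $(x,y)\in\mathbb R^2$, $$D^\beta(|x|^{r_1}W(t)u_0)(x,y)=W(t)(D^\beta|x|^{r_1}u_0)(x,y)+W(t)\big(D^\beta(\{\Phi_{1,t,r_1}(\widehat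 u_0)(\xi,\eta)\}^{\vee})\big)(x,y),$$ $$D^\beta(|y|^{r_2}W(t)u_0)(x,y)=W(t)(D^\beta|y|^{r_2}u_0)(x,y)+W(t)\big(D^\beta(\{\Phi_{2,t,r_2}(\widehat u_0)(\xi,\eta)\}^{\vee})\big)(x,y),$$ with, for $j=1,2$, $$\|D^\beta(\{\Phi_{j,t,r_j}(\widehat u_0)(\xi,\eta)\}^{\vee})\|_2\le c(1+|t|)\big(\|u_0\|_2+\|D_x^{\beta+s}u_0\|_2+\|D_y^{\beta+s}u_0\|_2\big).$$
   Context: $\widehat{\ }$ and $^{\vee}$ denote the Fourier transform and its inverse on $\mathbb R^2$, with $(\xi,\eta)$ the frequency variables dual to $(x,y)$. $D_x^\alpha$, $D_y^\alpha$ are the Fourier multipliers $|\xi|^\alpha$, $|\eta|^\alpha$, and $D^\beta$ is the homogeneous derivative of order $\beta$ (Fourier multiplier $|(\xi,\eta)|^\beta$). With $\varphi(\xi,\eta)=\xi^3+\xi\eta^2$ and $\alpha\in(0,1)$, define for a function $f$ on $\mathbb R^2$ $$\Phi_{1,t,\alpha}(f)(\xi,\eta)=\lim_{\epsilon\to0}\frac{1}{d_\alpha}\int_{|\tau|\ge\epsilon}\frac{e^{it(\varphi(\xi+\tau,\eta)-\varphi(\xi,\eta))}-1}{|\tau|^{1+\alpha}}f(\xi+\tau,\eta)\,d\tau,$$ $$\Phi_{2,t,\alpha}(f)(\xi,\eta)=\lim_{\epsilon\to0}\frac{1}{d_\alpha}\int_{|\tau|\ge\epsilon}\frac{e^{it(\varphi(\xi,\eta+\tau)-\varphi(\xi,\eta))}-1}{|\tau|^{1+\alpha}}f(\xi,\eta+\tau)\,d\tau,$$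 where $d_\alpha$ is the normalizing constant of the one-dimensional Stein derivative $\lim_{\epsilon\to0}\frac1{d_\alpha}\int_{|\tau|\ge\epsilon}\frac{g(\xi+\tau)-g(\xi)}{|\tau|^{1+\alpha}}d\tau$, chosen so that it coincides with the multiplier $|x|^\alpha$ on the physical side. $c$ denotes a constant depending only on $r_1,r_2$ (and $\beta$). *)

theory Defs
  imports "HOL-Analysis.Analysis"
begin

text \<open>Functions on R^2 are modelled as maps real \<times> real \<Rightarrow> complex, with Lebesgue measure lborel.
  Fourier convention: hat f (xi,eta) = int f(x,y) e^{-i(x xi + y eta)} dx dy,
  inverse with factor (2 pi)^(-2).\<close>

definition L2 :: "(real \<times> real \<Rightarrow> complex) \<Rightarrow> bool" where
  "L2 f \<longleftrightarrow> f \<in> borel_measurable lborel \<and> integrable lborel (\<lambda>z. (cmod (f z))\<^sup>2)"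

definition norm2 :: "(real \<times> real \<Rightarrow> complex) \<Rightarrow> real" where
  "norm2 f = sqrt (\<integral>z. (cmod (f z))\<^sup>2 \<partial>lborel)"

text \<open>Fourier integral (for integrable functions), sign sg = -1 forward, +1 backward.\<close>
definition FT1 :: "real \<Rightarrow> (real \<times> real \<Rightarrow> complex) \<Rightarrow> real \<times> real \<Rightarrow> complex" where
  "FT1 sg f \<zeta> = (\<integral>z. f z * cis (sg * (fst z * fst \<zeta> + snd z * snd \<zeta>)) \<partial>lborel)"

text \<open>Plancherel extension to L^2: L^2-limit of the transforms of the truncations to balls.\<close>
definition fourier :: "(real \<times> real \<Rightarrow> complex) \<Rightarrow> real \<times> real \<Rightarrow> complex" where
  "fourier f = (SOME g. L2 g \<and>
     ((\<lambda>R. norm2 (\<lambda>\<zeta>. FT1 (-1) (\<lambda>w. indicator (cball 0 R) w * f w) \<zeta> - g \<zeta>)) \<longlongrightarrow> 0) at_top)"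

definition ifourier :: "(real \<times> real \<Rightarrow> complex) \<Rightarrow> real \<times> real \<Rightarrow> complex" where
  "ifourier f = (SOME g. L2 g \<and>
     ((\<lambda>R. norm2 (\<lambda>z. complex_of_real (1 / (4 * pi\<^sup>2)) *
          FT1 1 (\<lambda>w. indicator (cball 0 R) w * f w) z - g z)) \<longlongrightarrow> 0) at_top)"

definition mult_op :: "(real \<times> real \<Rightarrow> complex) \<Rightarrow> (real \<times> real \<Rightarrow> complex) \<Rightarrow> real \<times> real \<Rightarrow> complex" where
  "mult_op m f = ifourier (\<lambda>\<zeta>. m \<zeta> * fourier f \<zeta>)"

definition phase :: "real \<times> real \<Rightarrow> real" where
  "phase \<zeta> = fst \<zeta> ^ 3 + fst \<zeta> * (snd \<zeta>)\<^sup>2"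

definition W :: "real \<Rightarrow> (real \<times> real \<Rightarrow> complex) \<Rightarrow> real \<times> real \<Rightarrow> complex" where
  "W t = mult_op (\<lambda>\<zeta>. cis (t * phase \<zeta>))"

definition Dx :: "real \<Rightarrow> (real \<times> real \<Rightarrow> complex) \<Rightarrow> real \<times> real \<Rightarrow> complex" where
  "Dx a = mult_op (\<lambda>\<zeta>. complex_of_real (\<bar>fst \<zeta>\<bar> powr a))"

definition Dy :: "real \<Rightarrow> (real \<times> real \<Rightarrow> complex) \<Rightarrow> real \<times> real \<Rightarrow> complex" where
  "Dy a = mult_op (\<lambda>\<zeta>. complex_of_real (\<bar>snd \<zeta>\<bar> powr a))"

definition D :: "real \<Rightarrow> (real \<times> real \<Rightarrow> complex) \<Rightarrow> real \<times> real \<Rightarrow> complex" where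
  "D b = mult_op (\<lambda>\<zeta>. complex_of_real (norm \<zeta> powr b))"

definition D_in_L2 :: "real \<Rightarrow> (real \<times> real \<Rightarrow> complex) \<Rightarrow> bool" where
  "D_in_L2 b f \<longleftrightarrow> L2 (\<lambda>\<zeta>. complex_of_real (norm \<zeta> powr b) * fourier f \<zeta>)"

definition Hs :: "real \<Rightarrow> (real \<times> real \<Rightarrow> complex) set" where
  "Hs s = {f. L2 f \<and> L2 (\<lambda>\<zeta>. complex_of_real ((1 + (norm \<zeta>)\<^sup>2) powr (s / 2)) * fourier f \<zeta>)}"

definition Z :: "real \<Rightarrow> real \<Rightarrow> real \<Rightarrow> (real \<times> real \<Rightarrow> complex) set" where
  "Z s r1 r2 = Hs s \<inter> {f. L2 (\<lambda>z. complex_of_real (\<bar>fst z\<bar> powr r1) * f z)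
                         \<and> L2 (\<lambda>z. complex_of_real (\<bar>snd z\<bar> powr r2) * f z)}"

text \<open>Normalizing constant of the 1D Stein derivative so that it equals the multiplier |x|^alpha
  under the above Fourier convention.\<close>
definition d_const :: "real \<Rightarrow> real" where
  "d_const a = - (\<integral>\<tau>. (1 - cos \<tau>) / \<bar>\<tau>\<bar> powr (1 + a) \<partial>lborel)"

definition Phi1 :: "real \<Rightarrow> real \<Rightarrow> (real \<times> real \<Rightarrow> complex) \<Rightarrow> real \<times> real \<Rightarrow> complex" where
  "Phi1 t a f \<zeta> = Lim (at_right 0) (\<lambda>\<epsilon>. complex_of_real (1 / d_const a) *
     (LINT \<tau>:{\<tau>. \<epsilon> \<le> \<bar>\<tau>\<bar>}|lborel.
        (cis (t * (phase (fst \<zeta> + \<tau>, snd \<zeta>) - phase \<zeta>)) - 1)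
          / complex_of_real (\<bar>\<tau>\<bar> powr (1 + a)) * f (fst \<zeta> + \<tau>, snd \<zeta>)))"

definition Phi2 :: "real \<Rightarrow> real \<Rightarrow> (real \<times> real \<Rightarrow> complex) \<Rightarrow> real \<times> real \<Rightarrow> complex" where
  "Phi2 t a f \<zeta> = Lim (at_right 0) (\<lambda>\<epsilon>. complex_of_real (1 / d_const a) *
     (LINT \<tau>:{\<tau>. \<epsilon> \<le> \<bar>\<tau>\<bar>}|lborel.
        (cis (t * (phase (fst \<zeta>, snd \<zeta> + \<tau>) - phase \<zeta>)) - 1)
          / complex_of_real (\<bar>\<tau>\<bar> powr (1 + a)) * f (fst \<zeta>, snd \<zeta> + \<tau>)))"

end

theory Submission
  imports Defs "HOL-Probability.Characteristic_Functions"
begin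

text \<open>Fix a coordinate direction \<open>e\<close> and an exponent \<open>a < 1\<close>, and cut the Stein derivative off at
  \<open>\<bar>\<tau>\<bar> \<ge> \<epsilon>\<close>. The truncated derivative is a convolution along \<open>e\<close> minus a constant multiple of the
  identity, so on the physical side it multiplies by a bounded function \<open>m\<^sub>\<epsilon>(z \<bullet> e)\<close>, and
  \<open>m\<^sub>\<epsilon>(x)\<close> is dominated by and tends to a multiple of \<open>\<bar>x\<bar> powr a\<close>. In the commutator with the
  multiplication by \<open>exp (i t phase)\<close> the constants cancel and exactly the truncated integral of
  \<open>\<Phi>\<close> remains. This gives the claimed identity with \<open>m\<^sub>\<epsilon>\<close> in place of \<open>\<bar>x\<bar> powr a\<close> for every
  square-integrable datum, and the identity itself follows by letting \<open>\<epsilon>\<close> tend to 0 in \<open>L\<^sup>2\<close>.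

  The convergence and the bounds rest on the Schur test. The oscillating factor is at most a
  constant times \<open>min 1 (L \<bar>\<tau>\<bar>)\<close> with \<open>L = (1 + \<bar>t\<bar>) (1 + \<bar>\<zeta>\<bar>\<^sup>2)\<close>, and the integral of
  \<open>min 1 (L \<bar>\<tau>\<bar>) / \<bar>\<tau>\<bar> powr (1 + a)\<close> is a multiple of \<open>L powr a\<close>; this is where the condition
  \<open>s \<ge> 2 a\<close> comes from. A further factor \<open>\<bar>\<zeta>\<bar> powr \<beta>\<close> costs \<open>max 1 \<bar>\<tau>\<bar> powr \<beta>\<close> in the kernel, which stays
  integrable at infinity because \<open>\<beta> < a\<close>.

  The Plancherel theorem on \<open>L\<^sup>1 \<inter> L\<^sup>2\<close> is obtained by Gaussian regularisation and the continuity of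
  translations in \<open>L\<^sup>2\<close>; inversion then follows from the two isometries being adjoint up to a factor.\<close>

section \<open>Square-integrable functions\<close>

text \<open>Nothing is known beforehand about the decay of \<open>W t u\<close>, so
  \<open>\<bar>x\<bar> powr a * W t u\<close> cannot be treated on the Fourier side directly, while
  a bounded multiplier can. That this product is square-integrable then comes out of the limit
  instead of being put in.

  The oscillating kernel is not symmetric, and its size depends on the base point. The Schur test is
  therefore run with a weight, and the cut at \<open>\<bar>\<tau>\<bar> = 1\<close> decides where
  the weight is needed: for shorter shifts the weights at the two end points are comparable, for
  longer ones the trivial bound 2 on the oscillating factor suffices. The weights that occur have
  order at most \<open>2 * a + b < 3\<close>, whatever s is, and this keeps the constants
  independent of s.

  The transforms are selected by \<open>SOME\<close>, so linearity and inversion hold only almost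
  everywhere. The selection depends only on the argument modulo null sets, however, and this turns
  many statements about transforms into equations between functions.\<close>

lemma nn_integral_Cauchy_Schwarz:
  fixes p q :: "'a \<Rightarrow> real"
  assumes [measurable]: "p \<in> borel_measurable M" "q \<in> borel_measurable M"
    and nonneg: "\<And>x. 0 \<le> p x" "\<And>x. 0 \<le> q x"
  shows "(\<integral>\<^sup>+x. ennreal (p x * q x) \<partial>M)\<^sup>2
    \<le> (\<integral>\<^sup>+x. ennreal ((p x)\<^sup>2) \<partial>M) * (\<integral>\<^sup>+x. ennreal ((q x)\<^sup>2) \<partial>M)"
    (is "?I\<^sup>2 \<le> ?A * ?B")
proof -
  \<comment> \<open>In \<open>ennreal\<close> the product of 0 and top is 0, so a vanishing factor
    next to an infinite one has to be treated apart; the left side is then 0 as well.\<close>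
  have zero: "?I = 0" if "?A = 0 \<or> ?B = 0"
  proof -
    have "AE x in M. p x * q x = 0"
      using that by (auto simp: nn_integral_0_iff_AE elim!: eventually_mono)
    then show ?thesis
      by (auto simp: nn_integral_0_iff_AE elim!: eventually_mono)
  qed
  consider "?A = 0 \<or> ?B = 0" | "?A \<noteq> 0" "?B = top" | "?B \<noteq> 0" "?A = top"
    | "?A \<noteq> 0" "?B \<noteq> 0" "?A \<noteq> top" "?B \<noteq> top" by blast
  then show ?thesis
  proof cases
    case 1
    then show ?thesis using zero by simp
  next
    case 2
    then show ?thesis by (simp add: ennreal_mult_top)
  next
    case 3
    then show ?thesis by (simp add: ennreal_top_mult)
  next
    case 4
    obtain a where a: "?A = ennreal a" "a > 0"
      using 4 by (metis ennreal_cases ennreal_0 order_le_less)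
    obtain b where b: "?B = ennreal b" "b > 0"
      using 4 by (metis ennreal_cases ennreal_0 order_le_less)
    \<comment> \<open>The value that minimises \<open>l / 2 * a + 1 / (2 * l) * b\<close>; both
      summands then equal half of \<open>sqrt (a * b)\<close>.\<close>
    define l where "l = sqrt (b / a)"
    have l: "l > 0" using a b by (simp add: l_def)
    have am: "p x * q x \<le> l / 2 * (p x)\<^sup>2 + 1 / (2 * l) * (q x)\<^sup>2" for x
    proof -
      have "0 \<le> (l * p x - q x)\<^sup>2 / (2 * l)" using l by simp
      also have "\<dots> = l / 2 * (p x)\<^sup>2 + 1 / (2 * l) * (q x)\<^sup>2 - p x * q x"
        using l by (simp add: power2_eq_square field_simps)
      finally show ?thesis by simp
    qed
    have "?I \<le> (\<integral>\<^sup>+x. ennreal (l / 2) * ennreal ((p x)\<^sup>2) + ennreal (1 / (2 * l)) * ennreal ((q x)\<^sup>2) \<partial>M)"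
      by (rule nn_integral_mono) (use am l in \<open>simp flip: ennreal_mult ennreal_plus add: ennreal_leI\<close>)
    also have "\<dots> = ennreal (l / 2) * ?A + ennreal (1 / (2 * l)) * ?B"
      by (simp add: nn_integral_add nn_integral_cmult)
    also have "\<dots> = ennreal (l / 2 * a + 1 / (2 * l) * b)"
      using a b l by (simp flip: ennreal_mult ennreal_plus)
    also have "l / 2 * a + 1 / (2 * l) * b = sqrt (a * b)"
    proof -
      have "l * a = sqrt (a * b)" "b / l = sqrt (a * b)"
        using a b by (auto simp: l_def real_sqrt_divide real_sqrt_mult field_simps)
      then show ?thesis by (simp add: field_simps)
    qed
    finally have "?I\<^sup>2 \<le> (ennreal (sqrt (a * b)))\<^sup>2"
      by (rule power_mono) simp
    also have "\<dots> = ?A * ?B"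
      using a b by (simp add: ennreal_power flip: ennreal_mult)
    finally show ?thesis .
  qed
qed

lemma borel_measurable_cnj [measurable]: "cnj \<in> borel_measurable borel"
  by (intro borel_measurable_continuous_onI continuous_intros)

lemma ennreal_power2_le:
  fixes x :: ennreal
  assumes "x\<^sup>2 \<le> (ennreal c)\<^sup>2" "0 \<le> c"
  shows "x \<le> ennreal c"
proof (cases x)
  case (real r)
  then have "r\<^sup>2 \<le> c\<^sup>2" using assms by (simp add: ennreal_power ennreal_le_iff)
  then show ?thesis using real assms by (auto intro!: ennreal_leI power2_le_imp_le)
next
  case top
  then show ?thesis using assms by (simp add: ennreal_power power2_eq_square ennreal_top_mult top_unique flip: ennreal_mult)
qed

text \<open>\<open>norm2\<close> rests on the Bochner integral, which is 0 for functions that are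
  not square-integrable, so an upper bound on it does not establish membership in \<open>L2\<close>.
  Estimates that have to do so are made for this extended-valued square of the norm.\<close>

abbreviation nn2 :: "(real \<times> real \<Rightarrow> complex) \<Rightarrow> ennreal" where
  "nn2 f \<equiv> \<integral>\<^sup>+z. ennreal ((cmod (f z))\<^sup>2) \<partial>lborel"

lemma L2_measurable[measurable_dest]: "L2 f \<Longrightarrow> f \<in> borel_measurable borel"
  by (simp add: L2_def)

lemma L2_iff: "L2 f \<longleftrightarrow> f \<in> borel_measurable borel \<and> nn2 f < \<infinity>"
  by (auto simp: L2_def integrable_iff_bounded)

lemma norm2_nonneg [simp]: "0 \<le> norm2 f"
  by (simp add: norm2_def)

lemma norm2_power2: "(norm2 f)\<^sup>2 = (\<integral>z. (cmod (f z))\<^sup>2 \<partial>lborel)"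
  by (simp add: norm2_def)

lemma nn2_norm2: "L2 f \<Longrightarrow> nn2 f = ennreal ((norm2 f)\<^sup>2)"
  by (simp add: L2_def norm2_power2 nn_integral_eq_integral)

lemma norm2_eq_nn2: "L2 f \<Longrightarrow> norm2 f = sqrt (enn2real (nn2 f))"
  by (simp add: nn2_norm2)

lemma L2_nn2_bound:
  assumes "f \<in> borel_measurable borel" "nn2 f \<le> ennreal (c\<^sup>2)" "0 \<le> c"
  shows "L2 f" "norm2 f \<le> c"
proof -
  show L: "L2 f" using assms by (auto simp: L2_iff intro: le_less_trans)
  have "ennreal ((norm2 f)\<^sup>2) \<le> ennreal (c\<^sup>2)"
    using assms(2) nn2_norm2[OF L] by simp
  then have "(norm2 f)\<^sup>2 \<le> c\<^sup>2" by (simp add: ennreal_le_iff)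
  then show "norm2 f \<le> c" using assms(3) by (simp add: power2_le_iff_abs_le)
qed

lemma L2_zero [simp]: "L2 (\<lambda>z. 0)"
  by (simp add: L2_def)

lemma norm2_zero [simp]: "norm2 (\<lambda>z. 0) = 0"
  by (simp add: norm2_def)

lemma L2_bound:
  assumes "L2 g" "f \<in> borel_measurable borel" "AE z in lborel. cmod (f z) \<le> c * cmod (g z)"
  shows "L2 f" "0 \<le> c \<Longrightarrow> norm2 f \<le> c * norm2 g"
proof -
  have [measurable]: "g \<in> borel_measurable borel" "f \<in> borel_measurable borel"
    using assms by (auto simp: L2_def)
  have le: "AE z in lborel. (cmod (f z))\<^sup>2 \<le> c\<^sup>2 * (cmod (g z))\<^sup>2"
    using assms(3) by eventually_elim (metis norm_ge_zero power_mono power_mult_distrib)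
  have I: "integrable lborel (\<lambda>z. c\<^sup>2 * (cmod (g z))\<^sup>2)"
    using assms(1) by (simp add: L2_def)
  have "integrable lborel (\<lambda>z. (cmod (f z))\<^sup>2)"
    by (rule Bochner_Integration.integrable_bound[OF I]) (use le in \<open>auto elim!: eventually_mono\<close>)
  then show "L2 f" by (simp add: L2_def)
  then have "(norm2 f)\<^sup>2 \<le> (\<integral>z. c\<^sup>2 * (cmod (g z))\<^sup>2 \<partial>lborel)"
    unfolding norm2_power2 by (intro integral_mono_AE I le) (simp add: L2_def)
  also have "\<dots> = (c * norm2 g)\<^sup>2"
    by (simp add: norm2_power2 power_mult_distrib)
  finally show "0 \<le> c \<Longrightarrow> norm2 f \<le> c * norm2 g"
    using power2_le_imp_le by fastforce
qed

lemma norm2_mono: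
  assumes "L2 g" "f \<in> borel_measurable borel" "AE z in lborel. cmod (f z) \<le> cmod (g z)"
  shows "norm2 f \<le> norm2 g"
  using L2_bound(2)[of g f 1] assms by simp

lemma L2_cong_AE:
  assumes "L2 g" "f \<in> borel_measurable borel" "AE z in lborel. f z = g z"
  shows "L2 f" "norm2 f = norm2 g"
proof -
  show *: "L2 f" by (rule L2_bound(1)[of g f 1]) (use assms in \<open>auto elim!: eventually_mono\<close>)
  show "norm2 f = norm2 g"
    by (intro antisym norm2_mono) (use assms * in \<open>auto simp: L2_def elim!: eventually_mono\<close>)
qed

lemma L2_add [simp]:
  assumes "L2 f" "L2 g" shows "L2 (\<lambda>z. f z + g z)"
proof -
  have [measurable]: "f \<in> borel_measurable borel" "g \<in> borel_measurable borel"
    using assms by (auto simp: L2_def)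
  have I: "integrable lborel (\<lambda>z. 2 * (cmod (f z))\<^sup>2 + 2 * (cmod (g z))\<^sup>2)"
    using assms by (simp add: L2_def)
  have "(cmod (f z + g z))\<^sup>2 \<le> 2 * (cmod (f z))\<^sup>2 + 2 * (cmod (g z))\<^sup>2" for z
  proof -
    have "(cmod (f z + g z))\<^sup>2 \<le> (cmod (f z) + cmod (g z))\<^sup>2"
      by (intro power_mono norm_triangle_ineq) simp
    moreover have "0 \<le> (cmod (f z) - cmod (g z))\<^sup>2" by simp
    ultimately show ?thesis by (simp add: power2_eq_square algebra_simps)
  qed
  then have "integrable lborel (\<lambda>z. (cmod (f z + g z))\<^sup>2)"
    by (intro Bochner_Integration.integrable_bound[OF I]) auto
  then show ?thesis by (simp add: L2_def)
qed

lemma L2_cmult [simp]: "L2 f \<Longrightarrow> L2 (\<lambda>z. c * f z)"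
  by (auto simp: L2_def norm_mult power_mult_distrib)

lemma norm2_cmult: "norm2 (\<lambda>z. c * f z) = cmod c * norm2 f"
  by (simp add: norm2_def norm_mult power_mult_distrib real_sqrt_mult)

lemma L2_uminus [simp]: "L2 f \<Longrightarrow> L2 (\<lambda>z. - f z)"
  using L2_cmult[of f "-1"] by simp

lemma L2_diff [simp]: "L2 f \<Longrightarrow> L2 g \<Longrightarrow> L2 (\<lambda>z. f z - g z)"
  using L2_add[of f "\<lambda>z. - g z"] by simp

lemma norm2_minus_commute: "norm2 (\<lambda>z. f z - g z) = norm2 (\<lambda>z. g z - f z)"
  by (simp add: norm2_def norm_minus_commute)

lemma L2_mult:
  assumes "L2 f" "m \<in> borel_measurable borel" "\<And>z. cmod (m z) \<le> c"
  shows "L2 (\<lambda>z. m z * f z)" "norm2 (\<lambda>z. m z * f z) \<le> c * norm2 f"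
proof -
  have [measurable]: "f \<in> borel_measurable borel" "m \<in> borel_measurable borel"
    using assms by (auto simp: L2_def)
  have "0 \<le> c" using assms(3)[of undefined] norm_ge_zero order_trans by blast
  moreover have "AE z in lborel. cmod (m z * f z) \<le> c * cmod (f z)"
    using assms(3) by (auto simp: norm_mult mult_right_mono)
  ultimately show "L2 (\<lambda>z. m z * f z)" "norm2 (\<lambda>z. m z * f z) \<le> c * norm2 f"
    using L2_bound[OF assms(1), of "\<lambda>z. m z * f z" c] by auto
qed

lemma L2_mult_integrable:
  assumes "L2 f" "L2 g"
  shows "integrable lborel (\<lambda>z. f z * cnj (g z))"
    and "(\<integral>z. cmod (f z) * cmod (g z) \<partial>lborel) \<le> norm2 f * norm2 g"
    and "integrable lborel (\<lambda>z. cmod (f z) * cmod (g z))"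
proof -
  have [measurable]: "f \<in> borel_measurable borel" "g \<in> borel_measurable borel"
    using assms by (auto simp: L2_def)
  have "(\<integral>\<^sup>+z. ennreal (cmod (f z) * cmod (g z)) \<partial>lborel)\<^sup>2 \<le> nn2 f * nn2 g"
    by (rule nn_integral_Cauchy_Schwarz) auto
  also have "\<dots> = (ennreal (norm2 f * norm2 g))\<^sup>2"
    using assms by (simp add: nn2_norm2 ennreal_power power_mult_distrib flip: ennreal_mult)
  finally have le: "(\<integral>\<^sup>+z. ennreal (cmod (f z) * cmod (g z)) \<partial>lborel) \<le> ennreal (norm2 f * norm2 g)"
    by (rule ennreal_power2_le) simp
  show I: "integrable lborel (\<lambda>z. cmod (f z) * cmod (g z))"
    unfolding integrable_iff_bounded using le by (auto simp: intro: le_less_trans)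
  then show "integrable lborel (\<lambda>z. f z * cnj (g z))"
    by (rule Bochner_Integration.integrable_bound) (auto simp: norm_mult)
  show "(\<integral>z. cmod (f z) * cmod (g z) \<partial>lborel) \<le> norm2 f * norm2 g"
    using le by (subst (asm) nn_integral_eq_integral[OF I]) (auto simp: ennreal_le_iff)
qed

lemma norm2_triangle:
  assumes "L2 f" "L2 g"
  shows "norm2 (\<lambda>z. f z + g z) \<le> norm2 f + norm2 g"
proof -
  have I: "integrable lborel (\<lambda>z. (cmod (f z))\<^sup>2 + 2 * (cmod (f z) * cmod (g z)) + (cmod (g z))\<^sup>2)"
    using assms L2_mult_integrable[OF assms] by (simp add: L2_def)
  have "(norm2 (\<lambda>z. f z + g z))\<^sup>2
      \<le> (\<integral>z. (cmod (f z))\<^sup>2 + 2 * (cmod (f z) * cmod (g z)) + (cmod (g z))\<^sup>2 \<partial>lborel)"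
    unfolding norm2_power2
  proof (rule integral_mono[OF _ I])
    show "integrable lborel (\<lambda>z. (cmod (f z + g z))\<^sup>2)"
      using L2_add[OF assms] by (simp add: L2_def)
    show "(cmod (f z + g z))\<^sup>2 \<le> (cmod (f z))\<^sup>2 + 2 * (cmod (f z) * cmod (g z)) + (cmod (g z))\<^sup>2" for z
      using power_mono[OF norm_triangle_ineq[of "f z" "g z"], of 2]
      by (simp add: power2_sum algebra_simps)
  qed
  also have "\<dots> = (norm2 f)\<^sup>2 + 2 * (\<integral>z. cmod (f z) * cmod (g z) \<partial>lborel) + (norm2 g)\<^sup>2"
    using assms L2_mult_integrable[OF assms] by (simp add: L2_def norm2_power2)
  also have "\<dots> \<le> (norm2 f + norm2 g)\<^sup>2"
    using L2_mult_integrable(2)[OF assms] by (simp add: power2_sum)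
  finally show ?thesis by (simp add: power2_le_iff_abs_le)
qed

lemma norm2_triangle_diff:
  assumes "L2 f" "L2 g" "L2 h"
  shows "norm2 (\<lambda>z. f z - h z) \<le> norm2 (\<lambda>z. f z - g z) + norm2 (\<lambda>z. g z - h z)"
  using norm2_triangle[of "\<lambda>z. f z - g z" "\<lambda>z. g z - h z"] assms by simp

lemma norm2_diff_ge:
  assumes "L2 f" "L2 g"
  shows "\<bar>norm2 f - norm2 g\<bar> \<le> norm2 (\<lambda>z. f z - g z)"
  using norm2_triangle_diff[of f g "\<lambda>z. 0"] norm2_triangle_diff[of g f "\<lambda>z. 0"]
    assms norm2_minus_commute[of f g] by simp

lemma norm2_zero_AE:
  assumes "L2 f" "norm2 f = 0"
  shows "AE z in lborel. f z = 0"
proof -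
  have "(\<integral>z. (cmod (f z))\<^sup>2 \<partial>lborel) = 0" using assms(2) norm2_power2[of f] by simp
  then have "AE z in lborel. (cmod (f z))\<^sup>2 = 0"
    using assms(1) by (subst (asm) integral_nonneg_eq_0_iff_AE) (auto simp: L2_def)
  then show ?thesis by simp
qed

lemma norm2_tendsto_norm:
  assumes "\<And>n. L2 (F n)" "L2 f" "((\<lambda>n. norm2 (\<lambda>z. F n z - f z)) \<longlongrightarrow> 0) G"
  shows "((\<lambda>n. norm2 (F n)) \<longlongrightarrow> norm2 f) G"
proof -
  have "((\<lambda>n. norm2 (F n) - norm2 f) \<longlongrightarrow> 0) G"
    using norm2_diff_ge[OF assms(1,2)] assms(3)
    by (intro Lim_null_comparison[OF _ assms(3)]) (auto intro!: always_eventually)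
  then show ?thesis by (simp add: LIM_zero_iff)
qed

lemma norm2_lim_unique:
  assumes "G \<noteq> bot" "\<And>n. L2 (F n)" "L2 f" "L2 g"
    "((\<lambda>n. norm2 (\<lambda>z. F n z - f z)) \<longlongrightarrow> 0) G" "((\<lambda>n. norm2 (\<lambda>z. F n z - g z)) \<longlongrightarrow> 0) G"
  shows "AE z in lborel. f z = g z"
proof -
  have "norm2 (\<lambda>z. f z - g z) \<le> 0"
  proof (rule tendsto_le[OF assms(1) _ tendsto_const])
    show "((\<lambda>n. norm2 (\<lambda>z. F n z - f z) + norm2 (\<lambda>z. F n z - g z)) \<longlongrightarrow> 0) G"
      using tendsto_add[OF assms(5,6)] by simp
    show "\<forall>\<^sub>F n in G. norm2 (\<lambda>z. f z - g z) \<le> norm2 (\<lambda>z. F n z - f z) + norm2 (\<lambda>z. F n z - g z)"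
      using norm2_triangle_diff[OF assms(3) assms(2) assms(4)]
      by (auto simp: norm2_minus_commute[of f])
  qed
  then have "norm2 (\<lambda>z. f z - g z) = 0" by (meson norm2_nonneg order_antisym)
  then show ?thesis using norm2_zero_AE[OF L2_diff[OF assms(3,4)]] by simp
qed

lemma L2_dominated:
  assumes h: "L2 h" and F: "\<And>n::nat. F n \<in> borel_measurable borel" and f: "f \<in> borel_measurable borel"
    and lim: "AE z in lborel. (\<lambda>n. F n z) \<longlonglongrightarrow> f z"
    and dom: "\<And>n. AE z in lborel. cmod (F n z) \<le> cmod (h z)"
  shows "\<And>n. L2 (F n)" "L2 f" "(\<lambda>n. norm2 (\<lambda>z. F n z - f z)) \<longlonglongrightarrow> 0"
proof -
  note [measurable] = F f
  show F2: "\<And>n. L2 (F n)" by (rule L2_bound(1)[OF h, of _ 1]) (use dom in auto)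
  have "AE z in lborel. \<forall>n. cmod (F n z) \<le> cmod (h z)" using dom by (simp add: AE_all_countable)
  then have bd: "AE z in lborel. cmod (f z) \<le> cmod (h z)"
    using lim
  proof eventually_elim
    case (elim z)
    then show ?case by (intro tendsto_upperbound[OF tendsto_norm[OF elim(2)]]) auto
  qed
  then show f2: "L2 f" by (intro L2_bound(1)[OF h, of _ 1]) auto
  have "(\<lambda>n. \<integral>z. (cmod (F n z - f z))\<^sup>2 \<partial>lborel) \<longlonglongrightarrow> (\<integral>z. 0 \<partial>(lborel :: (real \<times> real) measure))"
  proof (rule integral_dominated_convergence[where w = "\<lambda>z. 4 * (cmod (h z))\<^sup>2"])
    show "integrable lborel (\<lambda>z. 4 * (cmod (h z))\<^sup>2)" using h by (simp add: L2_def)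
    show "AE z in lborel. (\<lambda>n. (cmod (F n z - f z))\<^sup>2) \<longlonglongrightarrow> 0"
      using lim
    proof eventually_elim
      case (elim z)
      from tendsto_power[OF tendsto_norm[OF tendsto_diff[OF elim tendsto_const[of "f z"]]], of 2]
      show ?case by simp
    qed
    show "AE z in lborel. norm ((cmod (F n z - f z))\<^sup>2) \<le> 4 * (cmod (h z))\<^sup>2" for n
      using dom[of n] bd
    proof eventually_elim
      case (elim z)
      have "cmod (F n z - f z) \<le> 2 * cmod (h z)"
        using elim norm_triangle_ineq4[of "F n z" "f z"] by linarith
      from power_mono[OF this, of 2] show ?case by (simp add: power_mult_distrib)
    qed
  qed auto
  from tendsto_real_sqrt[OF this] show "(\<lambda>n. norm2 (\<lambda>z. F n z - f z)) \<longlonglongrightarrow> 0"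
    by (simp add: norm2_def)
qed

text \<open>Fatou's lemma for the squared norm. The bound is required only eventually because it is
  applied to tails of sequences.\<close>

lemma norm2_Fatou:
  assumes F: "\<And>n::nat. F n \<in> borel_measurable borel" and f: "f \<in> borel_measurable borel"
    and lim: "AE z in lborel. (\<lambda>n. F n z) \<longlonglongrightarrow> f z"
    and le: "\<forall>\<^sub>F n in sequentially. nn2 (F n) \<le> c"
  shows "nn2 f \<le> c"
proof -
  note [measurable] = F f
  have "nn2 f = (\<integral>\<^sup>+z. liminf (\<lambda>n. ennreal ((cmod (F n z))\<^sup>2)) \<partial>lborel)"
  proof (rule nn_integral_cong_AE)
    show "AE z in lborel. ennreal ((cmod (f z))\<^sup>2) = liminf (\<lambda>n. ennreal ((cmod (F n z))\<^sup>2))"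
      using lim
    proof eventually_elim
      case (elim z)
      have "(\<lambda>n. ennreal ((cmod (F n z))\<^sup>2)) \<longlonglongrightarrow> ennreal ((cmod (f z))\<^sup>2)"
        by (intro tendsto_ennrealI tendsto_power tendsto_norm elim)
      from lim_imp_Liminf[OF _ this] show ?case by simp
    qed
  qed
  also have "\<dots> \<le> liminf (\<lambda>n. nn2 (F n))"
    by (rule nn_integral_liminf) auto
  also have "\<dots> \<le> limsup (\<lambda>n. nn2 (F n))" by (rule Liminf_le_Limsup) simp
  also have "\<dots> \<le> c" by (rule Limsup_bounded[OF le])
  finally show ?thesis .
qed

text \<open>Fatou's lemma for \<open>F n - f\<close> bounds the norm of \<open>g - f\<close> by
  every positive e, without passing to a subsequence. Only measurability of g goes in: this is how
  the pointwise limit \<open>\<bar>x\<bar> powr a * W t u\<close> is recognised as a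
  square-integrable function.\<close>

lemma norm2_lim_pointwise:
  assumes "\<And>n::nat. L2 (F n)" "L2 f" "g \<in> borel_measurable borel"
    "(\<lambda>n. norm2 (\<lambda>z. F n z - f z)) \<longlonglongrightarrow> 0"
    and lim: "AE z in lborel. (\<lambda>n. F n z) \<longlonglongrightarrow> g z"
  shows "AE z in lborel. g z = f z"
proof -
  have [measurable]: "\<And>n. F n \<in> borel_measurable borel" "f \<in> borel_measurable borel" "g \<in> borel_measurable borel"
    using assms by (auto simp: L2_def)
  have "nn2 (\<lambda>z. g z - f z) \<le> ennreal (e\<^sup>2)" if "e > 0" for e
  proof (rule norm2_Fatou[of "\<lambda>n z. F n z - f z"])
    show "AE z in lborel. (\<lambda>n. F n z - f z) \<longlonglongrightarrow> g z - f z"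
      using lim by eventually_elim (intro tendsto_diff tendsto_const)
    have "\<forall>\<^sub>F n in sequentially. norm2 (\<lambda>z. F n z - f z) < e"
      using order_tendstoD(2)[OF assms(4) that] .
    then show "\<forall>\<^sub>F n in sequentially. nn2 (\<lambda>z. F n z - f z) \<le> ennreal (e\<^sup>2)"
      by eventually_elim (use assms(1,2) in \<open>auto simp: nn2_norm2 intro!: ennreal_leI power_mono\<close>)
  qed auto
  note le = this
  have b: "L2 (\<lambda>z. g z - f z)"
    by (rule L2_nn2_bound(1)[OF _ le[of 1]]) auto
  have "norm2 (\<lambda>z. g z - f z) \<le> 0"
  proof (rule field_le_epsilon)
    fix e :: real assume "e > 0"
    then show "norm2 (\<lambda>z. g z - f z) \<le> 0 + e"
      using L2_nn2_bound(2)[OF _ le, of e] by simp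
  qed
  then have "norm2 (\<lambda>z. g z - f z) = 0"
    by (simp add: order_antisym)
  from norm2_zero_AE[OF b this] show ?thesis by simp
qed

text \<open>Riesz-Fischer: a rapidly Cauchy subsequence converges almost everywhere, and Fatou's
  lemma carries the Cauchy estimate over to its limit.\<close>

lemma L2_complete:
  assumes F: "\<And>n::nat. L2 (F n)"
    and Cauchy: "\<And>e. e > 0 \<Longrightarrow> \<exists>N. \<forall>m\<ge>N. \<forall>n\<ge>N. norm2 (\<lambda>z. F m z - F n z) < e"
  shows "\<exists>f. L2 f \<and> (\<lambda>n. norm2 (\<lambda>z. F n z - f z)) \<longlonglongrightarrow> 0"
proof -
  note [measurable] = L2_measurable[OF F]
  have "\<forall>k. \<exists>N. \<forall>m\<ge>N. \<forall>n\<ge>N. norm2 (\<lambda>z. F m z - F n z) < (1/2)^k"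
    using Cauchy by simp
  then obtain N where N: "\<And>k m n. m \<ge> N k \<Longrightarrow> n \<ge> N k \<Longrightarrow> norm2 (\<lambda>z. F m z - F n z) < (1/2)^k"
    by metis
  \<comment> \<open>Summing all earlier thresholds makes r monotone and at least \<open>N k\<close>;
    the summand k makes it unbounded.\<close>
  define r where "r k = (\<Sum>i\<le>k. N i) + k" for k
  have rN: "r k \<ge> N k" for k by (simp add: r_def sum.remove[of "{..k}" k])
  have rS: "r k \<le> r (Suc k)" and rk: "k \<le> r k" for k by (auto simp: r_def)
  define G where "G k z = F (r (Suc k)) z - F (r k) z" for k z
  have [measurable]: "G k \<in> borel_measurable borel" for k unfolding G_def by measurable
  have G2: "L2 (G k)" for k unfolding G_def using F by simp
  have Gn: "norm2 (G k) < (1/2)^k" for k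
    unfolding G_def by (rule N) (use rN[of k] rS[of k] in auto)
  \<comment> \<open>The squared norm of \<open>G k\<close> is below \<open>(1/4)^k\<close>, so the
    weight \<open>2^k\<close> still leaves a convergent series. Its finiteness at z yields geometric
    decay of \<open>G k z\<close>, hence convergence of the telescoping sum.\<close>
  have "(\<integral>\<^sup>+z. (\<Sum>k. ennreal (2^k * (cmod (G k z))\<^sup>2)) \<partial>lborel)
      = (\<Sum>k. \<integral>\<^sup>+z. ennreal (2^k * (cmod (G k z))\<^sup>2) \<partial>lborel)"
    by (rule nn_integral_suminf) auto
  also have "\<dots> = (\<Sum>k. ennreal (2^k * (norm2 (G k))\<^sup>2))"
    by (simp add: ennreal_mult nn_integral_cmult nn2_norm2[OF G2])
  also have "\<dots> \<le> (\<Sum>k. ennreal ((1/2)^k))"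
  proof (intro suminf_le ennreal_leI)
    fix k
    have "(norm2 (G k))\<^sup>2 \<le> ((1/2)^k)\<^sup>2" using Gn[of k] by (intro power_mono) auto
    then have "2^k * (norm2 (G k))\<^sup>2 \<le> 2^k * ((1/2)^k)\<^sup>2" by (intro mult_left_mono) auto
    also have "\<dots> = (1/2)^k" by (simp add: power2_eq_square power_one_over field_simps)
    finally show "2^k * (norm2 (G k))\<^sup>2 \<le> (1/2)^k" .
  qed auto
  also have "\<dots> < \<infinity>"
    by (subst suminf_ennreal_eq) (auto intro: geometric_sums)
  finally have "AE z in lborel. (\<Sum>k. ennreal (2^k * (cmod (G k z))\<^sup>2)) \<noteq> \<infinity>"
    by (intro nn_integral_PInf_AE) auto
  then have conv: "AE z in lborel. convergent (\<lambda>k. F (r k) z)"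
  proof eventually_elim
    case (elim z)
    then have "summable (\<lambda>k. 2^k * (cmod (G k z))\<^sup>2)"
      by (intro summable_suminf_not_top) auto
    then have "Bseq (\<lambda>k. 2^k * (cmod (G k z))\<^sup>2)"
      using summable_LIMSEQ_zero convergent_imp_Bseq convergentI by blast
    then obtain K where K: "K > 0" "\<And>k. 2^k * (cmod (G k z))\<^sup>2 \<le> K"
      unfolding Bseq_def by fastforce
    have "cmod (G k z) \<le> sqrt K * (sqrt (1/2))^k" for k
    proof -
      have "(cmod (G k z))\<^sup>2 \<le> K * (1/2)^k" using K(2)[of k] by (simp add: field_simps)
      then have "cmod (G k z) \<le> sqrt (K * (1/2)^k)" by (rule real_le_rsqrt)
      then show ?thesis by (simp add: real_sqrt_mult real_sqrt_power)
    qed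
    moreover have "summable (\<lambda>k. sqrt K * (sqrt (1/2))^k)"
      by (intro summable_mult summable_geometric) (simp add: real_sqrt_lt_1_iff)
    ultimately have "summable (\<lambda>k. G k z)"
      by (blast intro: summable_comparison_test'[where N=0])
    then have "convergent (\<lambda>n. \<Sum>k<n. G k z)" by (simp add: summable_iff_convergent)
    moreover have "(\<Sum>k<n. G k z) = F (r n) z - F (r 0) z" for n
      unfolding G_def by (rule sum_lessThan_telescope)
    ultimately have "convergent (\<lambda>n. (F (r n) z - F (r 0) z) + F (r 0) z)"
      by (intro convergent_add convergent_const) simp
    then show ?case by simp
  qed
  define f where "f z = lim (\<lambda>k. F (r k) z)" for z
  have [measurable]: "f \<in> borel_measurable borel" unfolding f_def by measurable
  have lim: "AE z in lborel. (\<lambda>k. F (r k) z) \<longlonglongrightarrow> f z"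
    using conv by eventually_elim (simp add: f_def convergent_LIMSEQ_iff)
  \<comment> \<open>Fatou's lemma is applied along the subsequence with n fixed, which gives
    convergence of the whole sequence.\<close>
  have est: "nn2 (\<lambda>z. F n z - f z) \<le> ennreal (e\<^sup>2)" if "e > 0" "\<forall>m\<ge>M. \<forall>n\<ge>M. norm2 (\<lambda>z. F m z - F n z) < e" "n \<ge> M" for e M n
  proof (rule norm2_Fatou[of "\<lambda>k z. F n z - F (r k) z"])
    show "AE z in lborel. (\<lambda>k. F n z - F (r k) z) \<longlonglongrightarrow> F n z - f z"
      using lim by eventually_elim (intro tendsto_diff tendsto_const)
    show "\<forall>\<^sub>F k in sequentially. nn2 (\<lambda>z. F n z - F (r k) z) \<le> ennreal (e\<^sup>2)"
      using eventually_ge_at_top[of M]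
    proof eventually_elim
      case (elim k)
      then have "norm2 (\<lambda>z. F n z - F (r k) z) < e" using that rk[of k] by auto
      then show ?case by (subst nn2_norm2) (auto simp: F intro!: ennreal_leI power_mono)
    qed
  qed auto
  have f2: "L2 f"
  proof -
    obtain M where "\<forall>m\<ge>M. \<forall>n\<ge>M. norm2 (\<lambda>z. F m z - F n z) < 1" using Cauchy[of 1] by auto
    from est[OF zero_less_one this order_refl] have "L2 (\<lambda>z. F M z - f z)"
      by (intro L2_nn2_bound(1)[where c=1]) auto
    from L2_diff[OF F[of M] this] show ?thesis by simp
  qed
  have "(\<lambda>n. norm2 (\<lambda>z. F n z - f z)) \<longlonglongrightarrow> 0"
  proof (rule LIMSEQ_I)
    fix e :: real assume e: "e > 0"
    then obtain M where M: "\<forall>m\<ge>M. \<forall>n\<ge>M. norm2 (\<lambda>z. F m z - F n z) < e / 2"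
      using Cauchy[of "e/2"] by auto
    have "norm2 (\<lambda>z. F n z - f z) \<le> e / 2" if "n \<ge> M" for n
      using est[OF _ M that] e by (intro L2_nn2_bound(2)) auto
    then show "\<exists>M. \<forall>n\<ge>M. norm (norm2 (\<lambda>z. F n z - f z) - 0) < e"
      using e by (intro exI[of _ M]) fastforce
  qed
  with f2 show ?thesis by blast
qed

section \<open>Changes of variable, density of continuous functions, continuity of
  translations\<close>

lemma nn_integral_translate:
  fixes h :: "'a::euclidean_space"
  assumes [measurable]: "f \<in> borel_measurable borel"
  shows "(\<integral>\<^sup>+z. f (z + h) \<partial>lborel) = (\<integral>\<^sup>+z. f z \<partial>lborel)"
proof -
  have "(\<integral>\<^sup>+z. f z \<partial>lborel) = (\<integral>\<^sup>+z. f z \<partial>distr lborel borel ((+) h))"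
    by (simp add: lborel_distr_plus)
  then show ?thesis by (simp add: nn_integral_distr add.commute)
qed

lemma integral_lborel_affine:
  fixes f :: "'a::euclidean_space \<Rightarrow> 'b :: {banach, second_countable_topology}"
  assumes c: "c \<noteq> 0" and f [measurable]: "f \<in> borel_measurable borel"
  shows "(\<integral>x. f x \<partial>lborel) = \<bar>c\<bar> ^ DIM('a) *\<^sub>R (\<integral>x. f (t + c *\<^sub>R x) \<partial>lborel)"
  using c by (subst lborel_affine[of c t]) (simp_all add: integral_density integral_distr)

lemma integrable_lborel_affine:
  fixes f :: "'a::euclidean_space \<Rightarrow> 'b :: {banach, second_countable_topology}"
  assumes c: "c \<noteq> 0" and f: "integrable lborel f"
  shows "integrable lborel (\<lambda>x. f (t + c *\<^sub>R x))"
proof -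
  have [measurable]: "f \<in> borel_measurable borel" using f by auto
  have "integrable (density (distr lborel borel (\<lambda>x. t + c *\<^sub>R x)) (\<lambda>_. ennreal (\<bar>c\<bar> ^ DIM('a)))) f"
    using f lborel_affine[OF c, of t] by (simp add: ennreal_power)
  then have "integrable lborel (\<lambda>x. \<bar>c\<bar> ^ DIM('a) *\<^sub>R f (t + c *\<^sub>R x))"
    by (simp add: integrable_density integrable_distr_eq)
  from integrable_scaleR_right[OF this, of "inverse (\<bar>c\<bar> ^ DIM('a))"] show ?thesis
    using c by simp
qed

lemma L2_translate:
  assumes "L2 f"
  shows "L2 (\<lambda>z. f (z + h))" "norm2 (\<lambda>z. f (z + h)) = norm2 f"
proof -
  note [measurable] = L2_measurable[OF assms]
  have eq: "nn2 (\<lambda>z. f (z + h)) = nn2 f"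
    by (rule nn_integral_translate[where f="\<lambda>z. ennreal ((cmod (f z))\<^sup>2)"]) simp
  then show L: "L2 (\<lambda>z. f (z + h))" using assms by (simp add: L2_iff)
  show "norm2 (\<lambda>z. f (z + h)) = norm2 f"
    using eq assms L by (simp add: norm2_eq_nn2)
qed

lemma L2_indicator_cball: "L2 (\<lambda>z. indicator (cball 0 R) z)"
proof -
  have "nn2 (\<lambda>z. indicator (cball 0 R) z) = (\<integral>\<^sup>+z. indicator (cball 0 R) z \<partial>(lborel :: (real \<times> real) measure))"
    by (intro nn_integral_cong) (auto simp: indicator_def)
  also have "\<dots> < \<infinity>"
    using emeasure_lborel_cball_finite by simp
  finally show ?thesis by (auto simp: L2_iff intro!: borel_measurable_indicator)
qed

text \<open>A truncation of f in size and space is an almost everywhere limit of continuous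
  functions, but these come with no majorant. Composing them with a retraction onto a ball and
  multiplying by a cutoff supplies one without disturbing the limit. The bound by a multiple of an
  indicator records boundedness and bounded support together.\<close>

lemma L2_approx_continuous:
  assumes f: "L2 f" and "e > 0"
  obtains g :: "real \<times> real \<Rightarrow> complex" and R C where "continuous_on UNIV g" "L2 g"
    "\<And>z. cmod (g z) \<le> C * indicator (cball 0 R) z" "0 \<le> C" "norm2 (\<lambda>z. g z - f z) < e"
proof -
  note [measurable] = L2_measurable[OF f]
  define F where "F n z = (if cmod (f z) \<le> real n \<and> norm z \<le> real n then f z else 0)" for n z
  have [measurable]: "F n \<in> borel_measurable borel" for n unfolding F_def by measurable
  have "(\<lambda>n. norm2 (\<lambda>z. F n z - f z)) \<longlonglongrightarrow> 0"
  proof (rule L2_dominated(3)[OF f])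
    show "AE z in lborel. (\<lambda>n. F n z) \<longlonglongrightarrow> f z"
    proof (intro AE_I2 tendsto_eventually)
      fix z
      obtain N :: nat where "max (cmod (f z)) (norm z) \<le> N" using real_arch_simple by blast
      then show "\<forall>\<^sub>F n in sequentially. F n z = f z"
        by (intro eventually_sequentiallyI[of N]) (auto simp: F_def)
    qed
  qed (auto simp: F_def)
  then have "\<forall>\<^sub>F n in sequentially. norm2 (\<lambda>z. F n z - f z) < e / 2 \<and> n > 0"
    using \<open>e > 0\<close> by (intro eventually_conj order_tendstoD(2) eventually_gt_at_top) auto
  then obtain N where N: "norm2 (\<lambda>z. F N z - f z) < e / 2" "N > 0"
    by (auto dest: eventually_happens)
  have FN2: "L2 (F N)"
    by (rule L2_bound(1)[OF f, of _ 1]) (auto simp: F_def)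
  have "F N measurable_on UNIV"
    by (intro lebesgue_measurable_imp_measurable_on measurable_completion) auto
  then obtain N0 g where g: "negligible N0" "\<And>n. continuous_on UNIV (g n)"
    "\<And>z. z \<notin> N0 \<Longrightarrow> (\<lambda>n. g n z) \<longlonglongrightarrow> F N z"
    by (auto simp: measurable_on_def)
  have "AE z in lebesgue. (\<lambda>n. g n z) \<longlonglongrightarrow> F N z"
    by (rule AE_I'[of N0]) (use g in \<open>auto simp: negligible_iff_null_sets\<close>)
  then have gl: "AE z in lborel. (\<lambda>n. g n z) \<longlonglongrightarrow> F N z"
    by (simp add: AE_completion_iff)
  \<comment> \<open>\<psi> is the radial retraction onto the disc of radius N, and \<theta> falls
    linearly from 1 on the ball of radius N to 0 at radius \<open>N + 1\<close>; neither changes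
    \<open>F N\<close>. The denominator in \<psi> is positive because \<open>N > 0\<close>.\<close>
  define \<psi> :: "complex \<Rightarrow> complex" where "\<psi> w = (real N / max (real N) (cmod w)) *\<^sub>R w" for w
  define \<theta> :: "real \<times> real \<Rightarrow> real" where "\<theta> z = max 0 (1 + real N - max (real N) (norm z))" for z
  define G where "G n z = \<theta> z *\<^sub>R \<psi> (g n z)" for n z
  have \<psi>c: "continuous_on UNIV \<psi>"
    unfolding \<psi>_def using N by (intro continuous_intros) auto
  have Gc: "continuous_on UNIV (G n)" for n
    unfolding G_def \<theta>_def
    by (intro continuous_intros continuous_on_compose2[OF \<psi>c] g(2)) auto
  have \<psi>b: "cmod (\<psi> w) \<le> real N" for w
    using N by (auto simp: \<psi>_def max_def field_simps)
  have Gb: "cmod (G n z) \<le> real N * indicator (cball 0 (real N + 1)) z" for n z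
  proof (cases "norm z \<le> real N + 1")
    case True
    have "\<bar>\<theta> z\<bar> \<le> 1" by (auto simp: \<theta>_def)
    then have "cmod (G n z) \<le> 1 * real N"
      unfolding G_def norm_scaleR by (intro mult_mono \<psi>b) auto
    then show ?thesis using True by simp
  next
    case False
    then show ?thesis by (simp add: G_def \<theta>_def)
  qed
  have ind: "L2 (\<lambda>z. of_nat N * indicator (cball 0 (real N + 1)) z)"
    by (intro L2_cmult L2_indicator_cball)
  have Gb': "cmod (G n z) \<le> cmod (of_nat N * indicator (cball 0 (real N + 1)) z)" for n z
    using Gb[of n z] by (auto simp: norm_mult indicator_def split: if_splits)
  have Gm: "G n \<in> borel_measurable borel" for n
    by (rule borel_measurable_continuous_onI[OF Gc])
  have \<psi>F: "\<theta> z *\<^sub>R \<psi> (F N z) = F N z" for z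
    using N by (auto simp: \<psi>_def \<theta>_def F_def max_def)
  have "(\<lambda>n. norm2 (\<lambda>z. G n z - F N z)) \<longlonglongrightarrow> 0"
  proof (rule L2_dominated(3)[OF ind Gm])
    show "AE z in lborel. (\<lambda>n. G n z) \<longlonglongrightarrow> F N z"
      using gl
    proof eventually_elim
      case (elim z)
      have "(\<lambda>n. \<psi> (g n z)) \<longlonglongrightarrow> \<psi> (F N z)"
        by (rule continuous_on_tendsto_compose[OF \<psi>c elim]) auto
      then have "(\<lambda>n. G n z) \<longlonglongrightarrow> \<theta> z *\<^sub>R \<psi> (F N z)"
        unfolding G_def by (intro tendsto_intros)
      then show ?case by (simp add: \<psi>F)
    qed
  qed (use Gb' in auto)
  then have "\<forall>\<^sub>F n in sequentially. norm2 (\<lambda>z. G n z - F N z) < e / 2"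
    using \<open>e > 0\<close> by (intro order_tendstoD(2)) auto
  then obtain n where n: "norm2 (\<lambda>z. G n z - F N z) < e / 2" by (auto dest: eventually_happens)
  have G2: "L2 (G n)" by (rule L2_bound(1)[OF ind Gm, where c=1]) (use Gb' in auto)
  show ?thesis
  proof (rule that[OF Gc G2 Gb])
    show "norm2 (\<lambda>z. G n z - f z) < e"
      using norm2_triangle_diff[OF G2 FN2 f] n N by simp
  qed simp
qed

text \<open>For a continuous bounded function of bounded support, dominated convergence applies,
  since bounded shifts keep all translates in one ball. The general case is a three-term estimate,
  because translation preserves the norm.\<close>

lemma L2_translation_continuous:
  assumes f: "L2 f" and h: "h \<longlonglongrightarrow> (0 :: real \<times> real)"
  shows "(\<lambda>n. norm2 (\<lambda>z. f (z + h n) - f z)) \<longlonglongrightarrow> 0"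
proof (rule LIMSEQ_I)
  fix e :: real assume e: "e > 0"
  then have e4: "e / 4 > 0" by simp
  obtain g C R where g: "continuous_on UNIV g" "L2 g"
    "\<And>z. cmod (g z) \<le> C * indicator (cball 0 R) z" "0 \<le> C" "norm2 (\<lambda>z. g z - f z) < e / 4"
    by (rule L2_approx_continuous[OF f e4]) blast
  note [measurable] = L2_measurable[OF f] L2_measurable[OF g(2)]
  obtain K where K: "K > 0" "\<And>n. norm (h n) \<le> K"
    using convergent_imp_Bseq[OF convergentI[OF h]] by (auto simp: Bseq_def)
  have "(\<lambda>n. norm2 (\<lambda>z. g (z + h n) - g z)) \<longlonglongrightarrow> 0"
  proof (rule L2_dominated(3)[where h="\<lambda>z. complex_of_real C * indicator (cball 0 (R + K)) z"])
    show "L2 (\<lambda>z. complex_of_real C * indicator (cball 0 (R + K)) z)"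
      by (intro L2_cmult L2_indicator_cball)
    show "AE z in lborel. (\<lambda>n. g (z + h n)) \<longlonglongrightarrow> g z"
    proof (intro AE_I2 continuous_on_tendsto_compose[OF g(1)])
      show "(\<lambda>n. z + h n) \<longlonglongrightarrow> z" for z
        using tendsto_add[OF tendsto_const[of z] h] by simp
    qed auto
    show "AE z in lborel. cmod (g (z + h n)) \<le> cmod (complex_of_real C * indicator (cball 0 (R + K)) z)" for n
    proof (rule AE_I2)
      fix z
      have "norm z \<le> R + K" if "norm (z + h n) \<le> R"
        using that K(2)[of n] norm_triangle_ineq4[of "z + h n" "h n"] by simp
      then show "cmod (g (z + h n)) \<le> cmod (complex_of_real C * indicator (cball 0 (R + K)) z)"
        using g(3)[of "z + h n"] g(4)
        by (cases "norm (z + h n) \<le> R") (auto simp: norm_mult indicator_def)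
    qed
  qed auto
  then have "\<forall>\<^sub>F n in sequentially. norm2 (\<lambda>z. g (z + h n) - g z) < e / 4"
    using e by (intro order_tendstoD(2)) auto
  then obtain N where N: "\<And>n. n \<ge> N \<Longrightarrow> norm2 (\<lambda>z. g (z + h n) - g z) < e / 4"
    by (auto simp: eventually_sequentially)
  have "norm2 (\<lambda>z. f (z + h n) - f z) < e" if "n \<ge> N" for n
  proof -
    have "norm2 (\<lambda>z. f (z + h n) - g (z + h n)) = norm2 (\<lambda>z. f z - g z)"
      using L2_translate(2)[of "\<lambda>z. f z - g z" "h n"] f g(2) by simp
    moreover have "norm2 (\<lambda>z. f (z + h n) - f z)
        \<le> norm2 (\<lambda>z. f (z + h n) - g (z + h n)) + norm2 (\<lambda>z. g (z + h n) - f z)"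
      by (intro norm2_triangle_diff L2_translate f g(2))
    moreover have "norm2 (\<lambda>z. g (z + h n) - f z)
        \<le> norm2 (\<lambda>z. g (z + h n) - g z) + norm2 (\<lambda>z. g z - f z)"
      by (intro norm2_triangle_diff L2_translate f g(2))
    ultimately show ?thesis
      using N[OF that] g(5) e by (simp add: norm2_minus_commute[of f])
  qed
  then show "\<exists>N. \<forall>n\<ge>N. norm (norm2 (\<lambda>z. f (z + h n) - f z) - 0) < e" by auto
qed

section \<open>Fubini with a bounded kernel and the Fourier integral\<close>

lemma integrable_kernel:
  fixes f :: "'a::euclidean_space \<Rightarrow> complex" and g :: "'b::euclidean_space \<Rightarrow> complex"
  assumes f: "integrable lborel f" and g: "integrable lborel g"
    and K [measurable]: "(\<lambda>(x, y). K x y) \<in> borel_measurable (borel \<Otimes>\<^sub>M borel)" and K1: "\<And>x y. cmod (K x y) \<le> 1"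
  shows "integrable (lborel \<Otimes>\<^sub>M lborel) (\<lambda>(x, y). f x * g y * K x y)"
proof -
  have [measurable]: "f \<in> borel_measurable borel" "g \<in> borel_measurable borel" using f g by auto
  have "(\<integral>\<^sup>+p. ennreal (norm (case p of (x, y) \<Rightarrow> f x * g y * K x y)) \<partial>(lborel \<Otimes>\<^sub>M lborel))
      \<le> (\<integral>\<^sup>+p. (case p of (x, y) \<Rightarrow> ennreal (cmod (f x)) * ennreal (cmod (g y))) \<partial>(lborel \<Otimes>\<^sub>M lborel))"
    by (intro nn_integral_mono)
       (auto simp: norm_mult mult_left_le K1 simp flip: ennreal_mult intro!: ennreal_leI)
  also have "\<dots> = (\<integral>\<^sup>+x. \<integral>\<^sup>+y. ennreal (cmod (f x)) * ennreal (cmod (g y)) \<partial>lborel \<partial>lborel)"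
    by (subst lborel.nn_integral_fst[symmetric]) auto
  also have "\<dots> = (\<integral>\<^sup>+x. ennreal (cmod (f x)) \<partial>lborel) * (\<integral>\<^sup>+y. ennreal (cmod (g y)) \<partial>lborel)"
    by (simp add: nn_integral_cmult nn_integral_multc)
  also have "\<dots> < \<infinity>"
    using f g by (auto simp: integrable_iff_bounded ennreal_mult_less_top)
  finally show ?thesis by (simp add: integrable_iff_bounded)
qed

lemma Fubini_kernel:
  fixes f :: "'a::euclidean_space \<Rightarrow> complex" and g :: "'b::euclidean_space \<Rightarrow> complex"
  assumes "integrable lborel f" "integrable lborel g"
    and "(\<lambda>(x, y). K x y) \<in> borel_measurable (borel \<Otimes>\<^sub>M borel)" "\<And>x y. cmod (K x y) \<le> 1"
  shows "(\<integral>y. g y * (\<integral>x. f x * K x y \<partial>lborel) \<partial>lborel) = (\<integral>x. f x * (\<integral>y. g y * K x y \<partial>lborel) \<partial>lborel)"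
proof -
  have eq: "(\<integral>x. f x * g y * K x y \<partial>lborel) = g y * (\<integral>x. f x * K x y \<partial>lborel)"
    "(\<integral>y. f x * g y * K x y \<partial>lborel) = f x * (\<integral>y. g y * K x y \<partial>lborel)" for x y
  proof -
    have "(\<integral>x. f x * g y * K x y \<partial>lborel) = (\<integral>x. g y * (f x * K x y) \<partial>lborel)"
      by (simp add: ac_simps)
    also have "\<dots> = g y * (\<integral>x. f x * K x y \<partial>lborel)" by simp
    finally show "(\<integral>x. f x * g y * K x y \<partial>lborel) = g y * (\<integral>x. f x * K x y \<partial>lborel)" .
    show "(\<integral>y. f x * g y * K x y \<partial>lborel) = f x * (\<integral>y. g y * K x y \<partial>lborel)"
      by (simp add: mult.assoc)
  qed
  show ?thesis
    using lborel_pair.Fubini_integral[OF integrable_kernel[OF assms]] unfolding eq .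
qed

lemma integral_tensor:
  fixes f g :: "real \<Rightarrow> complex"
  assumes f: "integrable lborel f" and g: "integrable lborel g"
  shows "integrable lborel (\<lambda>z. f (fst z) * g (snd z))"
    and "(\<integral>z. f (fst z) * g (snd z) \<partial>lborel) = (\<integral>x. f x \<partial>lborel) * (\<integral>y. g y \<partial>lborel)"
proof -
  have I: "integrable (lborel \<Otimes>\<^sub>M lborel) (\<lambda>(x, y). f x * g y)"
    using integrable_kernel[OF f g, of "\<lambda>_ _. 1"] by simp
  then show "integrable lborel (\<lambda>z. f (fst z) * g (snd z))"
    by (simp add: lborel_prod case_prod_unfold)
  have "(\<integral>z. f (fst z) * g (snd z) \<partial>lborel) = (\<integral>x. \<integral>y. f x * g y \<partial>lborel \<partial>lborel)"
    using lborel_pair.integral_fst[OF I] by (simp add: lborel_prod case_prod_unfold)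
  then show "(\<integral>z. f (fst z) * g (snd z) \<partial>lborel) = (\<integral>x. f x \<partial>lborel) * (\<integral>y. g y \<partial>lborel)"
    by simp
qed

lemma FT1_alt: "FT1 sg f \<zeta> = (\<integral>z. f z * cis (sg * (z \<bullet> \<zeta>)) \<partial>lborel)"
  by (simp add: FT1_def inner_prod_def)

lemma FT1_integrable:
  assumes "integrable lborel f"
  shows "integrable lborel (\<lambda>z. f z * cis (sg * (z \<bullet> \<zeta>)))"
proof -
  have [measurable]: "f \<in> borel_measurable borel" using assms by auto
  show ?thesis
    by (rule Bochner_Integration.integrable_bound[OF assms]) (auto simp: norm_mult cis_conv_exp)
qed

lemma cis_measurable [measurable]: "cis \<in> borel_measurable borel"
  by (intro borel_measurable_continuous_onI continuous_intros)

lemma FT1_measurable: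
  assumes "integrable lborel f"
  shows "FT1 sg f \<in> borel_measurable borel"
proof -
  have [measurable]: "f \<in> borel_measurable borel" using assms by auto
  show ?thesis unfolding FT1_alt[abs_def] by measurable
qed

lemma FT1_bound:
  assumes "integrable lborel f"
  shows "cmod (FT1 sg f \<zeta>) \<le> (\<integral>z. cmod (f z) \<partial>lborel)"
  unfolding FT1_alt using integral_norm_bound[of lborel "\<lambda>z. f z * cis (sg * (z \<bullet> \<zeta>))"]
  by (simp add: norm_mult)

lemma FT1_add:
  "integrable lborel f \<Longrightarrow> integrable lborel g \<Longrightarrow> FT1 sg (\<lambda>z. f z + g z) \<zeta> = FT1 sg f \<zeta> + FT1 sg g \<zeta>"
  by (simp add: FT1_alt distrib_right FT1_integrable)

lemma FT1_diff:
  "integrable lborel f \<Longrightarrow> integrable lborel g \<Longrightarrow> FT1 sg (\<lambda>z. f z - g z) \<zeta> = FT1 sg f \<zeta> - FT1 sg g \<zeta>"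
  by (simp add: FT1_alt left_diff_distrib FT1_integrable)

lemma FT1_cmult: "FT1 sg (\<lambda>z. c * f z) \<zeta> = c * FT1 sg f \<zeta>"
  by (simp add: FT1_alt mult.assoc)

text \<open>The kernel \<open>cis (sg * (x \<bullet> y))\<close> is symmetric in x and y, so Fubini
  moves the transform from one factor to the other.\<close>

lemma FT1_multiplication_formula:
  assumes "integrable lborel f" "integrable lborel g"
  shows "(\<integral>\<zeta>. g \<zeta> * FT1 sg f \<zeta> \<partial>lborel) = (\<integral>z. f z * FT1 sg g z \<partial>lborel)"
  unfolding FT1_alt
  using Fubini_kernel[OF assms, of "\<lambda>x y. cis (sg * (x \<bullet> y))"]
  by (simp add: inner_commute)

section \<open>The Gaussian and its transform\<close>

definition gauss2 :: "real \<times> real \<Rightarrow> real" where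
  "gauss2 z = std_normal_density (fst z) * std_normal_density (snd z)"

lemma gauss2_eq: "gauss2 z = exp (- (norm z)\<^sup>2 / 2) / (2 * pi)"
  by (cases z) (simp add: gauss2_def std_normal_density_def norm_Pair real_sqrt_mult flip: exp_add,
      simp add: field_simps)

lemma gauss2_measurable [measurable]: "gauss2 \<in> borel_measurable borel"
  unfolding gauss2_def[abs_def] borel_prod[symmetric] by measurable

lemma gauss2_nonneg [simp]: "0 \<le> gauss2 z"
  by (simp add: gauss2_def)

lemma std_normal_density_cis:
  "integrable lborel (\<lambda>x. complex_of_real (std_normal_density x) * cis (t * x))"
  "(\<integral>x. complex_of_real (std_normal_density x) * cis (t * x) \<partial>lborel) = complex_of_real (exp (- t\<^sup>2 / 2))"
proof -
  have "complex_of_real (exp (- t\<^sup>2 / 2)) = char std_normal_distribution t"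
    by (simp add: char_std_normal_distribution)
  also have "\<dots> = (\<integral>x. std_normal_density x *\<^sub>R iexp (t * x) \<partial>lborel)"
    unfolding char_def by (subst integral_density) auto
  finally show "(\<integral>x. complex_of_real (std_normal_density x) * cis (t * x) \<partial>lborel) = complex_of_real (exp (- t\<^sup>2 / 2))"
    by (simp add: scaleR_conv_of_real cis_conv_exp)
  have "integrable lborel (\<lambda>x. complex_of_real (std_normal_density x))"
    by (simp add: integrable_normal_density)
  then show "integrable lborel (\<lambda>x. complex_of_real (std_normal_density x) * cis (t * x))"
    by (rule Bochner_Integration.integrable_bound) (auto simp: norm_mult)
qed

text \<open>The plane wave factors along the coordinates, which leaves the characteristic function
  of the standard normal law in each. The factor \<open>2 * pi\<close> undoes the normalisation of
  \<open>gauss2\<close> as a probability density.\<close>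

lemma gauss2_FT:
  "integrable lborel (\<lambda>k. complex_of_real (gauss2 k) * cis (k \<bullet> v))"
  "(\<integral>k. complex_of_real (gauss2 k) * cis (k \<bullet> v) \<partial>lborel) = complex_of_real (2 * pi * gauss2 v)"
proof -
  have eq: "complex_of_real (gauss2 k) * cis (k \<bullet> v)
    = (complex_of_real (std_normal_density (fst k)) * cis (fst v * fst k))
     * (complex_of_real (std_normal_density (snd k)) * cis (snd v * snd k))" for k
    by (simp add: gauss2_def inner_prod_def cis_mult[symmetric] ac_simps)
  show "integrable lborel (\<lambda>k. complex_of_real (gauss2 k) * cis (k \<bullet> v))"
    unfolding eq by (intro integral_tensor std_normal_density_cis)
  show "(\<integral>k. complex_of_real (gauss2 k) * cis (k \<bullet> v) \<partial>lborel) = complex_of_real (2 * pi * gauss2 v)"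
    unfolding eq integral_tensor(2)[OF std_normal_density_cis(1) std_normal_density_cis(1)] std_normal_density_cis(2)
    by (cases v) (simp add: gauss2_eq norm_Pair add_divide_distrib flip: of_real_mult exp_add)
qed

lemma gauss2_integral: "integrable lborel gauss2" "(\<integral>k. gauss2 k \<partial>lborel) = 1"
proof -
  have "integrable lborel (\<lambda>k. complex_of_real (gauss2 k))" "(\<integral>k. complex_of_real (gauss2 k) \<partial>lborel) = 1"
    using gauss2_FT[of 0] by (simp_all add: gauss2_eq)
  then show "integrable lborel gauss2" "(\<integral>k. gauss2 k \<partial>lborel) = 1"
    using integrable_Re by fastforce+
qed

section \<open>The Plancherel theorem\<close>

text \<open>The transform of f is bounded, so a Gaussian factor makes the square of its modulus
  integrable before Plancherel is available. Writing the square as a product with the conjugate and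
  using the multiplication formula twice turns the integral into a Gaussian average, at scale
  \<rho>, of the autocorrelation of f.\<close>

lemma FT1_gauss_regularized:
  assumes f2: "L2 f" and f1: "integrable lborel f" and sg: "sg = 1 \<or> sg = -1" and \<rho>: "\<rho> > 0"
  shows "(\<integral>\<zeta>. gauss2 (\<rho> *\<^sub>R \<zeta>) * (cmod (FT1 sg f \<zeta>))\<^sup>2 \<partial>lborel)
    = 2 * pi * Re (\<integral>k. gauss2 k * (\<integral>z. f z * cnj (f (z + \<rho> *\<^sub>R k)) \<partial>lborel) \<partial>lborel)"
    and "integrable lborel (\<lambda>\<zeta>. gauss2 (\<rho> *\<^sub>R \<zeta>) * (cmod (FT1 sg f \<zeta>))\<^sup>2)"
proof -
  note [measurable] = L2_measurable[OF f2] FT1_measurable[OF f1]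
  define B where "B = (\<integral>z. cmod (f z) \<partial>lborel)"
  have B: "cmod (FT1 sg f \<zeta>) \<le> B" for \<zeta> unfolding B_def by (rule FT1_bound[OF f1])
  have B0: "0 \<le> B" unfolding B_def by simp
  have Gi: "integrable lborel (\<lambda>\<zeta>. gauss2 (\<rho> *\<^sub>R \<zeta>))"
    using integrable_lborel_affine[OF _ gauss2_integral(1), of \<rho> 0] \<rho> by simp
  define h where "h \<zeta> = complex_of_real (gauss2 (\<rho> *\<^sub>R \<zeta>)) * cnj (FT1 sg f \<zeta>)" for \<zeta>
  have [measurable]: "h \<in> borel_measurable borel" unfolding h_def by measurable
  have hi: "integrable lborel h"
    by (rule Bochner_Integration.integrable_bound[OF integrable_mult_right[OF Gi, of B]])
       (auto simp: h_def norm_mult B B0 mult.commute[of B] intro!: mult_left_mono)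
  show "integrable lborel (\<lambda>\<zeta>. gauss2 (\<rho> *\<^sub>R \<zeta>) * (cmod (FT1 sg f \<zeta>))\<^sup>2)"
    by (rule Bochner_Integration.integrable_bound[OF integrable_mult_right[OF Gi, of "B\<^sup>2"]])
       (auto simp: norm_mult B B0 mult.commute[of "B\<^sup>2"] abs_mult intro!: mult_left_mono power_mono)
  have FTg: "(\<integral>\<zeta>. complex_of_real (gauss2 (\<rho> *\<^sub>R \<zeta>)) * cis (\<zeta> \<bullet> v) \<partial>lborel)
      = complex_of_real (2 * pi * gauss2 (v /\<^sub>R \<rho>) / \<rho>\<^sup>2)" for v
  proof -
    have "complex_of_real (2 * pi * gauss2 (v /\<^sub>R \<rho>))
        = (\<integral>k. complex_of_real (gauss2 k) * cis (k \<bullet> (v /\<^sub>R \<rho>)) \<partial>lborel)"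
      by (rule gauss2_FT(2)[symmetric])
    also have "\<dots> = \<rho>\<^sup>2 *\<^sub>R (\<integral>\<zeta>. complex_of_real (gauss2 (\<rho> *\<^sub>R \<zeta>)) * cis (\<zeta> \<bullet> v) \<partial>lborel)"
      using \<rho> by (subst integral_lborel_affine[where c=\<rho> and t=0]) (auto simp: power2_eq_square mult.assoc[symmetric])
    finally show ?thesis using \<rho> by (simp add: scaleR_conv_of_real field_simps)
  qed
  have FTh: "cnj (FT1 sg h z) = (\<integral>k. f (z + \<rho> *\<^sub>R k) * complex_of_real (2 * pi * gauss2 k) \<partial>lborel)" for z
  proof -
    have h2: "integrable lborel (\<lambda>\<zeta>. complex_of_real (gauss2 (\<rho> *\<^sub>R \<zeta>)) * cis (- sg * (z \<bullet> \<zeta>)))"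
      by (rule Bochner_Integration.integrable_bound[OF Gi]) (auto simp: norm_mult)
    have "cnj (FT1 sg h z) = (\<integral>\<zeta>. cnj (h \<zeta> * cis (sg * (\<zeta> \<bullet> z))) \<partial>lborel)"
      unfolding FT1_alt by (simp only: Bochner_Integration.integral_cnj)
    also have "\<dots> = (\<integral>\<zeta>. (complex_of_real (gauss2 (\<rho> *\<^sub>R \<zeta>)) * cis (- sg * (z \<bullet> \<zeta>))) * FT1 sg f \<zeta> \<partial>lborel)"
      by (rule Bochner_Integration.integral_cong) (auto simp: h_def cis_cnj inner_commute)
    also have "\<dots> = (\<integral>w. f w * FT1 sg (\<lambda>\<zeta>. complex_of_real (gauss2 (\<rho> *\<^sub>R \<zeta>)) * cis (- sg * (z \<bullet> \<zeta>))) w \<partial>lborel)"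
      by (rule FT1_multiplication_formula[OF f1 h2])
    also have "\<dots> = (\<integral>w. f w * complex_of_real (2 * pi * gauss2 ((w - z) /\<^sub>R \<rho>) / \<rho>\<^sup>2) \<partial>lborel)"
    proof (rule Bochner_Integration.integral_cong)
      fix w
      have "FT1 sg (\<lambda>\<zeta>. complex_of_real (gauss2 (\<rho> *\<^sub>R \<zeta>)) * cis (- sg * (z \<bullet> \<zeta>))) w
        = (\<integral>\<zeta>. complex_of_real (gauss2 (\<rho> *\<^sub>R \<zeta>)) * cis (\<zeta> \<bullet> (sg *\<^sub>R (w - z))) \<partial>lborel)"
        unfolding FT1_alt by (rule Bochner_Integration.integral_cong)
          (auto simp: mult.assoc cis_mult inner_diff_right inner_commute[of z] algebra_simps)
      \<comment> \<open>The sign disappears because \<open>gauss2\<close> is even; the lemma thus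
        serves the forward and the backward transform.\<close>
      also have "\<dots> = complex_of_real (2 * pi * gauss2 ((w - z) /\<^sub>R \<rho>) / \<rho>\<^sup>2)"
        unfolding FTg using sg by (auto simp: gauss2_eq)
      finally show "f w * FT1 sg (\<lambda>\<zeta>. complex_of_real (gauss2 (\<rho> *\<^sub>R \<zeta>)) * cis (- sg * (z \<bullet> \<zeta>))) w
        = f w * complex_of_real (2 * pi * gauss2 ((w - z) /\<^sub>R \<rho>) / \<rho>\<^sup>2)" by simp
    qed simp
    also have "\<dots> = \<rho>\<^sup>2 *\<^sub>R (\<integral>k. f (z + \<rho> *\<^sub>R k) * complex_of_real (2 * pi * gauss2 k / \<rho>\<^sup>2) \<partial>lborel)"
      using \<rho> by (subst integral_lborel_affine[where c=\<rho> and t=z]) (auto simp: power2_eq_square)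
    also have "\<dots> = (\<integral>k. \<rho>\<^sup>2 *\<^sub>R (f (z + \<rho> *\<^sub>R k) * complex_of_real (2 * pi * gauss2 k / \<rho>\<^sup>2)) \<partial>lborel)"
      by simp
    also have "\<dots> = (\<integral>k. f (z + \<rho> *\<^sub>R k) * complex_of_real (2 * pi * gauss2 k) \<partial>lborel)"
      using \<rho> by (intro Bochner_Integration.integral_cong) (auto simp: scaleR_conv_of_real)
    finally show ?thesis .
  qed
  have FTh': "FT1 sg h z = (\<integral>k. cnj (f (z + \<rho> *\<^sub>R k)) * complex_of_real (2 * pi * gauss2 k) \<partial>lborel)" for z
  proof -
    have "FT1 sg h z = cnj (\<integral>k. f (z + \<rho> *\<^sub>R k) * complex_of_real (2 * pi * gauss2 k) \<partial>lborel)"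
      using FTh[of z] by (metis complex_cnj_cnj)
    also have "\<dots> = (\<integral>k. cnj (f (z + \<rho> *\<^sub>R k) * complex_of_real (2 * pi * gauss2 k)) \<partial>lborel)"
      by (simp only: Bochner_Integration.integral_cnj)
    finally show ?thesis by simp
  qed
  \<comment> \<open>For fixed k the integral over z is at most the squared norm of f by
    Cauchy-Schwarz and translation invariance; the Gaussian makes the remaining integral over k
    finite.\<close>
  have Fub: "integrable (lborel \<Otimes>\<^sub>M lborel) (\<lambda>(z, k). f z * (cnj (f (z + \<rho> *\<^sub>R k)) * complex_of_real (2 * pi * gauss2 k)))"
  proof -
    have "(\<integral>\<^sup>+p. ennreal (norm (case p of (z, k) \<Rightarrow> f z * (cnj (f (z + \<rho> *\<^sub>R k)) * complex_of_real (2 * pi * gauss2 k)))) \<partial>(lborel \<Otimes>\<^sub>M lborel))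
      = (\<integral>\<^sup>+k. \<integral>\<^sup>+z. ennreal (cmod (f z) * cmod (f (z + \<rho> *\<^sub>R k))) * ennreal (2 * pi * gauss2 k) \<partial>lborel \<partial>lborel)"
      by (subst lborel_pair.nn_integral_snd[symmetric])
         (auto simp: norm_mult ac_simps simp flip: ennreal_mult intro!: nn_integral_cong)
    also have "\<dots> = (\<integral>\<^sup>+k. (\<integral>\<^sup>+z. ennreal (cmod (f z) * cmod (f (z + \<rho> *\<^sub>R k))) \<partial>lborel) * ennreal (2 * pi * gauss2 k) \<partial>lborel)"
      by (simp add: nn_integral_multc)
    also have "\<dots> \<le> (\<integral>\<^sup>+k. ennreal ((norm2 f)\<^sup>2) * ennreal (2 * pi * gauss2 k) \<partial>lborel)"
    proof (intro nn_integral_mono mult_right_mono)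
      fix k
      show "(\<integral>\<^sup>+z. ennreal (cmod (f z) * cmod (f (z + \<rho> *\<^sub>R k))) \<partial>lborel) \<le> ennreal ((norm2 f)\<^sup>2)"
        using L2_mult_integrable(2,3)[OF f2 L2_translate(1)[OF f2, of "\<rho> *\<^sub>R k"]] L2_translate(2)[OF f2, of "\<rho> *\<^sub>R k"]
        by (subst nn_integral_eq_integral) (auto simp: power2_eq_square intro!: ennreal_leI)
    qed simp
    also have "\<dots> = ennreal ((norm2 f)\<^sup>2) * (\<integral>\<^sup>+k. ennreal (2 * pi * gauss2 k) \<partial>lborel)"
      by (simp add: nn_integral_cmult)
    also have "\<dots> < \<infinity>"
      using gauss2_integral(1) by (subst nn_integral_eq_integral) (auto simp: ennreal_mult_less_top)
    finally show ?thesis unfolding integrable_iff_bounded by simp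
  qed
  have "complex_of_real (\<integral>\<zeta>. gauss2 (\<rho> *\<^sub>R \<zeta>) * (cmod (FT1 sg f \<zeta>))\<^sup>2 \<partial>lborel)
      = (\<integral>\<zeta>. h \<zeta> * FT1 sg f \<zeta> \<partial>lborel)"
    unfolding integral_complex_of_real[symmetric]
    by (rule Bochner_Integration.integral_cong[OF refl]) (simp only: h_def of_real_mult complex_norm_square ac_simps)
  also have "\<dots> = (\<integral>z. f z * FT1 sg h z \<partial>lborel)"
    by (rule FT1_multiplication_formula[OF f1 hi])
  also have "\<dots> = (\<integral>z. \<integral>k. f z * (cnj (f (z + \<rho> *\<^sub>R k)) * complex_of_real (2 * pi * gauss2 k)) \<partial>lborel \<partial>lborel)"
    unfolding FTh' by simp
  also have "\<dots> = (\<integral>k. \<integral>z. f z * (cnj (f (z + \<rho> *\<^sub>R k)) * complex_of_real (2 * pi * gauss2 k)) \<partial>lborel \<partial>lborel)"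
    by (rule lborel_pair.Fubini_integral[OF Fub, symmetric])
  also have "\<dots> = (\<integral>k. complex_of_real (2 * pi) * (complex_of_real (gauss2 k) * (\<integral>z. f z * cnj (f (z + \<rho> *\<^sub>R k)) \<partial>lborel)) \<partial>lborel)"
  proof (rule Bochner_Integration.integral_cong)
    fix k
    have "(\<integral>z. f z * (cnj (f (z + \<rho> *\<^sub>R k)) * complex_of_real (2 * pi * gauss2 k)) \<partial>lborel)
      = (\<integral>z. (complex_of_real (2 * pi) * complex_of_real (gauss2 k)) * (f z * cnj (f (z + \<rho> *\<^sub>R k))) \<partial>lborel)"
      by (simp add: ac_simps)
    also have "\<dots> = (complex_of_real (2 * pi) * complex_of_real (gauss2 k)) * (\<integral>z. f z * cnj (f (z + \<rho> *\<^sub>R k)) \<partial>lborel)"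
      by (rule integral_mult_right_zero)
    finally show "(\<integral>z. f z * (cnj (f (z + \<rho> *\<^sub>R k)) * complex_of_real (2 * pi * gauss2 k)) \<partial>lborel)
      = complex_of_real (2 * pi) * (complex_of_real (gauss2 k) * (\<integral>z. f z * cnj (f (z + \<rho> *\<^sub>R k)) \<partial>lborel))"
      by (simp add: mult.assoc)
  qed simp
  also have "\<dots> = complex_of_real (2 * pi) * (\<integral>k. gauss2 k * (\<integral>z. f z * cnj (f (z + \<rho> *\<^sub>R k)) \<partial>lborel) \<partial>lborel)"
    by (rule integral_mult_right_zero)
  finally have "Re (complex_of_real (\<integral>\<zeta>. gauss2 (\<rho> *\<^sub>R \<zeta>) * (cmod (FT1 sg f \<zeta>))\<^sup>2 \<partial>lborel))
    = Re (complex_of_real (2 * pi) * (\<integral>k. gauss2 k * (\<integral>z. f z * cnj (f (z + \<rho> *\<^sub>R k)) \<partial>lborel) \<partial>lborel))"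
    by (rule arg_cong)
  then show "(\<integral>\<zeta>. gauss2 (\<rho> *\<^sub>R \<zeta>) * (cmod (FT1 sg f \<zeta>))\<^sup>2 \<partial>lborel)
    = 2 * pi * Re (\<integral>k. gauss2 k * (\<integral>z. f z * cnj (f (z + \<rho> *\<^sub>R k)) \<partial>lborel) \<partial>lborel)"
    by simp
qed

text \<open>The difference from the value at shift 0 is an inner product of f with
  \<open>f (z + h n) - f z\<close>, small by Cauchy-Schwarz and the continuity of translations. The
  uniform bound is the majorant for the Gaussian average.\<close>

lemma autocorrelation_limit:
  assumes f: "L2 f" and h: "h \<longlonglongrightarrow> 0"
  shows "(\<lambda>n. \<integral>z. f z * cnj (f (z + h n)) \<partial>lborel) \<longlonglongrightarrow> complex_of_real ((norm2 f)\<^sup>2)"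
    and "cmod (\<integral>z. f z * cnj (f (z + v)) \<partial>lborel) \<le> (norm2 f)\<^sup>2"
proof -
  have b: "cmod (\<integral>z. f z * cnj (g z) \<partial>lborel) \<le> norm2 f * norm2 g" if "L2 g" for g
    using integral_norm_bound[of lborel "\<lambda>z. f z * cnj (g z)"] L2_mult_integrable(2)[OF f that]
    by (simp add: norm_mult)
  from b[OF L2_translate(1)[OF f, of v]] show "cmod (\<integral>z. f z * cnj (f (z + v)) \<partial>lborel) \<le> (norm2 f)\<^sup>2"
    by (simp add: L2_translate[OF f] power2_eq_square)
  have eq: "(\<integral>z. f z * cnj (f (z + h n)) \<partial>lborel) - complex_of_real ((norm2 f)\<^sup>2)
    = (\<integral>z. f z * cnj (f (z + h n) - f z) \<partial>lborel)" for n
  proof -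
    have "complex_of_real ((norm2 f)\<^sup>2) = (\<integral>z. f z * cnj (f z) \<partial>lborel)"
      unfolding norm2_power2 integral_complex_of_real[symmetric]
      by (rule Bochner_Integration.integral_cong[OF refl]) (rule complex_norm_square)
    then show ?thesis
      using L2_mult_integrable(1)[OF f L2_translate(1)[OF f, of "h n"]] L2_mult_integrable(1)[OF f f]
      by (simp add: right_diff_distrib)
  qed
  have bn: "norm (\<integral>z. f z * cnj (f (z + h n) - f z) \<partial>lborel) \<le> norm2 f * norm2 (\<lambda>z. f (z + h n) - f z)" for n
    by (rule b) (intro L2_diff L2_translate f)
  have "(\<lambda>n. norm2 f * norm2 (\<lambda>z. f (z + h n) - f z)) \<longlonglongrightarrow> norm2 f * 0"
    by (intro tendsto_intros L2_translation_continuous f h)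
  then have "(\<lambda>n. (\<integral>z. f z * cnj (f (z + h n)) \<partial>lborel) - complex_of_real ((norm2 f)\<^sup>2)) \<longlonglongrightarrow> 0"
    unfolding eq
    by (intro Lim_null_comparison[OF always_eventually[OF allI[OF bn]]]) simp
  then show "(\<lambda>n. \<integral>z. f z * cnj (f (z + h n)) \<partial>lborel) \<longlonglongrightarrow> complex_of_real ((norm2 f)\<^sup>2)"
    by (simp add: LIM_zero_iff)
qed

text \<open>The regularised integral is followed to its limit on both sides. The autocorrelation
  side converges by domination to \<open>2 * pi * (norm2 f)\<^sup>2\<close>; the frequency side
  converges monotonically, so the finiteness of its limit is a conclusion.\<close>

lemma Plancherel_L1_L2:
  assumes f2: "L2 f" and f1: "integrable lborel f" and sg: "sg = 1 \<or> sg = -1"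
  shows "L2 (FT1 sg f)" "norm2 (FT1 sg f) = 2 * pi * norm2 f"
proof -
  note [measurable] = L2_measurable[OF f2] FT1_measurable[OF f1]
  define \<rho> where "\<rho> n = 1 / real (Suc n)" for n
  have \<rho>: "\<rho> n > 0" for n by (simp add: \<rho>_def)
  have \<rho>0: "\<rho> \<longlonglongrightarrow> 0" unfolding \<rho>_def by (rule LIMSEQ_Suc[OF lim_1_over_n])
  define A where "A v = (\<integral>z. f z * cnj (f (z + v)) \<partial>lborel)" for v
  have [measurable]: "A \<in> borel_measurable borel" unfolding A_def by measurable
  have "(\<lambda>n. \<integral>k. gauss2 k * A (\<rho> n *\<^sub>R k) \<partial>lborel) \<longlonglongrightarrow> (\<integral>k. gauss2 k * complex_of_real ((norm2 f)\<^sup>2) \<partial>lborel)"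
  proof (rule integral_dominated_convergence[where w="\<lambda>k. gauss2 k * (norm2 f)\<^sup>2"])
    show "integrable lborel (\<lambda>k. gauss2 k * (norm2 f)\<^sup>2)" using gauss2_integral by simp
    show "AE k in lborel. (\<lambda>n. gauss2 k * A (\<rho> n *\<^sub>R k)) \<longlonglongrightarrow> gauss2 k * complex_of_real ((norm2 f)\<^sup>2)"
    proof (intro AE_I2 tendsto_mult tendsto_const)
      fix k :: "real \<times> real"
      have "(\<lambda>n. \<rho> n *\<^sub>R k) \<longlonglongrightarrow> 0 *\<^sub>R k" by (intro tendsto_intros \<rho>0)
      then show "(\<lambda>n. A (\<rho> n *\<^sub>R k)) \<longlonglongrightarrow> complex_of_real ((norm2 f)\<^sup>2)"
        unfolding A_def by (intro autocorrelation_limit f2) simp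
    qed
    show "AE k in lborel. norm (gauss2 k * A (\<rho> n *\<^sub>R k)) \<le> gauss2 k * (norm2 f)\<^sup>2" for n
      using autocorrelation_limit(2)[OF f2 tendsto_const]
      by (auto simp: norm_mult A_def intro!: mult_left_mono)
  qed measurable
  also have "(\<integral>k. gauss2 k * complex_of_real ((norm2 f)\<^sup>2) \<partial>lborel) = complex_of_real ((norm2 f)\<^sup>2)"
    using gauss2_integral by (simp flip: of_real_mult)
  finally have "(\<lambda>n. 2 * pi * Re (\<integral>k. gauss2 k * A (\<rho> n *\<^sub>R k) \<partial>lborel)) \<longlonglongrightarrow> 2 * pi * Re (complex_of_real ((norm2 f)\<^sup>2))"
    by (intro tendsto_intros)
  then have "(\<lambda>n. \<integral>\<zeta>. gauss2 (\<rho> n *\<^sub>R \<zeta>) * (cmod (FT1 sg f \<zeta>))\<^sup>2 \<partial>lborel) \<longlonglongrightarrow> 2 * pi * (norm2 f)\<^sup>2"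
    unfolding A_def FT1_gauss_regularized(1)[OF f2 f1 sg \<rho>] by simp
  then have "(\<lambda>n. ennreal (\<integral>\<zeta>. gauss2 (\<rho> n *\<^sub>R \<zeta>) * (cmod (FT1 sg f \<zeta>))\<^sup>2 \<partial>lborel)) \<longlonglongrightarrow> ennreal (2 * pi * (norm2 f)\<^sup>2)"
    by (rule tendsto_ennrealI)
  also have "(\<lambda>n. ennreal (\<integral>\<zeta>. gauss2 (\<rho> n *\<^sub>R \<zeta>) * (cmod (FT1 sg f \<zeta>))\<^sup>2 \<partial>lborel))
    = (\<lambda>n. \<integral>\<^sup>+\<zeta>. ennreal (gauss2 (\<rho> n *\<^sub>R \<zeta>) * (cmod (FT1 sg f \<zeta>))\<^sup>2) \<partial>lborel)"
    by (intro ext nn_integral_eq_integral[symmetric] FT1_gauss_regularized(2)[OF f2 f1 sg \<rho>]) auto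
  finally have lim1: "(\<lambda>n. \<integral>\<^sup>+\<zeta>. ennreal (gauss2 (\<rho> n *\<^sub>R \<zeta>) * (cmod (FT1 sg f \<zeta>))\<^sup>2) \<partial>lborel) \<longlonglongrightarrow> ennreal (2 * pi * (norm2 f)\<^sup>2)" .
  \<comment> \<open>As \<rho> decreases, \<open>gauss2 (\<rho> n *\<^sub>R \<zeta>)\<close>
    increases to \<open>gauss2 0 = 1 / (2 * pi)\<close>. This factor and the \<open>2 * pi\<close>
    of the other side combine to the constant \<open>2 * pi\<close> in the norms.\<close>
  have lim2: "(\<lambda>n. \<integral>\<^sup>+\<zeta>. ennreal (gauss2 (\<rho> n *\<^sub>R \<zeta>) * (cmod (FT1 sg f \<zeta>))\<^sup>2) \<partial>lborel)
      \<longlonglongrightarrow> (\<integral>\<^sup>+\<zeta>. ennreal (1 / (2 * pi) * (cmod (FT1 sg f \<zeta>))\<^sup>2) \<partial>lborel)"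
  proof (rule nn_integral_LIMSEQ)
    have le: "\<rho> (Suc n) \<le> \<rho> n" for n by (simp add: \<rho>_def field_simps)
    have "gauss2 (\<rho> n *\<^sub>R \<zeta>) \<le> gauss2 (\<rho> (Suc n) *\<^sub>R \<zeta>)" for n \<zeta>
    proof -
      have "(\<rho> (Suc n) * norm \<zeta>)\<^sup>2 \<le> (\<rho> n * norm \<zeta>)\<^sup>2"
        using le[of n] \<rho>[of "Suc n"] by (intro power_mono mult_right_mono) (auto intro: less_imp_le)
      then show ?thesis using \<rho>[of n] \<rho>[of "Suc n"]
        by (simp add: gauss2_eq divide_right_mono)
    qed
    then show "incseq (\<lambda>n \<zeta>. ennreal (gauss2 (\<rho> n *\<^sub>R \<zeta>) * (cmod (FT1 sg f \<zeta>))\<^sup>2))"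
      by (intro incseq_SucI le_funI ennreal_leI mult_right_mono) auto
    fix \<zeta>
    have "(\<lambda>n. gauss2 (\<rho> n *\<^sub>R \<zeta>)) \<longlonglongrightarrow> exp (- (norm (0 *\<^sub>R \<zeta>))\<^sup>2 / 2) / (2 * pi)"
      unfolding gauss2_eq by (intro tendsto_intros \<rho>0) auto
    then show "(\<lambda>n. ennreal (gauss2 (\<rho> n *\<^sub>R \<zeta>) * (cmod (FT1 sg f \<zeta>))\<^sup>2)) \<longlonglongrightarrow> ennreal (1 / (2 * pi) * (cmod (FT1 sg f \<zeta>))\<^sup>2)"
      by (intro tendsto_ennrealI tendsto_mult tendsto_const) simp
  qed measurable
  have "ennreal (1 / (2 * pi)) * nn2 (FT1 sg f) = ennreal (2 * pi * (norm2 f)\<^sup>2)"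
    unfolding LIMSEQ_unique[OF lim1 lim2]
    by (subst nn_integral_cmult[symmetric]) (auto simp flip: ennreal_mult)
  then have "ennreal (2 * pi) * (ennreal (1 / (2 * pi)) * nn2 (FT1 sg f)) = ennreal (2 * pi) * ennreal (2 * pi * (norm2 f)\<^sup>2)"
    by simp
  moreover have "ennreal (2 * pi) * (ennreal (1 / (2 * pi)) * nn2 (FT1 sg f)) = nn2 (FT1 sg f)"
    by (simp add: mult.assoc[symmetric] flip: ennreal_mult)
  moreover have "ennreal (2 * pi) * ennreal (2 * pi * (norm2 f)\<^sup>2) = ennreal ((2 * pi * norm2 f)\<^sup>2)"
    by (simp add: power2_eq_square ac_simps flip: ennreal_mult)
  ultimately have nn: "nn2 (FT1 sg f) = ennreal ((2 * pi * norm2 f)\<^sup>2)" by simp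
  then show L: "L2 (FT1 sg f)" by (simp add: L2_iff)
  show "norm2 (FT1 sg f) = 2 * pi * norm2 f"
    unfolding norm2_eq_nn2[OF L] nn by simp
qed

section \<open>Extension of the transform to square-integrable functions\<close>

definition trunc :: "real \<Rightarrow> (real \<times> real \<Rightarrow> complex) \<Rightarrow> real \<times> real \<Rightarrow> complex" where
  "trunc R f = (\<lambda>w. indicator (cball 0 R) w * f w)"

lemma trunc_measurable [measurable]: "f \<in> borel_measurable borel \<Longrightarrow> trunc R f \<in> borel_measurable borel"
  unfolding trunc_def by (intro borel_measurable_times borel_measurable_indicator) auto

lemma trunc_L2: "L2 f \<Longrightarrow> L2 (trunc R f)"
  by (rule L2_bound(1)[of f _ 1]) (auto simp: trunc_def indicator_def L2_measurable intro!: borel_measurable_times borel_measurable_indicator)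

lemma trunc_integrable: "L2 f \<Longrightarrow> integrable lborel (trunc R f)"
proof -
  assume "L2 f"
  moreover have "trunc R f = (\<lambda>z. f z * cnj (indicator (cball 0 R) z))"
    by (auto simp: trunc_def indicator_def)
  ultimately show ?thesis
    using L2_mult_integrable(1)[OF _ L2_indicator_cball] by metis
qed

lemma trunc_add: "trunc R (\<lambda>z. f z + g z) = (\<lambda>z. trunc R f z + trunc R g z)"
  and trunc_cmult: "trunc R (\<lambda>z. c * f z) = (\<lambda>z. c * trunc R f z)"
  by (auto simp: trunc_def algebra_simps)

lemma trunc_tendsto:
  assumes f: "L2 f"
  shows "((\<lambda>R. norm2 (\<lambda>z. trunc R f z - f z)) \<longlongrightarrow> 0) at_top"
proof (rule tendsto_at_topI_sequentially)
  fix X :: "nat \<Rightarrow> real" assume X: "filterlim X at_top sequentially"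
  note [measurable] = L2_measurable[OF f]
  show "(\<lambda>n. norm2 (\<lambda>z. trunc (X n) f z - f z)) \<longlonglongrightarrow> 0"
  proof (rule L2_dominated(3)[OF f])
    show "AE z in lborel. (\<lambda>n. trunc (X n) f z) \<longlonglongrightarrow> f z"
    proof (intro AE_I2 tendsto_eventually)
      fix z :: "real \<times> real"
      have "\<forall>\<^sub>F n in sequentially. norm z \<le> X n" using X by (simp add: filterlim_at_top)
      then show "\<forall>\<^sub>F n in sequentially. trunc (X n) f z = f z"
        by eventually_elim (simp add: trunc_def)
    qed
  qed (auto simp: trunc_def indicator_def)
qed

text \<open>The property under \<open>SOME\<close> in both \<open>fourier\<close> and
  \<open>ifourier\<close>, with the sign and the constant as parameters, so that existence,
  uniqueness, norm and linearity are proved once for the two.\<close>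

definition fourier_lim :: "real \<Rightarrow> complex \<Rightarrow> (real \<times> real \<Rightarrow> complex) \<Rightarrow> (real \<times> real \<Rightarrow> complex) \<Rightarrow> bool" where
  "fourier_lim sg c f g \<longleftrightarrow> L2 g \<and> ((\<lambda>R. norm2 (\<lambda>\<zeta>. c * FT1 sg (trunc R f) \<zeta> - g \<zeta>)) \<longlongrightarrow> 0) at_top"

lemma fourier_alt: "fourier f = (SOME g. fourier_lim (-1) 1 f g)"
  by (simp add: fourier_def fourier_lim_def trunc_def)

lemma ifourier_alt: "ifourier f = (SOME g. fourier_lim 1 (complex_of_real (1 / (4 * pi\<^sup>2))) f g)"
  by (simp add: ifourier_def fourier_lim_def trunc_def)

context
  fixes sg :: real assumes sg: "sg = 1 \<or> sg = -1"
begin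

lemma FT1_trunc_L2: "L2 f \<Longrightarrow> L2 (\<lambda>\<zeta>. c * FT1 sg (trunc R f) \<zeta>)"
  by (intro L2_cmult Plancherel_L1_L2 trunc_L2 trunc_integrable sg)

lemma FT1_diff_norm:
  assumes "L2 f" "L2 g" "integrable lborel f" "integrable lborel g"
  shows "norm2 (\<lambda>\<zeta>. c * FT1 sg f \<zeta> - c * FT1 sg g \<zeta>) = 2 * pi * cmod c * norm2 (\<lambda>z. f z - g z)"
proof -
  have "norm2 (\<lambda>\<zeta>. c * FT1 sg f \<zeta> - c * FT1 sg g \<zeta>) = norm2 (\<lambda>\<zeta>. c * FT1 sg (\<lambda>z. f z - g z) \<zeta>)"
    using assms by (simp add: FT1_diff right_diff_distrib)
  also have "\<dots> = cmod c * (2 * pi * norm2 (\<lambda>z. f z - g z))"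
    using assms by (simp add: norm2_cmult Plancherel_L1_L2(2)[OF _ _ sg])
  finally show ?thesis by simp
qed

text \<open>The transform multiplies distances by the constant K, so the transforms of the
  truncations inherit the Cauchy property from the truncations themselves.\<close>

lemma fourier_lim_ex:
  assumes f: "L2 f"
  shows "\<exists>g. fourier_lim sg c f g"
proof -
  define F where "F n \<zeta> = c * FT1 sg (trunc (real n) f) \<zeta>" for n \<zeta>
  define K where "K = 2 * pi * cmod c"
  have K: "0 \<le> K" by (simp add: K_def)
  have F2: "L2 (F n)" for n unfolding F_def by (rule FT1_trunc_L2[OF f])
  \<comment> \<open>One radius is an arbitrary real: the estimate gives the Cauchy property for
    integer radii and also the passage to radii tending to infinity in any way.\<close>
  have d: "norm2 (\<lambda>\<zeta>. c * FT1 sg (trunc R f) \<zeta> - F n \<zeta>)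
      \<le> K * (norm2 (\<lambda>z. trunc R f z - f z) + norm2 (\<lambda>z. trunc (real n) f z - f z))" for R n
  proof -
    have "norm2 (\<lambda>\<zeta>. c * FT1 sg (trunc R f) \<zeta> - F n \<zeta>) = K * norm2 (\<lambda>z. trunc R f z - trunc (real n) f z)"
      unfolding F_def K_def by (rule FT1_diff_norm) (intro trunc_L2 trunc_integrable f)+
    also have "\<dots> \<le> K * (norm2 (\<lambda>z. trunc R f z - f z) + norm2 (\<lambda>z. f z - trunc (real n) f z))"
      by (intro mult_left_mono K norm2_triangle_diff trunc_L2 f)
    finally show ?thesis by (simp add: norm2_minus_commute[of f])
  qed
  have t: "(\<lambda>n. norm2 (\<lambda>z. trunc (X n) f z - f z)) \<longlonglongrightarrow> 0" if "filterlim X at_top sequentially" for X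
    using filterlim_compose[OF trunc_tendsto[OF f] that] .
  note tn = t[OF filterlim_real_sequentially]
  have "\<exists>g. L2 g \<and> (\<lambda>n. norm2 (\<lambda>z. F n z - g z)) \<longlonglongrightarrow> 0"
  proof (rule L2_complete[OF F2])
    fix e :: real assume e: "e > 0"
    have "(\<lambda>n. K * norm2 (\<lambda>z. trunc (real n) f z - f z)) \<longlonglongrightarrow> K * 0"
      by (intro tendsto_intros tn)
    then have "\<forall>\<^sub>F n in sequentially. K * norm2 (\<lambda>z. trunc (real n) f z - f z) < e / 2"
      using e by (intro order_tendstoD(2)) auto
    then obtain N where N: "\<And>n. n \<ge> N \<Longrightarrow> K * norm2 (\<lambda>z. trunc (real n) f z - f z) < e / 2"
      by (auto simp: eventually_sequentially)
    have "norm2 (\<lambda>z. F m z - F n z) < e" if "m \<ge> N" "n \<ge> N" for m n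
      using d[of "real m" n] N[OF that(1)] N[OF that(2)] by (simp add: F_def[of m] distrib_left)
    then show "\<exists>N. \<forall>m\<ge>N. \<forall>n\<ge>N. norm2 (\<lambda>z. F m z - F n z) < e" by blast
  qed
  then obtain g where g: "L2 g" "(\<lambda>n. norm2 (\<lambda>z. F n z - g z)) \<longlonglongrightarrow> 0" by blast
  have "((\<lambda>R. norm2 (\<lambda>\<zeta>. c * FT1 sg (trunc R f) \<zeta> - g \<zeta>)) \<longlongrightarrow> 0) at_top"
  proof (rule tendsto_at_topI_sequentially)
    fix X :: "nat \<Rightarrow> real" assume X: "filterlim X at_top sequentially"
    show "(\<lambda>n. norm2 (\<lambda>\<zeta>. c * FT1 sg (trunc (X n) f) \<zeta> - g \<zeta>)) \<longlonglongrightarrow> 0"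
    proof (rule Lim_null_comparison[OF always_eventually[OF allI]])
      fix n
      have "norm2 (\<lambda>\<zeta>. c * FT1 sg (trunc (X n) f) \<zeta> - g \<zeta>)
        \<le> norm2 (\<lambda>\<zeta>. c * FT1 sg (trunc (X n) f) \<zeta> - F n \<zeta>) + norm2 (\<lambda>z. F n z - g z)"
        by (intro norm2_triangle_diff FT1_trunc_L2 f F2 g)
      then show "norm (norm2 (\<lambda>\<zeta>. c * FT1 sg (trunc (X n) f) \<zeta> - g \<zeta>))
        \<le> K * (norm2 (\<lambda>z. trunc (X n) f z - f z) + norm2 (\<lambda>z. trunc (real n) f z - f z)) + norm2 (\<lambda>z. F n z - g z)"
        using d[of "X n" n] by simp
    next
      have "(\<lambda>n. K * (norm2 (\<lambda>z. trunc (X n) f z - f z) + norm2 (\<lambda>z. trunc (real n) f z - f z)) + norm2 (\<lambda>z. F n z - g z))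
        \<longlonglongrightarrow> K * (0 + 0) + 0"
        by (intro tendsto_intros t[OF X] tn g(2))
      then show "(\<lambda>n. K * (norm2 (\<lambda>z. trunc (X n) f z - f z) + norm2 (\<lambda>z. trunc (real n) f z - f z)) + norm2 (\<lambda>z. F n z - g z)) \<longlonglongrightarrow> 0"
        by simp
    qed
  qed
  with g(1) show ?thesis by (auto simp: fourier_lim_def)
qed

lemma fourier_lim_unique:
  assumes f: "L2 f" and "fourier_lim sg c f g" "fourier_lim sg c f g'"
  shows "AE z in lborel. g z = g' z"
  by (rule norm2_lim_unique[OF trivial_limit_at_top_linorder FT1_trunc_L2[OF f]])
     (use assms in \<open>auto simp: fourier_lim_def\<close>)

lemma fourier_lim_norm:
  assumes f: "L2 f" and g: "fourier_lim sg c f g"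
  shows "norm2 g = 2 * pi * cmod c * norm2 f"
proof (rule tendsto_unique[OF trivial_limit_at_top_linorder])
  show "((\<lambda>R. norm2 (\<lambda>\<zeta>. c * FT1 sg (trunc R f) \<zeta>)) \<longlongrightarrow> norm2 g) at_top"
    by (rule norm2_tendsto_norm[OF FT1_trunc_L2[OF f]]) (use g in \<open>auto simp: fourier_lim_def\<close>)
  have "((\<lambda>R. 2 * pi * cmod c * norm2 (trunc R f)) \<longlongrightarrow> 2 * pi * cmod c * norm2 f) at_top"
    by (intro tendsto_mult tendsto_const norm2_tendsto_norm trunc_L2 f trunc_tendsto)
  then show "((\<lambda>R. norm2 (\<lambda>\<zeta>. c * FT1 sg (trunc R f) \<zeta>)) \<longlongrightarrow> 2 * pi * cmod c * norm2 f) at_top"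
    by (simp add: norm2_cmult Plancherel_L1_L2(2)[OF trunc_L2[OF f] trunc_integrable[OF f] sg] ac_simps)
qed

lemma fourier_lim_add:
  assumes f: "L2 f" "L2 f'" and g: "fourier_lim sg c f g" "fourier_lim sg c f' g'"
  shows "fourier_lim sg c (\<lambda>z. f z + f' z) (\<lambda>z. g z + g' z)"
  unfolding fourier_lim_def
proof
  have g2: "L2 g" "L2 g'" using g by (auto simp: fourier_lim_def)
  then show "L2 (\<lambda>z. g z + g' z)" by simp
  have eq: "c * FT1 sg (trunc R (\<lambda>z. f z + f' z)) \<zeta> - (g \<zeta> + g' \<zeta>)
    = (c * FT1 sg (trunc R f) \<zeta> - g \<zeta>) + (c * FT1 sg (trunc R f') \<zeta> - g' \<zeta>)" for R \<zeta>
    using f by (simp add: trunc_add FT1_add trunc_integrable algebra_simps)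
  show "((\<lambda>R. norm2 (\<lambda>\<zeta>. c * FT1 sg (trunc R (\<lambda>z. f z + f' z)) \<zeta> - (g \<zeta> + g' \<zeta>))) \<longlongrightarrow> 0) at_top"
    unfolding eq
  proof (rule Lim_null_comparison[OF always_eventually[OF allI]])
    fix R
    show "norm (norm2 (\<lambda>\<zeta>. (c * FT1 sg (trunc R f) \<zeta> - g \<zeta>) + (c * FT1 sg (trunc R f') \<zeta> - g' \<zeta>)))
      \<le> norm2 (\<lambda>\<zeta>. c * FT1 sg (trunc R f) \<zeta> - g \<zeta>) + norm2 (\<lambda>\<zeta>. c * FT1 sg (trunc R f') \<zeta> - g' \<zeta>)"
      using norm2_triangle[OF L2_diff[OF FT1_trunc_L2[OF f(1)] g2(1)] L2_diff[OF FT1_trunc_L2[OF f(2)] g2(2)]] by simp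
  next
    show "((\<lambda>R. norm2 (\<lambda>\<zeta>. c * FT1 sg (trunc R f) \<zeta> - g \<zeta>) + norm2 (\<lambda>\<zeta>. c * FT1 sg (trunc R f') \<zeta> - g' \<zeta>)) \<longlongrightarrow> 0) at_top"
      using g tendsto_add[of _ 0 at_top _ 0] by (auto simp: fourier_lim_def)
  qed
qed

lemma fourier_lim_cmult:
  assumes "fourier_lim sg c f g"
  shows "fourier_lim sg c (\<lambda>z. a * f z) (\<lambda>z. a * g z)"
proof -
  have eq: "c * FT1 sg (trunc R (\<lambda>z. a * f z)) \<zeta> - a * g \<zeta> = a * (c * FT1 sg (trunc R f) \<zeta> - g \<zeta>)" for R \<zeta>
    by (simp add: trunc_cmult FT1_cmult algebra_simps)
  show ?thesis
    using assms tendsto_mult[OF tendsto_const[of "cmod a"]]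
    unfolding fourier_lim_def eq norm2_cmult by fastforce
qed

lemma fourier_lim_L1:
  assumes f: "L2 f" "integrable lborel f"
  shows "fourier_lim sg c f (\<lambda>\<zeta>. c * FT1 sg f \<zeta>)"
  unfolding fourier_lim_def
proof
  show "L2 (\<lambda>\<zeta>. c * FT1 sg f \<zeta>)" by (intro L2_cmult Plancherel_L1_L2 sg f)
  have "((\<lambda>R. 2 * pi * cmod c * norm2 (\<lambda>z. trunc R f z - f z)) \<longlongrightarrow> 2 * pi * cmod c * 0) at_top"
    by (intro tendsto_mult tendsto_const trunc_tendsto f)
  then show "((\<lambda>R. norm2 (\<lambda>\<zeta>. c * FT1 sg (trunc R f) \<zeta> - c * FT1 sg f \<zeta>)) \<longlongrightarrow> 0) at_top"
    by (simp add: FT1_diff_norm[OF trunc_L2[OF f(1)] f(1) trunc_integrable[OF f(1)] f(2)])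
qed

end

section \<open>The selected transforms\<close>

lemma FT1_trunc_cong:
  assumes "f \<in> borel_measurable borel" "g \<in> borel_measurable borel" "AE z in lborel. f z = g z"
  shows "FT1 sg (trunc R f) = FT1 sg (trunc R g)"
proof
  note [measurable] = assms(1,2)
  show "FT1 sg (trunc R f) \<zeta> = FT1 sg (trunc R g) \<zeta>" for \<zeta>
    unfolding FT1_alt
    by (rule integral_cong_AE, measurable, measurable)
       (use assms(3) in \<open>auto simp: trunc_def elim!: eventually_mono\<close>)
qed

text \<open>The selection criterion sees its argument only through integrals of truncations.
  Arguments that agree almost everywhere thus have the same criterion, so \<open>SOME\<close>
  returns the same function: equality holds everywhere.\<close>

lemma fourier_cong_AE:
  assumes "f \<in> borel_measurable borel" "g \<in> borel_measurable borel" "AE z in lborel. f z = g z"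
  shows "fourier f = fourier g" "ifourier f = ifourier g"
  unfolding fourier_alt ifourier_alt fourier_lim_def FT1_trunc_cong[OF assms] by auto

lemma fourier_lim_fourier: "L2 f \<Longrightarrow> fourier_lim (-1) 1 f (fourier f)"
  unfolding fourier_alt by (rule someI_ex[OF fourier_lim_ex]) auto

lemma fourier_lim_ifourier: "L2 f \<Longrightarrow> fourier_lim 1 (complex_of_real (1 / (4 * pi\<^sup>2))) f (ifourier f)"
  unfolding ifourier_alt by (rule someI_ex[OF fourier_lim_ex]) auto

lemma L2_fourier [simp]: "L2 f \<Longrightarrow> L2 (fourier f)" and L2_ifourier [simp]: "L2 f \<Longrightarrow> L2 (ifourier f)"
  using fourier_lim_fourier fourier_lim_ifourier by (auto simp: fourier_lim_def)

lemma norm2_fourier: "L2 f \<Longrightarrow> norm2 (fourier f) = 2 * pi * norm2 f"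
  using fourier_lim_norm[OF _ _ fourier_lim_fourier, of f] by simp

lemma norm2_ifourier: "L2 f \<Longrightarrow> norm2 (ifourier f) = norm2 f / (2 * pi)"
proof -
  assume f: "L2 f"
  have "cmod (complex_of_real (1 / (4 * pi\<^sup>2))) = 1 / (4 * pi\<^sup>2)"
    by (subst norm_of_real) simp
  then show ?thesis
    using fourier_lim_norm[OF _ f fourier_lim_ifourier[OF f]] by (simp add: power2_eq_square)
qed

text \<open>The selection need not be additive on representatives; uniqueness of the mean limit
  gives additivity outside a null set.\<close>

lemma fourier_add:
  assumes "L2 f" "L2 g"
  shows "AE z in lborel. fourier (\<lambda>z. f z + g z) z = fourier f z + fourier g z"
    and "AE z in lborel. ifourier (\<lambda>z. f z + g z) z = ifourier f z + ifourier g z"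
  using assms
  by (auto intro!: fourier_lim_unique[OF _ _ fourier_lim_fourier fourier_lim_add] fourier_lim_unique[OF _ _ fourier_lim_ifourier fourier_lim_add] fourier_lim_fourier fourier_lim_ifourier)

lemma fourier_cmult:
  assumes "L2 f"
  shows "AE z in lborel. fourier (\<lambda>z. a * f z) z = a * fourier f z"
    and "AE z in lborel. ifourier (\<lambda>z. a * f z) z = a * ifourier f z"
  using assms
  by (auto intro!: fourier_lim_unique[OF _ _ fourier_lim_fourier fourier_lim_cmult] fourier_lim_unique[OF _ _ fourier_lim_ifourier fourier_lim_cmult] fourier_lim_fourier fourier_lim_ifourier)

lemma fourier_diff:
  assumes "L2 f" "L2 g"
  shows "AE z in lborel. fourier (\<lambda>z. f z - g z) z = fourier f z - fourier g z"
    and "AE z in lborel. ifourier (\<lambda>z. f z - g z) z = ifourier f z - ifourier g z"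
proof -
  have *: "L2 (\<lambda>z. (-1) * g z)" by (rule L2_cmult[OF assms(2)])
  from fourier_add(1)[OF assms(1) *] fourier_cmult(1)[OF assms(2), of "-1"]
  show "AE z in lborel. fourier (\<lambda>z. f z - g z) z = fourier f z - fourier g z"
    by eventually_elim simp
  from fourier_add(2)[OF assms(1) *] fourier_cmult(2)[OF assms(2), of "-1"]
  show "AE z in lborel. ifourier (\<lambda>z. f z - g z) z = ifourier f z - ifourier g z"
    by eventually_elim simp
qed

lemma norm2_fourier_diff:
  assumes "L2 f" "L2 g"
  shows "norm2 (\<lambda>z. fourier f z - fourier g z) = 2 * pi * norm2 (\<lambda>z. f z - g z)"
    and "norm2 (\<lambda>z. ifourier f z - ifourier g z) = norm2 (\<lambda>z. f z - g z) / (2 * pi)"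
proof -
  note [measurable] = L2_measurable[OF L2_fourier[OF assms(1)]] L2_measurable[OF L2_fourier[OF assms(2)]]
    L2_measurable[OF L2_ifourier[OF assms(1)]] L2_measurable[OF L2_ifourier[OF assms(2)]]
  have "norm2 (\<lambda>z. fourier f z - fourier g z) = norm2 (fourier (\<lambda>z. f z - g z))"
    by (rule L2_cong_AE(2)) (use assms fourier_diff(1)[OF assms] in \<open>auto elim!: eventually_mono\<close>)
  then show "norm2 (\<lambda>z. fourier f z - fourier g z) = 2 * pi * norm2 (\<lambda>z. f z - g z)"
    using assms by (simp add: norm2_fourier)
  have "norm2 (\<lambda>z. ifourier f z - ifourier g z) = norm2 (ifourier (\<lambda>z. f z - g z))"
    by (rule L2_cong_AE(2)) (use assms fourier_diff(2)[OF assms] in \<open>auto elim!: eventually_mono\<close>)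
  then show "norm2 (\<lambda>z. ifourier f z - ifourier g z) = norm2 (\<lambda>z. f z - g z) / (2 * pi)"
    using assms by (simp add: norm2_ifourier)
qed

lemma ifourier_L1:
  assumes "L2 f" "integrable lborel f"
  shows "AE z in lborel. ifourier f z = complex_of_real (1 / (4 * pi\<^sup>2)) * FT1 1 f z"
  by (rule fourier_lim_unique[OF _ _ fourier_lim_ifourier fourier_lim_L1]) (use assms in auto)

section \<open>Inner products and Fourier inversion\<close>

abbreviation ip :: "(real \<times> real \<Rightarrow> complex) \<Rightarrow> (real \<times> real \<Rightarrow> complex) \<Rightarrow> complex" where
  "ip f g \<equiv> \<integral>z. f z * cnj (g z) \<partial>lborel"

lemma ip_bound: "L2 f \<Longrightarrow> L2 g \<Longrightarrow> cmod (ip f g) \<le> norm2 f * norm2 g"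
  using integral_norm_bound[of lborel "\<lambda>z. f z * cnj (g z)"] L2_mult_integrable(2)[of f g]
  by (simp add: norm_mult)

lemma ip_self: "ip f f = complex_of_real ((norm2 f)\<^sup>2)"
  unfolding norm2_power2 integral_complex_of_real[symmetric]
  by (rule Bochner_Integration.integral_cong[OF refl]) (rule complex_norm_square[symmetric])

lemma ip_tendsto:
  assumes F: "\<And>n. L2 (F n)" "L2 f" "((\<lambda>n. norm2 (\<lambda>z. F n z - f z)) \<longlongrightarrow> 0) A"
    and G: "\<And>n. L2 (G n)" "L2 g" "((\<lambda>n. norm2 (\<lambda>z. G n z - g z)) \<longlongrightarrow> 0) A"
  shows "((\<lambda>n. ip (F n) (G n)) \<longlongrightarrow> ip f g) A"
proof -
  have eq: "ip (F n) (G n) - ip f g = ip (\<lambda>z. F n z - f z) (G n) + ip f (\<lambda>z. G n z - g z)" for n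
    using F G by (simp add: L2_mult_integrable(1) left_diff_distrib right_diff_distrib)
  have "((\<lambda>n. ip (F n) (G n) - ip f g) \<longlongrightarrow> 0) A"
    unfolding eq
  proof (rule Lim_null_comparison[OF always_eventually[OF allI]])
    fix n
    show "norm (ip (\<lambda>z. F n z - f z) (G n) + ip f (\<lambda>z. G n z - g z))
        \<le> norm2 (\<lambda>z. F n z - f z) * norm2 (G n) + norm2 f * norm2 (\<lambda>z. G n z - g z)"
      using F G by (intro norm_triangle_mono ip_bound L2_diff)
    have "((\<lambda>n. norm2 (\<lambda>z. F n z - f z) * norm2 (G n) + norm2 f * norm2 (\<lambda>z. G n z - g z)) \<longlongrightarrow> 0 * norm2 g + norm2 f * 0) A"
      using F G by (intro tendsto_add tendsto_mult tendsto_const norm2_tendsto_norm)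
    then show "((\<lambda>n. norm2 (\<lambda>z. F n z - f z) * norm2 (G n) + norm2 f * norm2 (\<lambda>z. G n z - g z)) \<longlongrightarrow> 0) A"
      by simp
  qed
  then show ?thesis by (simp add: LIM_zero_iff)
qed

text \<open>Conjugation turns the backward kernel into the forward one, so for truncations this is
  the multiplication formula; both sides are continuous in the mean. The factor
  \<open>4 * pi\<^sup>2\<close> cancels the normalisation of \<open>ifourier\<close>.\<close>

lemma ip_fourier:
  assumes f: "L2 f" and g: "L2 g"
  shows "ip (fourier f) g = complex_of_real (4 * pi\<^sup>2) * ip f (ifourier g)"
proof -
  define c where "c = complex_of_real (1 / (4 * pi\<^sup>2))"
  have c0: "complex_of_real (4 * pi\<^sup>2) * cnj c = 1" by (simp add: c_def)
  have F: "fourier_lim (-1) 1 f (fourier f)" "fourier_lim 1 c g (ifourier g)"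
    using fourier_lim_fourier[OF f] fourier_lim_ifourier[OF g] by (auto simp: c_def)
  have eq: "ip (\<lambda>\<zeta>. 1 * FT1 (-1) (trunc R f) \<zeta>) (trunc R g)
    = complex_of_real (4 * pi\<^sup>2) * ip (trunc R f) (\<lambda>\<zeta>. c * FT1 1 (trunc R g) \<zeta>)" for R
  proof -
    have cn: "cnj (FT1 1 (trunc R g) z) = FT1 (-1) (\<lambda>z. cnj (trunc R g z)) z" for z
      unfolding FT1_alt by (simp add: cis_cnj flip: Bochner_Integration.integral_cnj)
    have gi: "integrable lborel (\<lambda>z. cnj (trunc R g z))"
      using trunc_integrable[OF g] by simp
    have "ip (\<lambda>\<zeta>. 1 * FT1 (-1) (trunc R f) \<zeta>) (trunc R g)
      = (\<integral>\<zeta>. cnj (trunc R g \<zeta>) * FT1 (-1) (trunc R f) \<zeta> \<partial>lborel)"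
      by (simp add: mult.commute)
    also have "\<dots> = (\<integral>z. trunc R f z * cnj (FT1 1 (trunc R g) z) \<partial>lborel)"
      unfolding cn by (rule FT1_multiplication_formula[OF trunc_integrable[OF f] gi])
    also have "\<dots> = (complex_of_real (4 * pi\<^sup>2) * cnj c) * (\<integral>z. trunc R f z * cnj (FT1 1 (trunc R g) z) \<partial>lborel)"
      unfolding c0 by simp
    also have "\<dots> = complex_of_real (4 * pi\<^sup>2) * (\<integral>z. cnj c * (trunc R f z * cnj (FT1 1 (trunc R g) z)) \<partial>lborel)"
      by (simp only: mult.assoc integral_mult_right_zero)
    also have "\<dots> = complex_of_real (4 * pi\<^sup>2) * ip (trunc R f) (\<lambda>\<zeta>. c * FT1 1 (trunc R g) \<zeta>)"
      by (simp only: complex_cnj_mult ac_simps)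
    finally show ?thesis .
  qed
  have l1: "((\<lambda>R. ip (\<lambda>\<zeta>. 1 * FT1 (-1) (trunc R f) \<zeta>) (trunc R g)) \<longlongrightarrow> ip (fourier f) g) at_top"
    using F by (intro ip_tendsto FT1_trunc_L2 trunc_L2 trunc_tendsto f g) (auto simp: fourier_lim_def)
  have l2: "((\<lambda>R. complex_of_real (4 * pi\<^sup>2) * ip (trunc R f) (\<lambda>\<zeta>. c * FT1 1 (trunc R g) \<zeta>))
      \<longlongrightarrow> complex_of_real (4 * pi\<^sup>2) * ip f (ifourier g)) at_top"
    using F by (intro tendsto_mult tendsto_const ip_tendsto FT1_trunc_L2 trunc_L2 trunc_tendsto f g) (auto simp: fourier_lim_def)
  show ?thesis
    using tendsto_unique[OF trivial_limit_at_top_linorder l1] l2 unfolding eq by blast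
qed

lemma norm2_diff_power2:
  assumes "L2 f" "L2 g"
  shows "(norm2 (\<lambda>z. f z - g z))\<^sup>2 = (norm2 f)\<^sup>2 - 2 * Re (ip f g) + (norm2 g)\<^sup>2"
proof -
  have "complex_of_real ((norm2 (\<lambda>z. f z - g z))\<^sup>2) = ip f f - ip f g - ip g f + ip g g"
    unfolding ip_self[symmetric]
    using assms by (simp add: L2_mult_integrable(1) left_diff_distrib right_diff_distrib)
  moreover have "ip g f = cnj (ip f g)"
    by (simp add: mult.commute flip: Bochner_Integration.integral_cnj)
  ultimately have "complex_of_real ((norm2 (\<lambda>z. f z - g z))\<^sup>2)
      = complex_of_real ((norm2 f)\<^sup>2) - (ip f g + cnj (ip f g)) + complex_of_real ((norm2 g)\<^sup>2)"
    by (simp only: ip_self) simp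
  then have "complex_of_real ((norm2 (\<lambda>z. f z - g z))\<^sup>2)
      = complex_of_real ((norm2 f)\<^sup>2 - 2 * Re (ip f g) + (norm2 g)\<^sup>2)"
    by (simp only: complex_add_cnj) simp
  then show ?thesis using of_real_eq_iff by blast
qed

text \<open>The equality case of Cauchy-Schwarz: expanding the square of the distance gives 0.
  Inversion is an instance, since adjointness computes the inner product and Plancherel the
  norms.\<close>

lemma L2_eq_AE:
  assumes "L2 f" "L2 g" "norm2 f = norm2 g" "Re (ip f g) = (norm2 f)\<^sup>2"
  shows "AE z in lborel. f z = g z"
proof -
  have "norm2 (\<lambda>z. f z - g z) = 0"
    using norm2_diff_power2[OF assms(1,2)] assms(3,4) by simp
  from norm2_zero_AE[OF _ this] show ?thesis using assms by simp
qed

lemma ifourier_fourier: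
  assumes "L2 f" shows "AE z in lborel. ifourier (fourier f) z = f z"
proof -
  have "complex_of_real (4 * pi\<^sup>2) * ip f (ifourier (fourier f)) = complex_of_real ((norm2 (fourier f))\<^sup>2)"
    using ip_fourier[OF assms L2_fourier[OF assms]] by (simp only: ip_self)
  also have "\<dots> = complex_of_real (4 * pi\<^sup>2) * complex_of_real ((norm2 f)\<^sup>2)"
    using assms by (simp add: norm2_fourier power_mult_distrib)
  finally have "ip f (ifourier (fourier f)) = complex_of_real ((norm2 f)\<^sup>2)" by simp
  then have "AE z in lborel. f z = ifourier (fourier f) z"
    using assms by (intro L2_eq_AE) (auto simp: norm2_fourier norm2_ifourier)
  then show ?thesis by eventually_elim simp
qed

lemma fourier_ifourier:
  assumes "L2 f" shows "AE z in lborel. fourier (ifourier f) z = f z"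
proof -
  have "ip (fourier (ifourier f)) f = complex_of_real (4 * pi\<^sup>2) * complex_of_real ((norm2 (ifourier f))\<^sup>2)"
    using ip_fourier[OF L2_ifourier[OF assms] assms] by (simp only: ip_self)
  also have "\<dots> = complex_of_real ((norm2 f)\<^sup>2)"
    unfolding of_real_mult[symmetric] of_real_eq_iff
    using assms by (simp add: norm2_ifourier power_divide power_mult_distrib)
  finally show ?thesis
    using assms by (intro L2_eq_AE) (auto simp: norm2_fourier norm2_ifourier)
qed

section \<open>The Stein derivative kernel\<close>

text \<open>Division by zero gives \<open>kern a 0 = 0\<close>, so the kernel is a nonnegative
  function on the whole line.\<close>

definition kern :: "real \<Rightarrow> real \<Rightarrow> real" where
  "kern a \<tau> = 1 / \<bar>\<tau>\<bar> powr (1 + a)"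

lemma kern_nonneg [simp]: "0 \<le> kern a \<tau>" and kern_minus [simp]: "kern a (- \<tau>) = kern a \<tau>"
  and kern_measurable [measurable]: "kern a \<in> borel_measurable borel"
  by (simp_all add: kern_def[abs_def])

lemma kern_scale: "L > 0 \<Longrightarrow> kern a (\<tau> / L) = L powr (1 + a) * kern a \<tau>"
  by (simp add: kern_def powr_divide abs_mult)

text \<open>The integrand behaves like \<open>\<bar>\<tau>\<bar> powr (- a)\<close> at 0 and like
  \<open>\<bar>\<tau>\<bar> powr (- 1 - a)\<close> at infinity, so each end uses one of the two
  bounds on a.\<close>

lemma min_kern_integrable:
  assumes a: "0 < a" "a < 1"
  shows "integrable lborel (\<lambda>\<tau>. min 1 \<bar>\<tau>\<bar> * kern a \<tau>)"
proof -
  \<comment> \<open>A majorant on the positive half-line that vanishes on the negative one; adding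
    its reflection covers the line.\<close>
  define G where "G \<tau> = indicator {0..1} \<tau> * \<tau> powr (- a) + indicator {1..} \<tau> * \<tau> powr (- 1 - a)" for \<tau> :: real
  have [measurable]: "G \<in> borel_measurable borel" unfolding G_def by measurable
  have G0: "0 \<le> G \<tau>" for \<tau> by (simp add: G_def)
  have le: "min 1 \<bar>\<tau>\<bar> * kern a \<tau> \<le> G \<tau>" if "\<tau> \<ge> 0" for \<tau>
  proof (cases "\<tau> \<le> 1")
    case True
    then have "min 1 \<bar>\<tau>\<bar> * kern a \<tau> = indicator {0..1} \<tau> * \<tau> powr (- a)"
      using that by (cases "\<tau> = 0") (auto simp: kern_def powr_add powr_minus field_simps)
    then show ?thesis by (simp add: G_def)
  next
    case False
    then have "min 1 \<bar>\<tau>\<bar> * kern a \<tau> = indicator {1..} \<tau> * \<tau> powr (- 1 - a)"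
      by (simp add: kern_def powr_minus powr_diff powr_add field_simps)
    then show ?thesis by (simp add: G_def)
  qed
  have le': "min 1 \<bar>\<tau>\<bar> * kern a \<tau> \<le> G \<tau> + G (- \<tau>)" for \<tau>
    using le[of \<tau>] le[of "- \<tau>"] G0[of \<tau>] G0[of "- \<tau>"] by (cases "\<tau> \<ge> 0") auto
  have "(\<integral>\<^sup>+\<tau>. ennreal (G \<tau>) \<partial>lborel)
      = (\<integral>\<^sup>+\<tau>. ennreal (indicator {0..1} \<tau> * \<tau> powr (- a)) \<partial>lborel) + (\<integral>\<^sup>+\<tau>. ennreal (indicator {1..} \<tau> * \<tau> powr (- 1 - a)) \<partial>lborel)"
    unfolding G_def by (subst nn_integral_add[symmetric]) (auto simp: ennreal_plus)
  also have "(\<integral>\<^sup>+\<tau>. ennreal (indicator {0..1} \<tau> * \<tau> powr (- a)) \<partial>lborel) = ennreal (1 powr (- a + 1) / (- a + 1))"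
    by (rule nn_integral_has_integral_lebesgue) (use a has_integral_powr_from_0[of "- a" 1] in auto)
  also have "(\<integral>\<^sup>+\<tau>. ennreal (indicator {1..} \<tau> * \<tau> powr (- 1 - a)) \<partial>lborel) = ennreal (- (1 powr (- 1 - a + 1) / (- 1 - a + 1)))"
    by (rule nn_integral_has_integral_lebesgue) (use a has_integral_powr_to_inf[of "- 1 - a" 1] in auto)
  finally have Gfin: "(\<integral>\<^sup>+\<tau>. ennreal (G \<tau>) \<partial>lborel) < \<infinity>" by simp
  have "(\<integral>\<^sup>+\<tau>. ennreal (G (- \<tau>)) \<partial>lborel) = (\<integral>\<^sup>+\<tau>. ennreal (G \<tau>) \<partial>lborel)"
    using nn_integral_real_affine[of "\<lambda>\<tau>. ennreal (G \<tau>)" "-1" 0] by simp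
  with Gfin have "(\<integral>\<^sup>+\<tau>. ennreal (G \<tau>) + ennreal (G (- \<tau>)) \<partial>lborel) < \<infinity>"
    by (subst nn_integral_add) auto
  moreover have "(\<integral>\<^sup>+\<tau>. ennreal (min 1 \<bar>\<tau>\<bar> * kern a \<tau>) \<partial>lborel) \<le> (\<integral>\<^sup>+\<tau>. ennreal (G \<tau>) + ennreal (G (- \<tau>)) \<partial>lborel)"
    by (rule nn_integral_mono) (use le' G0 in \<open>simp flip: ennreal_plus add: ennreal_leI\<close>)
  ultimately have "(\<integral>\<^sup>+\<tau>. ennreal (min 1 \<bar>\<tau>\<bar> * kern a \<tau>) \<partial>lborel) < \<infinity>" by (rule le_less_trans[rotated])
  then show ?thesis
    unfolding integrable_iff_bounded by (auto simp: abs_mult)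
qed

definition Jconst :: "real \<Rightarrow> real" where
  "Jconst a = (\<integral>\<tau>. min 1 \<bar>\<tau>\<bar> * kern a \<tau> \<partial>lborel)"

lemma Jconst_nonneg [simp]: "0 \<le> Jconst a"
  by (simp add: Jconst_def)

text \<open>Substituting \<open>\<tau> / L\<close> for \<tau> extracts \<open>L powr (1 + a)\<close>
  from the kernel and \<open>1 / L\<close> from the measure. At \<open>L = 0\<close> both sides
  vanish, as \<open>0 powr a = 0\<close>.\<close>

lemma nn_integral_min_kern:
  assumes a: "0 < a" "a < 1" and L: "L \<ge> 0"
  shows "(\<integral>\<^sup>+\<tau>. ennreal (min 1 (L * \<bar>\<tau>\<bar>) * kern a \<tau>) \<partial>lborel) = ennreal (L powr a * Jconst a)"
proof (cases "L = 0")
  case False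
  with L have L: "L > 0" by simp
  have "(\<integral>\<^sup>+\<tau>. ennreal (min 1 (L * \<bar>\<tau>\<bar>) * kern a \<tau>) \<partial>lborel)
      = ennreal \<bar>1 / L\<bar> * (\<integral>\<^sup>+\<tau>. ennreal (min 1 (L * \<bar>0 + 1 / L * \<tau>\<bar>) * kern a (0 + 1 / L * \<tau>)) \<partial>lborel)"
    by (rule nn_integral_real_affine) (use L in auto)
  also have "\<dots> = ennreal (1 / L) * (\<integral>\<^sup>+\<tau>. ennreal (L powr (1 + a)) * ennreal (min 1 \<bar>\<tau>\<bar> * kern a \<tau>) \<partial>lborel)"
    using L kern_scale[OF L, of a]
    by (intro arg_cong2[of _ _ _ _ "(*)"] nn_integral_cong) (auto simp: abs_mult ac_simps simp flip: ennreal_mult)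
  also have "\<dots> = ennreal (1 / L) * (ennreal (L powr (1 + a)) * ennreal (Jconst a))"
    by (simp add: nn_integral_cmult Jconst_def nn_integral_eq_integral[OF min_kern_integrable[OF a]])
  also have "\<dots> = ennreal (L powr a * Jconst a)"
    using L by (simp add: powr_add flip: ennreal_mult)
  finally show ?thesis .
qed (use a in simp)

lemma integrable_min_kern:
  assumes a: "0 < a" "a < 1" and L: "L \<ge> 0"
  shows "integrable lborel (\<lambda>\<tau>. min 1 (L * \<bar>\<tau>\<bar>) * kern a \<tau>)"
    and "(\<integral>\<tau>. min 1 (L * \<bar>\<tau>\<bar>) * kern a \<tau> \<partial>lborel) = L powr a * Jconst a"
proof -
  show I: "integrable lborel (\<lambda>\<tau>. min 1 (L * \<bar>\<tau>\<bar>) * kern a \<tau>)"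
    unfolding integrable_iff_bounded using nn_integral_min_kern[OF a L] L by (auto simp: abs_mult)
  have "ennreal (\<integral>\<tau>. min 1 (L * \<bar>\<tau>\<bar>) * kern a \<tau> \<partial>lborel) = ennreal (L powr a * Jconst a)"
    using nn_integral_min_kern[OF a L] nn_integral_eq_integral[OF I] L by simp
  then show "(\<integral>\<tau>. min 1 (L * \<bar>\<tau>\<bar>) * kern a \<tau> \<partial>lborel) = L powr a * Jconst a"
    using L by (subst (asm) ennreal_inj) auto
qed

section \<open>The truncated kernel and its multiplier\<close>

definition trunc_kern :: "real \<Rightarrow> real \<Rightarrow> real \<Rightarrow> real" where
  "trunc_kern a \<epsilon> \<tau> = indicator {\<tau>. \<epsilon> \<le> \<bar>\<tau>\<bar>} \<tau> * kern a \<tau>"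

lemma trunc_kern_nonneg [simp]: "0 \<le> trunc_kern a \<epsilon> \<tau>" and trunc_kern_le: "trunc_kern a \<epsilon> \<tau> \<le> kern a \<tau>"
  and trunc_kern_measurable [measurable]: "trunc_kern a \<epsilon> \<in> borel_measurable borel"
  by (auto simp: trunc_kern_def[abs_def] indicator_def)

text \<open>Where the truncated kernel does not vanish,
  \<open>\<bar>\<tau>\<bar> / \<epsilon>\<close> is at least 1, so the integrand with
  \<open>L = 1 / \<epsilon>\<close> is a majorant.\<close>

lemma trunc_kern_integrable:
  assumes a: "0 < a" "a < 1" and \<epsilon>: "\<epsilon> > 0"
  shows "integrable lborel (trunc_kern a \<epsilon>)"
proof (rule Bochner_Integration.integrable_bound[OF integrable_min_kern(1)[OF a, of "1 / \<epsilon>"]])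
  show "AE \<tau> in lborel. norm (trunc_kern a \<epsilon> \<tau>) \<le> norm (min 1 (1 / \<epsilon> * \<bar>\<tau>\<bar>) * kern a \<tau>)"
    using \<epsilon> by (intro AE_I2) (auto simp: trunc_kern_def indicator_def min_def)
qed (use \<epsilon> in auto)

lemma trunc_kern_tendsto:
  assumes "\<tau> \<noteq> 0"
  shows "((\<lambda>\<epsilon>. trunc_kern a \<epsilon> \<tau>) \<longlongrightarrow> kern a \<tau>) (at_right 0)"
proof (rule tendsto_eventually)
  have "\<forall>\<^sub>F \<epsilon> in at_right 0. \<epsilon> < \<bar>\<tau>\<bar>"
    using assms eventually_at_right_real[of 0 "\<bar>\<tau>\<bar>"] by (auto elim!: eventually_mono)
  then show "\<forall>\<^sub>F \<epsilon> in at_right 0. trunc_kern a \<epsilon> \<tau> = kern a \<tau>"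
    by eventually_elim (simp add: trunc_kern_def)
qed

lemma cmod_cis_diff_le: "cmod (cis x - 1) \<le> 2 * min 1 \<bar>x\<bar>"
proof -
  have "cmod (cis x - 1) \<le> 2" using norm_triangle_ineq4[of "cis x" 1] by simp
  moreover have "cmod (cis x - 1) \<le> \<bar>x\<bar>"
    using iexp_approx1[of x 0] by (simp add: cis_conv_exp)
  ultimately show ?thesis by (auto simp: min_def)
qed

text \<open>The strict sign permits division by the normalising constant. It is negative because the
  real part of \<open>cis \<tau> - 1\<close> is \<open>- (1 - cos \<tau>)\<close>.\<close>

lemma d_const_nonzero:
  assumes a: "0 < a" "a < 1"
  shows "d_const a < 0" "integrable lborel (\<lambda>\<tau>. (1 - cos \<tau>) * kern a \<tau>)"
    "d_const a = - (\<integral>\<tau>. (1 - cos \<tau>) * kern a \<tau> \<partial>lborel)"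
proof -
  have b: "\<bar>1 - cos \<tau>\<bar> \<le> 2 * min 1 \<bar>\<tau>\<bar>" for \<tau> :: real
    using order_trans[OF abs_Re_le_cmod cmod_cis_diff_le[of \<tau>]] by (simp add: abs_minus_commute)
  show I: "integrable lborel (\<lambda>\<tau>. (1 - cos \<tau>) * kern a \<tau>)"
    by (rule Bochner_Integration.integrable_bound[OF integrable_mult_right[OF min_kern_integrable[OF a], of 2]])
       (use b in \<open>auto simp: abs_mult mult.assoc[symmetric] intro!: mult_right_mono\<close>)
  show eq: "d_const a = - (\<integral>\<tau>. (1 - cos \<tau>) * kern a \<tau> \<partial>lborel)"
    by (simp add: d_const_def kern_def)
  \<comment> \<open>A lower bound for the integrand on \<open>{1..2}\<close>: cosine decreases there
    because 2 is less than pi, and the kernel is smallest at 2.\<close>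
  define m where "m = (1 - cos 1) * (1 / 2 powr (1 + a))"
  have "cos (1::real) < cos 0" using pi_gt3 by (intro cos_monotone_0_pi) auto
  then have m: "m > 0" by (simp add: m_def)
  have "(\<integral>\<tau>. indicator {1..2::real} \<tau> * m \<partial>lborel) \<le> (\<integral>\<tau>. (1 - cos \<tau>) * kern a \<tau> \<partial>lborel)"
  proof (rule integral_mono[OF _ I])
    show "indicator {1..2} \<tau> * m \<le> (1 - cos \<tau>) * kern a \<tau>" for \<tau> :: real
    proof (cases "\<tau> \<in> {1..2}")
      case True
      then have "cos \<tau> \<le> cos 1" using pi_gt3 by (intro cos_monotone_0_pi_le) auto
      moreover have "1 / 2 powr (1 + a) \<le> kern a \<tau>"
        using True a unfolding kern_def by (intro divide_left_mono powr_mono2) auto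
      ultimately have "m \<le> (1 - cos \<tau>) * kern a \<tau>"
        unfolding m_def by (intro mult_mono) auto
      then show ?thesis using True by simp
    qed (simp add: cos_le_one)
  qed simp
  moreover have "(\<integral>\<tau>. indicator {1..2::real} \<tau> * m \<partial>lborel) = m" by simp
  ultimately show "d_const a < 0" using m eq by simp
qed

text \<open>The physical-side symbol, before division by \<open>d_const a\<close>, of the Stein
  derivative truncated at \<epsilon>: shifting the frequency by \<tau> multiplies the inverse
  transform by \<open>cis (- \<tau> * x)\<close>.\<close>

definition stein_mult :: "real \<Rightarrow> real \<Rightarrow> real \<Rightarrow> complex" where
  "stein_mult a \<epsilon> x = (\<integral>\<tau>. complex_of_real (trunc_kern a \<epsilon> \<tau>) * (cis (- \<tau> * x) - 1) \<partial>lborel)"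

text \<open>Reflection of \<tau> cancels the odd sine part, and scaling by
  \<open>\<bar>x\<bar>\<close> reduces the cosine part to the integral that defines
  \<open>d_const\<close>. Division by \<open>d_const a\<close> therefore produces exactly
  \<open>\<bar>x\<bar> powr a\<close>.\<close>

lemma kern_cis_integral:
  assumes a: "0 < a" "a < 1"
  shows "integrable lborel (\<lambda>\<tau>. complex_of_real (kern a \<tau>) * (cis (- \<tau> * x) - 1))"
    and "(\<integral>\<tau>. complex_of_real (kern a \<tau>) * (cis (- \<tau> * x) - 1) \<partial>lborel) = complex_of_real (d_const a * \<bar>x\<bar> powr a)"
proof -
  have I: "integrable lborel (\<lambda>\<tau>. complex_of_real (kern a \<tau>) * (cis (\<tau> * x) - 1))" for x
  proof (rule Bochner_Integration.integrable_bound[OF integrable_mult_right[OF integrable_min_kern(1)[OF a, of "\<bar>x\<bar>"], of 2]])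
    show "AE \<tau> in lborel. norm (complex_of_real (kern a \<tau>) * (cis (\<tau> * x) - 1)) \<le> norm (2 * (min 1 (\<bar>x\<bar> * \<bar>\<tau>\<bar>) * kern a \<tau>))"
    proof (rule AE_I2)
      fix \<tau>
      have "cmod (cis (\<tau> * x) - 1) * kern a \<tau> \<le> 2 * min 1 (\<bar>x\<bar> * \<bar>\<tau>\<bar>) * kern a \<tau>"
        using cmod_cis_diff_le[of "\<tau> * x"] by (intro mult_right_mono) (auto simp: abs_mult mult.commute)
      then show "norm (complex_of_real (kern a \<tau>) * (cis (\<tau> * x) - 1)) \<le> norm (2 * (min 1 (\<bar>x\<bar> * \<bar>\<tau>\<bar>) * kern a \<tau>))"
        by (simp add: norm_mult abs_mult mult.commute)
    qed
  qed auto
  from I[of "-x"] show I': "integrable lborel (\<lambda>\<tau>. complex_of_real (kern a \<tau>) * (cis (- \<tau> * x) - 1))" by simp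
  define M where "M = (\<integral>\<tau>. complex_of_real (kern a \<tau>) * (cis (- \<tau> * x) - 1) \<partial>lborel)"
  have M': "M = (\<integral>\<tau>. complex_of_real (kern a \<tau>) * (cis (\<tau> * x) - 1) \<partial>lborel)"
    unfolding M_def by (subst lborel_integral_real_affine[of "-1" _ 0]) auto
  have "M + M = (\<integral>\<tau>. complex_of_real (kern a \<tau>) * (cis (- \<tau> * x) - 1) + complex_of_real (kern a \<tau>) * (cis (\<tau> * x) - 1) \<partial>lborel)"
    unfolding Bochner_Integration.integral_add[OF I' I] M_def[symmetric] M'[symmetric] ..
  also have "\<dots> = (\<integral>\<tau>. complex_of_real (2 * (kern a \<tau> * (cos (\<tau> * x) - 1))) \<partial>lborel)"
    by (rule Bochner_Integration.integral_cong[OF refl]) (simp add: complex_eq_iff algebra_simps)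
  also have "\<dots> = complex_of_real (2 * (\<integral>\<tau>. kern a \<tau> * (cos (\<tau> * x) - 1) \<partial>lborel))"
    by (simp only: integral_complex_of_real integral_mult_right_zero)
  finally have M: "M = complex_of_real (\<integral>\<tau>. kern a \<tau> * (cos (\<tau> * x) - 1) \<partial>lborel)" by simp
  have "(\<integral>\<tau>. kern a \<tau> * (cos (\<tau> * x) - 1) \<partial>lborel) = d_const a * \<bar>x\<bar> powr a"
  proof (cases "x = 0")
    case False
    define L where "L = \<bar>x\<bar>"
    have L: "L > 0" using False by (simp add: L_def)
    have c: "cos (\<tau> * x) = cos (\<tau> * L)" for \<tau> by (auto simp: L_def abs_if)
    have "(\<integral>\<tau>. kern a \<tau> * (cos (\<tau> * x) - 1) \<partial>lborel)
      = (1 / L) * (\<integral>\<tau>. kern a (\<tau> / L) * (cos \<tau> - 1) \<partial>lborel)"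
      using L unfolding c by (subst lborel_integral_real_affine[of "1 / L" _ 0]) auto
    also have "\<dots> = (1 / L) * (\<integral>\<tau>. (- (L powr (1 + a))) * ((1 - cos \<tau>) * kern a \<tau>) \<partial>lborel)"
      unfolding kern_scale[OF L] by (simp add: algebra_simps)
    also have "\<dots> = (1 / L) * (L powr (1 + a) * d_const a)"
      unfolding integral_mult_right_zero d_const_nonzero(3)[OF a] by simp
    also have "\<dots> = d_const a * L powr a" using L by (simp add: powr_add)
    finally show ?thesis by (simp add: L_def)
  qed (use a in simp)
  with M show "(\<integral>\<tau>. complex_of_real (kern a \<tau>) * (cis (- \<tau> * x) - 1) \<partial>lborel) = complex_of_real (d_const a * \<bar>x\<bar> powr a)"
    by (simp add: M_def)
qed

text \<open>Uniform in \<epsilon>: it makes \<open>\<bar>x\<bar> powr a * u\<close> a majorant for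
  all truncated multipliers applied to u, up to a constant.\<close>

lemma stein_mult_bound:
  assumes a: "0 < a" "a < 1"
  shows "cmod (stein_mult a \<epsilon> x) \<le> 2 * Jconst a * \<bar>x\<bar> powr a"
proof -
  have "cmod (stein_mult a \<epsilon> x) \<le> (\<integral>\<tau>. 2 * (min 1 (\<bar>x\<bar> * \<bar>\<tau>\<bar>) * kern a \<tau>) \<partial>lborel)"
    unfolding stein_mult_def
  proof (rule Bochner_Integration.integral_norm_bound_integral)
    show I: "integrable lborel (\<lambda>\<tau>. 2 * (min 1 (\<bar>x\<bar> * \<bar>\<tau>\<bar>) * kern a \<tau>))"
      using integrable_min_kern(1)[OF a, of "\<bar>x\<bar>"] by simp
    show b: "norm (complex_of_real (trunc_kern a \<epsilon> \<tau>) * (cis (- \<tau> * x) - 1)) \<le> 2 * (min 1 (\<bar>x\<bar> * \<bar>\<tau>\<bar>) * kern a \<tau>)" for \<tau>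
    proof -
      have "trunc_kern a \<epsilon> \<tau> * cmod (cis (- \<tau> * x) - 1) \<le> kern a \<tau> * (2 * min 1 (\<bar>x\<bar> * \<bar>\<tau>\<bar>))"
        using cmod_cis_diff_le[of "- \<tau> * x"] by (intro mult_mono trunc_kern_le) (auto simp: abs_mult mult.commute)
      then show ?thesis by (simp add: norm_mult mult.commute mult.left_commute)
    qed
    show "integrable lborel (\<lambda>\<tau>. complex_of_real (trunc_kern a \<epsilon> \<tau>) * (cis (- \<tau> * x) - 1))"
      by (rule Bochner_Integration.integrable_bound[OF I]) (use b in \<open>auto intro: order_trans[OF _ abs_ge_self]\<close>)
  qed
  also have "\<dots> = 2 * Jconst a * \<bar>x\<bar> powr a"
    using integrable_min_kern(2)[OF a, of "\<bar>x\<bar>"] by simp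
  finally show ?thesis .
qed

lemma stein_mult_tendsto:
  assumes a: "0 < a" "a < 1" and X: "filterlim X (at_right 0) sequentially"
  shows "(\<lambda>n. stein_mult a (X n) x / complex_of_real (d_const a)) \<longlonglongrightarrow> complex_of_real (\<bar>x\<bar> powr a)"
proof -
  have "(\<lambda>n. stein_mult a (X n) x) \<longlonglongrightarrow> (\<integral>\<tau>. complex_of_real (kern a \<tau>) * (cis (- \<tau> * x) - 1) \<partial>lborel)"
    unfolding stein_mult_def
  proof (rule integral_dominated_convergence[where w="\<lambda>\<tau>. cmod (complex_of_real (kern a \<tau>) * (cis (- \<tau> * x) - 1))"])
    show "integrable lborel (\<lambda>\<tau>. cmod (complex_of_real (kern a \<tau>) * (cis (- \<tau> * x) - 1)))"
      by (intro integrable_norm kern_cis_integral a)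
    show "AE \<tau> in lborel. (\<lambda>n. complex_of_real (trunc_kern a (X n) \<tau>) * (cis (- \<tau> * x) - 1)) \<longlonglongrightarrow> complex_of_real (kern a \<tau>) * (cis (- \<tau> * x) - 1)"
      using AE_lborel_singleton[of 0]
      by eventually_elim (intro tendsto_intros filterlim_compose[OF trunc_kern_tendsto X])
    show "AE \<tau> in lborel. norm (complex_of_real (trunc_kern a (X n) \<tau>) * (cis (- \<tau> * x) - 1)) \<le> cmod (complex_of_real (kern a \<tau>) * (cis (- \<tau> * x) - 1))" for n
      by (auto simp: norm_mult trunc_kern_le intro!: mult_right_mono)
  qed auto
  then have "(\<lambda>n. stein_mult a (X n) x / complex_of_real (d_const a)) \<longlonglongrightarrow> complex_of_real (d_const a * \<bar>x\<bar> powr a) / complex_of_real (d_const a)"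
    unfolding kern_cis_integral(2)[OF a] using d_const_nonzero(1)[OF a] by (intro tendsto_intros) auto
  then show ?thesis using d_const_nonzero(1)[OF a] by simp
qed

lemma stein_mult_measurable [measurable]: "stein_mult a \<epsilon> \<in> borel_measurable borel"
  unfolding stein_mult_def[abs_def] by measurable

section \<open>Convolution along a line\<close>

text \<open>K is split into the square roots of \<open>K / w\<close> and \<open>K * w\<close>, with
  w taken at the shifted point, and Cauchy-Schwarz is applied in \<tau>. The first factor is bounded
  by A. Exchanging the integrals in the second leaves a \<tau>-integral with fixed end point v,
  bounded by \<open>B * w v\<close>; together with the w already present this gives the square of
  the weight.\<close>

lemma Schur_test_line:
  fixes K :: "real \<times> real \<Rightarrow> real \<Rightarrow> real" and w :: "real \<times> real \<Rightarrow> real"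
  assumes [measurable]: "(\<lambda>(\<zeta>, \<tau>). K \<zeta> \<tau>) \<in> borel_measurable (borel \<Otimes>\<^sub>M borel)"
      "w \<in> borel_measurable borel" "g \<in> borel_measurable borel"
    and K: "\<And>\<zeta> \<tau>. 0 \<le> K \<zeta> \<tau>" and w: "\<And>\<zeta>. 0 < w \<zeta>" and A0: "0 \<le> A" and B0: "0 \<le> B"
    and A: "\<And>\<zeta>. (\<integral>\<^sup>+\<tau>. ennreal (K \<zeta> \<tau> / w (\<zeta> + \<tau> *\<^sub>R e)) \<partial>lborel) \<le> ennreal A"
    and B: "\<And>v. (\<integral>\<^sup>+\<tau>. ennreal (K (v - \<tau> *\<^sub>R e) \<tau>) \<partial>lborel) \<le> ennreal (B * w v)"
  shows "(\<integral>\<^sup>+\<zeta>. (\<integral>\<^sup>+\<tau>. ennreal (K \<zeta> \<tau> * cmod (g (\<zeta> + \<tau> *\<^sub>R e))) \<partial>lborel)\<^sup>2 \<partial>lborel)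
    \<le> ennreal (A * B) * (\<integral>\<^sup>+\<zeta>. ennreal ((w \<zeta>)\<^sup>2 * (cmod (g \<zeta>))\<^sup>2) \<partial>lborel)"
proof -
  let ?v = "\<lambda>\<zeta> \<tau>. \<zeta> + \<tau> *\<^sub>R e"
  have w0: "0 \<le> w v" for v using w[of v] by simp
  have "(\<integral>\<^sup>+\<tau>. ennreal (K \<zeta> \<tau> * cmod (g (?v \<zeta> \<tau>))) \<partial>lborel)\<^sup>2
      \<le> ennreal A * (\<integral>\<^sup>+\<tau>. ennreal (K \<zeta> \<tau> * w (?v \<zeta> \<tau>) * (cmod (g (?v \<zeta> \<tau>)))\<^sup>2) \<partial>lborel)" for \<zeta>
  proof -
    have eq: "sqrt (K \<zeta> \<tau> / w (?v \<zeta> \<tau>)) * (sqrt (K \<zeta> \<tau> * w (?v \<zeta> \<tau>)) * cmod (g (?v \<zeta> \<tau>)))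
        = K \<zeta> \<tau> * cmod (g (?v \<zeta> \<tau>))" for \<tau>
    proof -
      have "sqrt (K \<zeta> \<tau> / w (?v \<zeta> \<tau>)) * sqrt (K \<zeta> \<tau> * w (?v \<zeta> \<tau>)) = sqrt ((K \<zeta> \<tau>)\<^sup>2)"
        using w[of "?v \<zeta> \<tau>"] unfolding real_sqrt_mult[symmetric] by (simp add: power2_eq_square)
      then show ?thesis using K[of \<zeta> \<tau>] by (simp add: mult.assoc[symmetric])
    qed
    have "(\<integral>\<^sup>+\<tau>. ennreal (K \<zeta> \<tau> * cmod (g (?v \<zeta> \<tau>))) \<partial>lborel)\<^sup>2
      = (\<integral>\<^sup>+\<tau>. ennreal (sqrt (K \<zeta> \<tau> / w (?v \<zeta> \<tau>)) * (sqrt (K \<zeta> \<tau> * w (?v \<zeta> \<tau>)) * cmod (g (?v \<zeta> \<tau>)))) \<partial>lborel)\<^sup>2"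
      by (simp only: eq)
    also have "\<dots> \<le> (\<integral>\<^sup>+\<tau>. ennreal ((sqrt (K \<zeta> \<tau> / w (?v \<zeta> \<tau>)))\<^sup>2) \<partial>lborel)
        * (\<integral>\<^sup>+\<tau>. ennreal ((sqrt (K \<zeta> \<tau> * w (?v \<zeta> \<tau>)) * cmod (g (?v \<zeta> \<tau>)))\<^sup>2) \<partial>lborel)"
      by (rule nn_integral_Cauchy_Schwarz) (auto simp: K w0)
    also have "\<dots> = (\<integral>\<^sup>+\<tau>. ennreal (K \<zeta> \<tau> / w (?v \<zeta> \<tau>)) \<partial>lborel)
        * (\<integral>\<^sup>+\<tau>. ennreal (K \<zeta> \<tau> * w (?v \<zeta> \<tau>) * (cmod (g (?v \<zeta> \<tau>)))\<^sup>2) \<partial>lborel)"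
      by (simp add: K w0 power_mult_distrib)
    also have "\<dots> \<le> ennreal A * (\<integral>\<^sup>+\<tau>. ennreal (K \<zeta> \<tau> * w (?v \<zeta> \<tau>) * (cmod (g (?v \<zeta> \<tau>)))\<^sup>2) \<partial>lborel)"
      by (intro mult_right_mono A) simp
    finally show ?thesis .
  qed
  then have "(\<integral>\<^sup>+\<zeta>. (\<integral>\<^sup>+\<tau>. ennreal (K \<zeta> \<tau> * cmod (g (?v \<zeta> \<tau>))) \<partial>lborel)\<^sup>2 \<partial>lborel)
    \<le> (\<integral>\<^sup>+\<zeta>. ennreal A * (\<integral>\<^sup>+\<tau>. ennreal (K \<zeta> \<tau> * w (?v \<zeta> \<tau>) * (cmod (g (?v \<zeta> \<tau>)))\<^sup>2) \<partial>lborel) \<partial>lborel)"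
    by (rule nn_integral_mono)
  also have "\<dots> = ennreal A * (\<integral>\<^sup>+\<zeta>. \<integral>\<^sup>+\<tau>. ennreal (K \<zeta> \<tau> * w (?v \<zeta> \<tau>) * (cmod (g (?v \<zeta> \<tau>)))\<^sup>2) \<partial>lborel \<partial>lborel)"
    by (rule nn_integral_cmult) measurable
  also have "(\<integral>\<^sup>+\<zeta>. \<integral>\<^sup>+\<tau>. ennreal (K \<zeta> \<tau> * w (?v \<zeta> \<tau>) * (cmod (g (?v \<zeta> \<tau>)))\<^sup>2) \<partial>lborel \<partial>lborel)
      = (\<integral>\<^sup>+\<tau>. \<integral>\<^sup>+\<zeta>. ennreal (K \<zeta> \<tau> * w (?v \<zeta> \<tau>) * (cmod (g (?v \<zeta> \<tau>)))\<^sup>2) \<partial>lborel \<partial>lborel)"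
    by (rule lborel_pair.Fubini'[symmetric]) measurable
  \<comment> \<open>For fixed \<tau> the end point \<open>v = \<zeta> + \<tau> *\<^sub>R e\<close>
    becomes the variable, which is why the second hypothesis evaluates K at
    \<open>v - \<tau> *\<^sub>R e\<close>.\<close>
  also have "\<dots> = (\<integral>\<^sup>+\<tau>. \<integral>\<^sup>+v. ennreal (K (v - \<tau> *\<^sub>R e) \<tau> * w v * (cmod (g v))\<^sup>2) \<partial>lborel \<partial>lborel)"
  proof (rule nn_integral_cong)
    fix \<tau> :: real
    show "(\<integral>\<^sup>+\<zeta>. ennreal (K \<zeta> \<tau> * w (?v \<zeta> \<tau>) * (cmod (g (?v \<zeta> \<tau>)))\<^sup>2) \<partial>lborel)
      = (\<integral>\<^sup>+v. ennreal (K (v - \<tau> *\<^sub>R e) \<tau> * w v * (cmod (g v))\<^sup>2) \<partial>lborel)"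
      by (subst nn_integral_translate[of "\<lambda>v. ennreal (K (v - \<tau> *\<^sub>R e) \<tau> * w v * (cmod (g v))\<^sup>2)" "\<tau> *\<^sub>R e", symmetric]) auto
  qed
  also have "\<dots> = (\<integral>\<^sup>+v. \<integral>\<^sup>+\<tau>. ennreal (K (v - \<tau> *\<^sub>R e) \<tau> * w v * (cmod (g v))\<^sup>2) \<partial>lborel \<partial>lborel)"
    by (rule lborel_pair.Fubini') measurable
  also have "\<dots> \<le> (\<integral>\<^sup>+v. ennreal B * ennreal ((w v)\<^sup>2 * (cmod (g v))\<^sup>2) \<partial>lborel)"
  proof (rule nn_integral_mono)
    fix v
    have "(\<integral>\<^sup>+\<tau>. ennreal (K (v - \<tau> *\<^sub>R e) \<tau> * w v * (cmod (g v))\<^sup>2) \<partial>lborel)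
      = (\<integral>\<^sup>+\<tau>. ennreal (K (v - \<tau> *\<^sub>R e) \<tau>) * ennreal (w v * (cmod (g v))\<^sup>2) \<partial>lborel)"
      by (simp add: K w0 mult.assoc flip: ennreal_mult)
    also have "\<dots> = (\<integral>\<^sup>+\<tau>. ennreal (K (v - \<tau> *\<^sub>R e) \<tau>) \<partial>lborel) * ennreal (w v * (cmod (g v))\<^sup>2)"
      by (rule nn_integral_multc) measurable
    also have "\<dots> \<le> ennreal (B * w v) * ennreal (w v * (cmod (g v))\<^sup>2)"
      by (intro mult_right_mono B) simp
    also have "\<dots> = ennreal B * ennreal ((w v)\<^sup>2 * (cmod (g v))\<^sup>2)"
      using B0 w0[of v] by (simp add: power2_eq_square ac_simps flip: ennreal_mult)
    finally show "(\<integral>\<^sup>+\<tau>. ennreal (K (v - \<tau> *\<^sub>R e) \<tau> * w v * (cmod (g v))\<^sup>2) \<partial>lborel)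
      \<le> ennreal B * ennreal ((w v)\<^sup>2 * (cmod (g v))\<^sup>2)" .
  qed
  also have "\<dots> = ennreal B * (\<integral>\<^sup>+\<zeta>. ennreal ((w \<zeta>)\<^sup>2 * (cmod (g \<zeta>))\<^sup>2) \<partial>lborel)"
    by (rule nn_integral_cmult) measurable
  finally show ?thesis
    using A0 B0 by (simp add: mult_left_mono mult.assoc ennreal_mult)
qed

text \<open>Convolution with the reflected kernel, restricted to a line: the sign of the shift is
  that of the Stein derivative and accounts for \<open>cis (- \<tau> * x)\<close> in the
  symbol.\<close>

definition line_conv :: "real \<times> real \<Rightarrow> (real \<Rightarrow> complex) \<Rightarrow> (real \<times> real \<Rightarrow> complex) \<Rightarrow> real \<times> real \<Rightarrow> complex" where
  "line_conv e k g \<zeta> = (\<integral>\<tau>. k \<tau> * g (\<zeta> + \<tau> *\<^sub>R e) \<partial>lborel)"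

context
  fixes k :: "real \<Rightarrow> complex" and e :: "real \<times> real"
  assumes k: "integrable lborel k"
begin

lemma k_measurable [measurable]: "k \<in> borel_measurable borel"
  using k by auto

lemma line_conv_measurable:
  assumes [measurable]: "g \<in> borel_measurable borel"
  shows "line_conv e k g \<in> borel_measurable borel"
  unfolding line_conv_def[abs_def] by measurable

text \<open>Young's inequality, as the Schur test with weight 1. The modulus stands inside the inner
  integral, so finiteness also yields integrability of the convolution integrand at almost every
  point.\<close>

lemma line_conv_nn_bound:
  assumes g: "L2 g"
  shows "(\<integral>\<^sup>+\<zeta>. (\<integral>\<^sup>+\<tau>. ennreal (cmod (k \<tau>) * cmod (g (\<zeta> + \<tau> *\<^sub>R e))) \<partial>lborel)\<^sup>2 \<partial>lborel)
    \<le> ennreal (((\<integral>\<tau>. cmod (k \<tau>) \<partial>lborel) * norm2 g)\<^sup>2)"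
proof -
  note [measurable] = L2_measurable[OF g]
  define A where "A = (\<integral>\<tau>. cmod (k \<tau>) \<partial>lborel)"
  have A: "0 \<le> A" "(\<integral>\<^sup>+\<tau>. ennreal (cmod (k \<tau>)) \<partial>lborel) = ennreal A"
    using k by (auto simp: A_def nn_integral_eq_integral)
  have "(\<integral>\<^sup>+\<zeta>. (\<integral>\<^sup>+\<tau>. ennreal (cmod (k \<tau>) * cmod (g (\<zeta> + \<tau> *\<^sub>R e))) \<partial>lborel)\<^sup>2 \<partial>lborel)
    \<le> ennreal (A * A) * (\<integral>\<^sup>+\<zeta>. ennreal ((1::real)\<^sup>2 * (cmod (g \<zeta>))\<^sup>2) \<partial>lborel)"
    by (rule Schur_test_line[where K="\<lambda>\<zeta> \<tau>. cmod (k \<tau>)" and w="\<lambda>_. 1" and A=A and B=A]) (auto simp: A)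
  also have "\<dots> = ennreal ((A * norm2 g)\<^sup>2)"
    using A by (simp add: nn2_norm2[OF g] power_mult_distrib flip: ennreal_mult power2_eq_square)
  finally show ?thesis by (simp add: A_def)
qed

lemma line_conv_AE_integrable:
  assumes g: "L2 g"
  shows "AE \<zeta> in lborel. integrable lborel (\<lambda>\<tau>. k \<tau> * g (\<zeta> + \<tau> *\<^sub>R e))"
proof -
  note [measurable] = L2_measurable[OF g]
  have "(\<integral>\<^sup>+\<zeta>. (\<integral>\<^sup>+\<tau>. ennreal (cmod (k \<tau>) * cmod (g (\<zeta> + \<tau> *\<^sub>R e))) \<partial>lborel)\<^sup>2 \<partial>lborel) \<noteq> \<infinity>"
    using line_conv_nn_bound[OF g] by (auto simp: top_unique)
  then have "AE \<zeta> in lborel. (\<integral>\<^sup>+\<tau>. ennreal (cmod (k \<tau>) * cmod (g (\<zeta> + \<tau> *\<^sub>R e))) \<partial>lborel)\<^sup>2 \<noteq> \<infinity>"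
    by (intro nn_integral_PInf_AE) measurable
  then show ?thesis
    by eventually_elim
       (auto simp: integrable_iff_bounded norm_mult power2_eq_square ennreal_mult_eq_top_iff less_top)
qed

lemma line_conv_L2:
  assumes g: "L2 g"
  shows "L2 (line_conv e k g)" "norm2 (line_conv e k g) \<le> (\<integral>\<tau>. cmod (k \<tau>) \<partial>lborel) * norm2 g"
proof -
  note [measurable] = L2_measurable[OF g]
  have "nn2 (line_conv e k g) \<le> (\<integral>\<^sup>+\<zeta>. (\<integral>\<^sup>+\<tau>. ennreal (cmod (k \<tau>) * cmod (g (\<zeta> + \<tau> *\<^sub>R e))) \<partial>lborel)\<^sup>2 \<partial>lborel)"
  proof (rule nn_integral_mono_AE)
    show "AE \<zeta> in lborel. ennreal ((cmod (line_conv e k g \<zeta>))\<^sup>2)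
        \<le> (\<integral>\<^sup>+\<tau>. ennreal (cmod (k \<tau>) * cmod (g (\<zeta> + \<tau> *\<^sub>R e))) \<partial>lborel)\<^sup>2"
      using line_conv_AE_integrable[OF g]
    proof eventually_elim
      case (elim \<zeta>)
      from integral_norm_bound_ennreal[OF this]
      have "ennreal (cmod (line_conv e k g \<zeta>)) \<le> (\<integral>\<^sup>+\<tau>. ennreal (cmod (k \<tau>) * cmod (g (\<zeta> + \<tau> *\<^sub>R e))) \<partial>lborel)"
        by (simp add: line_conv_def norm_mult)
      from power_mono[OF this, of 2] show ?case by (simp add: ennreal_power)
    qed
  qed
  also note line_conv_nn_bound[OF g]
  finally have *: "nn2 (line_conv e k g) \<le> ennreal (((\<integral>\<tau>. cmod (k \<tau>) \<partial>lborel) * norm2 g)\<^sup>2)" .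
  show "L2 (line_conv e k g)" "norm2 (line_conv e k g) \<le> (\<integral>\<tau>. cmod (k \<tau>) \<partial>lborel) * norm2 g"
    by (rule L2_nn2_bound[OF _ *]; simp add: line_conv_measurable)+
qed

lemma line_conv_diff_norm:
  assumes g: "L2 g" "L2 g'"
  shows "norm2 (\<lambda>\<zeta>. line_conv e k g \<zeta> - line_conv e k g' \<zeta>) \<le> (\<integral>\<tau>. cmod (k \<tau>) \<partial>lborel) * norm2 (\<lambda>\<zeta>. g \<zeta> - g' \<zeta>)"
proof -
  note [measurable] = line_conv_measurable[OF L2_measurable[OF g(1)]] line_conv_measurable[OF L2_measurable[OF g(2)]]
  have "AE \<zeta> in lborel. line_conv e k g \<zeta> - line_conv e k g' \<zeta> = line_conv e k (\<lambda>\<zeta>. g \<zeta> - g' \<zeta>) \<zeta>"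
    using line_conv_AE_integrable[OF g(1)] line_conv_AE_integrable[OF g(2)]
    by eventually_elim (simp add: line_conv_def right_diff_distrib)
  then have "norm2 (\<lambda>\<zeta>. line_conv e k g \<zeta> - line_conv e k g' \<zeta>) = norm2 (line_conv e k (\<lambda>\<zeta>. g \<zeta> - g' \<zeta>))"
    by (intro L2_cong_AE(2) line_conv_L2 L2_diff g) auto
  then show ?thesis using line_conv_L2(2)[OF L2_diff[OF g]] by simp
qed

lemma line_conv_FT1:
  assumes g: "integrable lborel g"
  shows "integrable lborel (line_conv e k g)"
    and "FT1 1 (line_conv e k g) z = (\<integral>\<tau>. k \<tau> * cis (- \<tau> * (z \<bullet> e)) \<partial>lborel) * FT1 1 g z"
proof -
  have [measurable]: "g \<in> borel_measurable borel" using g by auto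
  have tr: "(\<integral>\<^sup>+\<zeta>. ennreal (cmod (g (\<zeta> + h))) \<partial>lborel) = (\<integral>\<^sup>+\<zeta>. ennreal (cmod (g \<zeta>)) \<partial>lborel)" for h
    by (rule nn_integral_translate[where f="\<lambda>z. ennreal (cmod (g z))"]) simp
  have I: "integrable (lborel \<Otimes>\<^sub>M lborel) (\<lambda>(\<zeta>, \<tau>). k \<tau> * g (\<zeta> + \<tau> *\<^sub>R e))"
  proof -
    have "(\<integral>\<^sup>+p. ennreal (norm (case p of (\<zeta>, \<tau>) \<Rightarrow> k \<tau> * g (\<zeta> + \<tau> *\<^sub>R e))) \<partial>(lborel \<Otimes>\<^sub>M lborel))
      = (\<integral>\<^sup>+\<tau>. \<integral>\<^sup>+\<zeta>. ennreal (cmod (k \<tau>)) * ennreal (cmod (g (\<zeta> + \<tau> *\<^sub>R e))) \<partial>lborel \<partial>lborel)"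
      by (subst lborel_pair.nn_integral_snd[symmetric])
         (auto simp: norm_mult simp flip: ennreal_mult intro!: nn_integral_cong)
    also have "\<dots> = (\<integral>\<^sup>+\<tau>. ennreal (cmod (k \<tau>)) \<partial>lborel) * (\<integral>\<^sup>+\<zeta>. ennreal (cmod (g \<zeta>)) \<partial>lborel)"
      by (simp add: nn_integral_cmult nn_integral_multc tr)
    also have "\<dots> < \<infinity>"
      using k g by (auto simp: integrable_iff_bounded ennreal_mult_less_top)
    finally show ?thesis unfolding integrable_iff_bounded by simp
  qed
  show "integrable lborel (line_conv e k g)"
    using lborel_pair.integrable_fst[OF I] by (simp add: line_conv_def[abs_def])
  have I2: "integrable (lborel \<Otimes>\<^sub>M lborel) (\<lambda>(\<zeta>, \<tau>). k \<tau> * g (\<zeta> + \<tau> *\<^sub>R e) * cis (\<zeta> \<bullet> z))"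
    by (rule Bochner_Integration.integrable_bound[OF I]) (auto simp: norm_mult)
  have "FT1 1 (line_conv e k g) z = (\<integral>\<zeta>. \<integral>\<tau>. k \<tau> * g (\<zeta> + \<tau> *\<^sub>R e) * cis (\<zeta> \<bullet> z) \<partial>lborel \<partial>lborel)"
    unfolding FT1_alt line_conv_def by simp
  also have "\<dots> = (\<integral>\<tau>. \<integral>\<zeta>. k \<tau> * g (\<zeta> + \<tau> *\<^sub>R e) * cis (\<zeta> \<bullet> z) \<partial>lborel \<partial>lborel)"
    by (rule lborel_pair.Fubini_integral[OF I2, symmetric])
  also have "\<dots> = (\<integral>\<tau>. k \<tau> * cis (- \<tau> * (z \<bullet> e)) * FT1 1 g z \<partial>lborel)"
  proof (rule Bochner_Integration.integral_cong[OF refl])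
    fix \<tau>
    have ip: "(\<zeta> + \<tau> *\<^sub>R e) \<bullet> z = \<zeta> \<bullet> z + \<tau> * (z \<bullet> e)" for \<zeta>
      by (simp add: inner_add_left inner_commute[of e])
    have "FT1 1 g z = (\<integral>v. g v * cis (v \<bullet> z) \<partial>lborel)" by (simp add: FT1_alt)
    also have "\<dots> = (\<integral>\<zeta>. g (\<zeta> + \<tau> *\<^sub>R e) * cis ((\<zeta> + \<tau> *\<^sub>R e) \<bullet> z) \<partial>lborel)"
      using integral_lborel_affine[of 1 "\<lambda>v. g v * cis (v \<bullet> z)" "\<tau> *\<^sub>R e"] by (simp add: add.commute)
    also have "\<dots> = (\<integral>\<zeta>. g (\<zeta> + \<tau> *\<^sub>R e) * cis (\<zeta> \<bullet> z) * cis (\<tau> * (z \<bullet> e)) \<partial>lborel)"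
      by (simp only: ip cis_mult[symmetric] mult.assoc)
    also have "\<dots> = (\<integral>\<zeta>. g (\<zeta> + \<tau> *\<^sub>R e) * cis (\<zeta> \<bullet> z) \<partial>lborel) * cis (\<tau> * (z \<bullet> e))"
      by (rule integral_mult_left_zero)
    finally have "k \<tau> * cis (- \<tau> * (z \<bullet> e)) * FT1 1 g z
      = k \<tau> * (\<integral>\<zeta>. g (\<zeta> + \<tau> *\<^sub>R e) * cis (\<zeta> \<bullet> z) \<partial>lborel) * (cis (- \<tau> * (z \<bullet> e)) * cis (\<tau> * (z \<bullet> e)))"
      by (simp only: ac_simps)
    also have "cis (- \<tau> * (z \<bullet> e)) * cis (\<tau> * (z \<bullet> e)) = 1" by (simp add: cis_mult)
    finally show "(\<integral>\<zeta>. k \<tau> * g (\<zeta> + \<tau> *\<^sub>R e) * cis (\<zeta> \<bullet> z) \<partial>lborel) = k \<tau> * cis (- \<tau> * (z \<bullet> e)) * FT1 1 g z"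
      by (auto simp: mult.assoc)
  qed
  also have "\<dots> = (\<integral>\<tau>. k \<tau> * cis (- \<tau> * (z \<bullet> e)) \<partial>lborel) * FT1 1 g z"
    by (rule integral_mult_left_zero)
  finally show "FT1 1 (line_conv e k g) z = (\<integral>\<tau>. k \<tau> * cis (- \<tau> * (z \<bullet> e)) \<partial>lborel) * FT1 1 g z" .
qed

lemma kappa_bound: "cmod (\<integral>\<tau>. k \<tau> * cis (- \<tau> * x) \<partial>lborel) \<le> (\<integral>\<tau>. cmod (k \<tau>) \<partial>lborel)"
  using integral_norm_bound[of lborel "\<lambda>\<tau>. k \<tau> * cis (- \<tau> * x)"] by (simp add: norm_mult)

lemma kappa_mult_L2:
  assumes "L2 h"
  shows "L2 (\<lambda>z. (\<integral>\<tau>. k \<tau> * cis (- \<tau> * (z \<bullet> e)) \<partial>lborel) * h z)"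
    "norm2 (\<lambda>z. (\<integral>\<tau>. k \<tau> * cis (- \<tau> * (z \<bullet> e)) \<partial>lborel) * h z) \<le> (\<integral>\<tau>. cmod (k \<tau>) \<partial>lborel) * norm2 h"
  by (rule L2_mult[OF assms _ kappa_bound]; measurable)+

text \<open>Truncations of g are integrable, and there Fubini computes the transform. The symbol is
  bounded by the integral of the modulus of k, so both sides are continuous in the mean and the
  formula extends to g.\<close>

lemma ifourier_line_conv:
  assumes g: "L2 g"
  shows "AE z in lborel. ifourier (line_conv e k g) z = (\<integral>\<tau>. k \<tau> * cis (- \<tau> * (z \<bullet> e)) \<partial>lborel) * ifourier g z"
proof -
  define \<kappa> where "\<kappa> z = (\<integral>\<tau>. k \<tau> * cis (- \<tau> * (z \<bullet> e)) \<partial>lborel)" for z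
  define A where "A = (\<integral>\<tau>. cmod (k \<tau>) \<partial>lborel)"
  define G where "G R = trunc R g" for R :: real
  have G: "L2 (G R)" "integrable lborel (G R)" for R
    unfolding G_def by (intro trunc_L2 trunc_integrable g)+
  have [measurable]: "\<kappa> \<in> borel_measurable borel" unfolding \<kappa>_def by measurable
  note [measurable] = L2_measurable[OF L2_ifourier[OF g]] L2_measurable[OF L2_ifourier[OF G(1)]]
    L2_measurable[OF L2_ifourier[OF line_conv_L2(1)[OF G(1)]]] L2_measurable[OF L2_ifourier[OF line_conv_L2(1)[OF g]]]
  have \<kappa>: "L2 (\<lambda>z. \<kappa> z * h z)" "norm2 (\<lambda>z. \<kappa> z * h z) \<le> A * norm2 h" if "L2 h" for h
    using kappa_mult_L2[OF that] by (simp_all add: \<kappa>_def A_def)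
  have eq: "AE z in lborel. ifourier (line_conv e k (G R)) z = \<kappa> z * ifourier (G R) z" for R
    using ifourier_L1[OF line_conv_L2(1)[OF G(1)] line_conv_FT1(1)[OF G(2)], of R] ifourier_L1[OF G, of R]
    by eventually_elim (simp add: line_conv_FT1(2)[OF G(2)] \<kappa>_def)
  have lim: "((\<lambda>R. A * (norm2 (\<lambda>z. G R z - g z) / (2 * pi))) \<longlongrightarrow> 0) at_top"
  proof -
    have "((\<lambda>R. A * (norm2 (\<lambda>z. G R z - g z) / (2 * pi))) \<longlongrightarrow> A * (0 / (2 * pi))) at_top"
      unfolding G_def by (intro tendsto_intros trunc_tendsto g) auto
    then show ?thesis by simp
  qed
  show ?thesis
    unfolding \<kappa>_def[symmetric]
  proof (rule norm2_lim_unique[where F="\<lambda>R. ifourier (line_conv e k (G R))" and G=at_top])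
    show "((\<lambda>R. norm2 (\<lambda>z. ifourier (line_conv e k (G R)) z - ifourier (line_conv e k g) z)) \<longlongrightarrow> 0) at_top"
    proof (rule Lim_null_comparison[OF always_eventually[OF allI] lim])
      show "norm (norm2 (\<lambda>z. ifourier (line_conv e k (G R)) z - ifourier (line_conv e k g) z)) \<le> A * (norm2 (\<lambda>z. G R z - g z) / (2 * pi))" for R
        using line_conv_diff_norm[OF G(1) g, of R] unfolding norm2_fourier_diff(2)[OF line_conv_L2(1)[OF G(1)] line_conv_L2(1)[OF g]]
        by (simp add: A_def divide_right_mono)
    qed
    show "((\<lambda>R. norm2 (\<lambda>z. ifourier (line_conv e k (G R)) z - \<kappa> z * ifourier g z)) \<longlongrightarrow> 0) at_top"
    proof (rule Lim_null_comparison[OF always_eventually[OF allI] lim])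
      fix R
      have "norm2 (\<lambda>z. ifourier (line_conv e k (G R)) z - \<kappa> z * ifourier g z) = norm2 (\<lambda>z. \<kappa> z * (ifourier (G R) z - ifourier g z))"
        by (intro L2_cong_AE(2) \<kappa>(1) L2_diff L2_ifourier G g) (use eq[of R] in \<open>auto elim!: eventually_mono simp: right_diff_distrib\<close>)
      also have "\<dots> \<le> A * (norm2 (\<lambda>z. G R z - g z) / (2 * pi))"
        using \<kappa>(2)[OF L2_diff[OF L2_ifourier[OF G(1)] L2_ifourier[OF g]], of R]
        unfolding norm2_fourier_diff(2)[OF G(1) g] .
      finally show "norm (norm2 (\<lambda>z. ifourier (line_conv e k (G R)) z - \<kappa> z * ifourier g z)) \<le> A * (norm2 (\<lambda>z. G R z - g z) / (2 * pi))"
        by simp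
    qed
  qed (auto intro!: L2_ifourier line_conv_L2 G g \<kappa>)
qed

end

section \<open>Estimates for the phase\<close>

definition weight :: "real \<times> real \<Rightarrow> real" where
  "weight \<zeta> = 1 + (norm \<zeta>)\<^sup>2"

lemma weight_ge_1 [simp]: "1 \<le> weight \<zeta>" and weight_pos [simp]: "0 < weight \<zeta>"
  and weight_nonneg [simp]: "0 \<le> weight \<zeta>"
  and weight_measurable [measurable]: "weight \<in> borel_measurable borel"
  by (simp_all add: weight_def[abs_def] add_pos_nonneg)

lemma weight_nonzero [simp]: "weight \<zeta> \<noteq> 0"
  using weight_pos[of \<zeta>] by linarith

text \<open>A form of Peetre's inequality. For short shifts it makes the weights at both ends
  comparable; for long ones, its power \<open>b / 2\<close> costs the factor
  \<open>max 1 \<bar>\<tau>\<bar> powr b\<close>.\<close>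

lemma weight_shift:
  assumes e: "norm e = 1"
  shows "weight \<zeta> \<le> 3 * weight (\<zeta> + \<tau> *\<^sub>R e) * (max 1 \<bar>\<tau>\<bar>)\<^sup>2"
proof -
  define v where "v = \<zeta> + \<tau> *\<^sub>R e"
  define m where "m = (max 1 \<bar>\<tau>\<bar>)\<^sup>2"
  have m: "1 \<le> m" "\<tau>\<^sup>2 \<le> m"
    unfolding m_def by (simp, intro abs_le_square_iff[THEN iffD1]) auto
  have "norm \<zeta> \<le> norm v + \<bar>\<tau>\<bar>"
    using norm_triangle_ineq4[of v "\<tau> *\<^sub>R e"] e by (simp add: v_def)
  then have "(norm \<zeta>)\<^sup>2 \<le> (norm v + \<bar>\<tau>\<bar>)\<^sup>2" by (intro power_mono) auto
  also have "\<dots> \<le> 2 * (norm v)\<^sup>2 + 2 * \<tau>\<^sup>2"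
    using sum_squares_bound[of "norm v" "\<bar>\<tau>\<bar>"] by (simp add: power2_sum)
  finally have "weight \<zeta> \<le> 1 + 2 * (norm v)\<^sup>2 + 2 * \<tau>\<^sup>2" by (simp add: weight_def)
  also have "\<dots> \<le> m + 2 * ((norm v)\<^sup>2 * m) + 2 * m"
    using m mult_left_mono[OF m(1), of "(norm v)\<^sup>2"] by simp
  also have "\<dots> \<le> 3 * weight v * m" using m by (simp add: weight_def algebra_simps)
  finally show ?thesis by (simp add: v_def m_def)
qed

text \<open>The factor \<tau> divides the difference exactly. The quotient is quadratic in the base
  point and the shift, and a shift of length at most 1 is absorbed by the constant 1 in the
  weight.\<close>

lemma phase_diff_bound:
  assumes e: "e = (1, 0) \<or> e = (0, 1)" and \<tau>: "\<bar>\<tau>\<bar> \<le> 1"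
  shows "\<bar>phase (\<zeta> + \<tau> *\<^sub>R e) - phase \<zeta>\<bar> \<le> 6 * \<bar>\<tau>\<bar> * weight \<zeta>"
proof (cases \<zeta>)
  case (Pair x y)
  have w: "weight \<zeta> = 1 + x\<^sup>2 + y\<^sup>2" by (simp add: Pair weight_def norm_Pair)
  have t2: "\<tau>\<^sup>2 \<le> 1" using \<tau> by (simp add: abs_square_le_1)
  have ab: "2 * \<bar>u * v\<bar> \<le> u\<^sup>2 + v\<^sup>2" for u v :: real
    using sum_squares_bound[of "\<bar>u\<bar>" "\<bar>v\<bar>"] by (simp add: abs_mult)
  have x\<tau>: "2 * \<bar>x * \<tau>\<bar> \<le> x\<^sup>2 + 1" using ab[of x \<tau>] t2 by simp
  have fin: "\<bar>D\<bar> \<le> 6 * \<bar>\<tau>\<bar> * weight \<zeta>" if "D = \<tau> * X" "\<bar>X\<bar> \<le> 6 * weight \<zeta>" for D X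
    using that(1) mult_left_mono[OF that(2), of "\<bar>\<tau>\<bar>"] by (simp add: abs_mult ac_simps)
  from e show ?thesis
  proof
    assume e: "e = (1, 0)"
    have "phase (\<zeta> + \<tau> *\<^sub>R e) - phase \<zeta> = \<tau> * (3 * x\<^sup>2 + 3 * (x * \<tau>) + \<tau>\<^sup>2 + y\<^sup>2)"
      by (simp add: Pair e phase_def power2_eq_square power3_eq_cube algebra_simps)
    moreover have "\<bar>3 * x\<^sup>2 + 3 * (x * \<tau>) + \<tau>\<^sup>2 + y\<^sup>2\<bar> \<le> 6 * weight \<zeta>"
      using x\<tau> t2 unfolding w by (simp add: abs_le_iff) (smt (verit) zero_le_power2)
    ultimately show ?thesis by (rule fin)
  next
    assume e: "e = (0, 1)"
    have "phase (\<zeta> + \<tau> *\<^sub>R e) - phase \<zeta> = \<tau> * (2 * (x * y) + x * \<tau>)"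
      by (simp add: Pair e phase_def power2_eq_square algebra_simps)
    moreover have "\<bar>2 * (x * y) + x * \<tau>\<bar> \<le> 6 * weight \<zeta>"
      using x\<tau> ab[of x y] unfolding w by (smt (verit) zero_le_power2)
    ultimately show ?thesis by (rule fin)
  qed
qed

definition osc :: "real \<times> real \<Rightarrow> real \<Rightarrow> real \<times> real \<Rightarrow> real \<Rightarrow> complex" where
  "osc e t \<zeta> \<tau> = cis (t * (phase (\<zeta> + \<tau> *\<^sub>R e) - phase \<zeta>)) - 1"

lemma phase_measurable [measurable]: "phase \<in> borel_measurable borel"
proof -
  have "continuous_on UNIV phase" unfolding phase_def[abs_def] by (intro continuous_intros)
  then show ?thesis by (rule borel_measurable_continuous_onI)
qed

lemma osc_measurable [measurable]: "(\<lambda>(\<zeta>, \<tau>). osc e t \<zeta> \<tau>) \<in> borel_measurable (borel \<Otimes>\<^sub>M borel)"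
  unfolding osc_def by measurable

lemma osc_le_2: "cmod (osc e t \<zeta> \<tau>) \<le> 2"
  using cmod_cis_diff_le[of "t * (phase (\<zeta> + \<tau> *\<^sub>R e) - phase \<zeta>)"] by (simp add: osc_def)

text \<open>The two versions place the weight at the start and at the end of the shift, as the two
  Schur hypotheses demand; the second follows by reversing the shift. The constant is 2 from
  \<open>cmod_cis_diff_le\<close> times 6 from the phase. For long shifts the minimum is 1, because
  \<open>1 + \<bar>t\<bar>\<close> and the weight are at least 1, and the trivial bound 2 is
  enough.\<close>

lemma osc_bound:
  assumes e: "e = (1, 0) \<or> e = (0, 1)"
  shows "cmod (osc e t \<zeta> \<tau>) \<le> 12 * min 1 ((1 + \<bar>t\<bar>) * weight \<zeta> * \<bar>\<tau>\<bar>)"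
    and "cmod (osc e t (v - \<tau> *\<^sub>R e) \<tau>) \<le> 12 * min 1 ((1 + \<bar>t\<bar>) * weight v * \<bar>\<tau>\<bar>)"
proof -
  have *: "cmod (cis (t * D) - 1) \<le> 12 * min 1 ((1 + \<bar>t\<bar>) * weight u * \<bar>\<tau>\<bar>)"
    if D: "\<bar>\<tau>\<bar> \<le> 1 \<Longrightarrow> \<bar>D\<bar> \<le> 6 * \<bar>\<tau>\<bar> * weight u" for D u
  proof (cases "\<bar>\<tau>\<bar> \<le> 1")
    case True
    have "\<bar>t * D\<bar> \<le> (1 + \<bar>t\<bar>) * (6 * \<bar>\<tau>\<bar> * weight u)"
      unfolding abs_mult by (intro mult_mono D True) auto
    then have "2 * min 1 \<bar>t * D\<bar> \<le> 12 * min 1 ((1 + \<bar>t\<bar>) * weight u * \<bar>\<tau>\<bar>)"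
      by (auto simp: min_def algebra_simps)
    then show ?thesis using cmod_cis_diff_le[of "t * D"] by linarith
  next
    case False
    have "1 * 1 * 1 \<le> (1 + \<bar>t\<bar>) * weight u * \<bar>\<tau>\<bar>"
      using False by (intro mult_mono) auto
    then have "12 * min 1 ((1 + \<bar>t\<bar>) * weight u * \<bar>\<tau>\<bar>) = 12" by simp
    then show ?thesis using cmod_cis_diff_le[of "t * D"] by linarith
  qed
  show "cmod (osc e t \<zeta> \<tau>) \<le> 12 * min 1 ((1 + \<bar>t\<bar>) * weight \<zeta> * \<bar>\<tau>\<bar>)"
    unfolding osc_def by (intro * phase_diff_bound e)
  show "cmod (osc e t (v - \<tau> *\<^sub>R e) \<tau>) \<le> 12 * min 1 ((1 + \<bar>t\<bar>) * weight v * \<bar>\<tau>\<bar>)"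
    unfolding osc_def using phase_diff_bound[OF e, of "- \<tau>" v]
    by (intro *) (simp add: abs_minus_commute)
qed

text \<open>36 is 12 from the oscillating factor times 3 from the comparison of weights, for short
  shifts. The second term belongs to long shifts, where
  \<open>max 1 \<bar>\<tau>\<bar> powr b\<close> turns \<open>kern a\<close> into
  \<open>kern (a - b)\<close>.\<close>

definition Schur_const :: "real \<Rightarrow> real \<Rightarrow> real" where
  "Schur_const a b = 36 * Jconst a + 2 * Jconst (a - b)"

lemma Schur_const_nonneg [simp]: "0 \<le> Schur_const a b"
  by (simp add: Schur_const_def)

text \<open>The Schur test with weight \<open>weight powr a\<close>. Both row and column integrals
  are split at \<open>\<bar>\<tau>\<bar> = 1\<close>: the short part scales like the weight to the
  power a, while the long part is bounded independently of the base point and is absorbed since the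
  weight is at least 1.\<close>

lemma osc_Schur:
  assumes e: "e = (1, 0) \<or> e = (0, 1)" and a: "0 < a" "a < 1" and b: "0 \<le> b" "b < a"
    and [measurable]: "g \<in> borel_measurable borel"
  shows "(\<integral>\<^sup>+\<zeta>. (\<integral>\<^sup>+\<tau>. ennreal (cmod (osc e t \<zeta> \<tau>) * kern a \<tau> * max 1 \<bar>\<tau>\<bar> powr b * cmod (g (\<zeta> + \<tau> *\<^sub>R e))) \<partial>lborel)\<^sup>2 \<partial>lborel)
    \<le> ennreal (Schur_const a b * (1 + \<bar>t\<bar>) * (Schur_const a b * (1 + \<bar>t\<bar>)))
      * (\<integral>\<^sup>+\<zeta>. ennreal ((weight \<zeta> powr a)\<^sup>2 * (cmod (g \<zeta>))\<^sup>2) \<partial>lborel)"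
proof -
  have e1: "norm e = 1" using e by auto
  define T where "T = 1 + \<bar>t\<bar>"
  have T: "1 \<le> T" by (simp add: T_def)
  \<comment> \<open>This produces the linear growth in t; it needs a base of at least 1, hence
    \<open>1 + \<bar>t\<bar>\<close>.\<close>
  have Ta: "T powr a \<le> T" using powr_mono[of a 1 T] a T by simp
  have ab: "0 < a - b" "a - b < 1" using a b by auto
  define K where "K \<zeta> \<tau> = cmod (osc e t \<zeta> \<tau>) * kern a \<tau> * max 1 \<bar>\<tau>\<bar> powr b" for \<zeta> \<tau>
  have [measurable]: "(\<lambda>(\<zeta>, \<tau>). K \<zeta> \<tau>) \<in> borel_measurable (borel \<Otimes>\<^sub>M borel)"
    unfolding K_def by measurable
  have far: "K \<zeta> \<tau> \<le> 2 * (min 1 \<bar>\<tau>\<bar> * kern (a - b) \<tau>)" if "\<bar>\<tau>\<bar> > 1" for \<zeta> \<tau>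
  proof -
    have "kern a \<tau> * \<bar>\<tau>\<bar> powr b = kern (a - b) \<tau>"
      using that by (simp add: kern_def powr_add powr_diff field_simps)
    then have "K \<zeta> \<tau> = cmod (osc e t \<zeta> \<tau>) * kern (a - b) \<tau>"
      using that by (simp add: K_def mult.assoc)
    also have "\<dots> \<le> 2 * kern (a - b) \<tau>" by (intro mult_right_mono osc_le_2) simp
    finally show ?thesis using that by simp
  qed
  have near: "K \<zeta> \<tau> = cmod (osc e t \<zeta> \<tau>) * kern a \<tau>" if "\<bar>\<tau>\<bar> \<le> 1" for \<zeta> \<tau>
    using that by (simp add: K_def)
  have J0: "(\<integral>\<^sup>+\<tau>. ennreal (c * (min 1 (T * weight u * \<bar>\<tau>\<bar>) * kern a \<tau>) + 2 * (min 1 \<bar>\<tau>\<bar> * kern (a - b) \<tau>)) \<partial>lborel)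
      = ennreal (c * (T powr a * weight u powr a * Jconst a) + 2 * Jconst (a - b))" if "c \<ge> 0" for c u
  proof -
    have Tw: "0 \<le> T * weight u" using T by (simp add: less_imp_le)
    have "(\<integral>\<^sup>+\<tau>. ennreal (c * (min 1 (T * weight u * \<bar>\<tau>\<bar>) * kern a \<tau>) + 2 * (min 1 \<bar>\<tau>\<bar> * kern (a - b) \<tau>)) \<partial>lborel)
      = (\<integral>\<^sup>+\<tau>. ennreal c * ennreal (min 1 (T * weight u * \<bar>\<tau>\<bar>) * kern a \<tau>) + ennreal 2 * ennreal (min 1 (1 * \<bar>\<tau>\<bar>) * kern (a - b) \<tau>) \<partial>lborel)"
      using that T by (intro nn_integral_cong) (simp add: ennreal_plus ennreal_mult)
    also have "\<dots> = ennreal c * ennreal ((T * weight u) powr a * Jconst a) + ennreal 2 * ennreal (1 powr (a - b) * Jconst (a - b))"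
      by (subst nn_integral_add) (simp_all add: nn_integral_cmult nn_integral_min_kern[OF a Tw] nn_integral_min_kern[OF ab, of 1, simplified])
    also have "\<dots> = ennreal (c * (T powr a * weight u powr a * Jconst a) + 2 * Jconst (a - b))"
      using that T by (simp del: ennreal_numeral add: powr_mult less_imp_le flip: ennreal_mult ennreal_plus)
    finally show ?thesis .
  qed
  have recip: "1 / y \<le> 3 / x" if "x \<le> 3 * y" "1 \<le> x" "1 \<le> y" for x y :: real
    using that by (simp add: field_simps)
  have w1: "1 \<le> weight u powr a" for u using ge_one_powr_ge_zero[of "weight u" a] a by simp
  have "(\<integral>\<^sup>+\<zeta>. (\<integral>\<^sup>+\<tau>. ennreal (K \<zeta> \<tau> * cmod (g (\<zeta> + \<tau> *\<^sub>R e))) \<partial>lborel)\<^sup>2 \<partial>lborel)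
    \<le> ennreal (Schur_const a b * T * (Schur_const a b * T)) * (\<integral>\<^sup>+\<zeta>. ennreal ((weight \<zeta> powr a)\<^sup>2 * (cmod (g \<zeta>))\<^sup>2) \<partial>lborel)"
  proof (rule Schur_test_line)
    show "0 \<le> K \<zeta> \<tau>" for \<zeta> \<tau> by (simp add: K_def)
    show "0 < weight \<zeta> powr a" for \<zeta> using w1[of \<zeta>] by linarith
    show "0 \<le> Schur_const a b * T" using T by simp
    then show "0 \<le> Schur_const a b * T" .
    show "(\<integral>\<^sup>+\<tau>. ennreal (K \<zeta> \<tau> / weight (\<zeta> + \<tau> *\<^sub>R e) powr a) \<partial>lborel) \<le> ennreal (Schur_const a b * T)" for \<zeta>
    proof -
      have "K \<zeta> \<tau> / weight (\<zeta> + \<tau> *\<^sub>R e) powr a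
        \<le> 36 / weight \<zeta> powr a * (min 1 (T * weight \<zeta> * \<bar>\<tau>\<bar>) * kern a \<tau>) + 2 * (min 1 \<bar>\<tau>\<bar> * kern (a - b) \<tau>)" for \<tau>
      proof (cases "\<bar>\<tau>\<bar> \<le> 1")
        case True
        let ?w = "weight (\<zeta> + \<tau> *\<^sub>R e)"
        have "weight \<zeta> \<le> 3 * ?w" using weight_shift[OF e1, of \<zeta> \<tau>] True by simp
        then have "weight \<zeta> powr a \<le> (3 * ?w) powr a" using a by (intro powr_mono2) (auto simp: less_imp_le)
        also have "\<dots> \<le> 3 * ?w powr a"
          using powr_mono[of a 1 "3::real"] a by (simp add: powr_mult less_imp_le mult_right_mono)
        finally have "1 / ?w powr a \<le> 3 / weight \<zeta> powr a"
          by (rule recip) (rule w1)+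
        moreover have "K \<zeta> \<tau> \<le> 12 * min 1 (T * weight \<zeta> * \<bar>\<tau>\<bar>) * kern a \<tau>"
          unfolding near[OF True] using osc_bound(1)[OF e, of t \<zeta> \<tau>] by (intro mult_right_mono) (simp_all add: T_def)
        ultimately have "K \<zeta> \<tau> * (1 / ?w powr a) \<le> (12 * min 1 (T * weight \<zeta> * \<bar>\<tau>\<bar>) * kern a \<tau>) * (3 / weight \<zeta> powr a)"
          using T by (intro mult_mono) (auto simp: K_def less_imp_le)
        also have "\<dots> \<le> 36 / weight \<zeta> powr a * (min 1 (T * weight \<zeta> * \<bar>\<tau>\<bar>) * kern a \<tau>) + 2 * (min 1 \<bar>\<tau>\<bar> * kern (a - b) \<tau>)"
          by simp
        finally show ?thesis by simp
      next
        case False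
        have "K \<zeta> \<tau> / weight (\<zeta> + \<tau> *\<^sub>R e) powr a \<le> K \<zeta> \<tau> / 1"
          using w1[of "\<zeta> + \<tau> *\<^sub>R e"] by (intro divide_left_mono) (auto simp: K_def)
        also have "\<dots> \<le> 2 * (min 1 \<bar>\<tau>\<bar> * kern (a - b) \<tau>)" using far[of \<tau> \<zeta>] False by simp
        also have "\<dots> \<le> 36 / weight \<zeta> powr a * (min 1 (T * weight \<zeta> * \<bar>\<tau>\<bar>) * kern a \<tau>) + 2 * (min 1 \<bar>\<tau>\<bar> * kern (a - b) \<tau>)"
          using T by (simp add: less_imp_le)
        finally show ?thesis .
      qed
      then have "(\<integral>\<^sup>+\<tau>. ennreal (K \<zeta> \<tau> / weight (\<zeta> + \<tau> *\<^sub>R e) powr a) \<partial>lborel)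
        \<le> (\<integral>\<^sup>+\<tau>. ennreal (36 / weight \<zeta> powr a * (min 1 (T * weight \<zeta> * \<bar>\<tau>\<bar>) * kern a \<tau>) + 2 * (min 1 \<bar>\<tau>\<bar> * kern (a - b) \<tau>)) \<partial>lborel)"
        by (intro nn_integral_mono ennreal_leI)
      also have "\<dots> = ennreal (36 / weight \<zeta> powr a * (T powr a * weight \<zeta> powr a * Jconst a) + 2 * Jconst (a - b))"
        by (rule J0) simp
      also have "\<dots> \<le> ennreal (Schur_const a b * T)"
      proof (rule ennreal_leI)
        have "36 / weight \<zeta> powr a * (T powr a * weight \<zeta> powr a * Jconst a) + 2 * Jconst (a - b) = 36 * (T powr a * Jconst a) + 2 * (1 * Jconst (a - b))"
          using w1[of \<zeta>] by simp
        also have "\<dots> \<le> 36 * (T * Jconst a) + 2 * (T * Jconst (a - b))"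
          using T Ta by (intro add_mono mult_left_mono mult_right_mono) auto
        finally show "36 / weight \<zeta> powr a * (T powr a * weight \<zeta> powr a * Jconst a) + 2 * Jconst (a - b) \<le> Schur_const a b * T"
          by (simp add: Schur_const_def algebra_simps)
      qed
      finally show ?thesis .
    qed
    show "(\<integral>\<^sup>+\<tau>. ennreal (K (v - \<tau> *\<^sub>R e) \<tau>) \<partial>lborel) \<le> ennreal (Schur_const a b * T * weight v powr a)" for v
    proof -
      have "K (v - \<tau> *\<^sub>R e) \<tau> \<le> 12 * (min 1 (T * weight v * \<bar>\<tau>\<bar>) * kern a \<tau>) + 2 * (min 1 \<bar>\<tau>\<bar> * kern (a - b) \<tau>)" for \<tau>
      proof (cases "\<bar>\<tau>\<bar> \<le> 1")
        case True
        have "K (v - \<tau> *\<^sub>R e) \<tau> \<le> 12 * min 1 (T * weight v * \<bar>\<tau>\<bar>) * kern a \<tau>"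
          unfolding near[OF True] using osc_bound(2)[OF e, of t v \<tau>] by (intro mult_right_mono) (simp_all add: T_def)
        also have "\<dots> \<le> 12 * (min 1 (T * weight v * \<bar>\<tau>\<bar>) * kern a \<tau>) + 2 * (min 1 \<bar>\<tau>\<bar> * kern (a - b) \<tau>)"
          by simp
        finally show ?thesis .
      next
        case False
        have "0 \<le> 12 * (min 1 (T * weight v * \<bar>\<tau>\<bar>) * kern a \<tau>)" using T by (simp add: less_imp_le)
        moreover have "1 < \<bar>\<tau>\<bar>" using False by simp
        ultimately show ?thesis using far[of \<tau> "v - \<tau> *\<^sub>R e"] by linarith
      qed
      then have "(\<integral>\<^sup>+\<tau>. ennreal (K (v - \<tau> *\<^sub>R e) \<tau>) \<partial>lborel)
        \<le> (\<integral>\<^sup>+\<tau>. ennreal (12 * (min 1 (T * weight v * \<bar>\<tau>\<bar>) * kern a \<tau>) + 2 * (min 1 \<bar>\<tau>\<bar> * kern (a - b) \<tau>)) \<partial>lborel)"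
        by (intro nn_integral_mono ennreal_leI)
      also have "\<dots> = ennreal (12 * (T powr a * weight v powr a * Jconst a) + 2 * Jconst (a - b))"
        by (rule J0) simp
      also have "\<dots> \<le> ennreal (Schur_const a b * T * weight v powr a)"
      proof (rule ennreal_leI)
        \<comment> \<open>Lets the contribution of long shifts, which carries neither time nor
          weight, be absorbed into the common bound.\<close>
        have TW: "1 * 1 \<le> T * weight v powr a" by (rule mult_mono) (use T w1 in auto)
        have "12 * (T powr a * weight v powr a * Jconst a) + 2 * (1 * Jconst (a - b))
          \<le> 36 * (T * weight v powr a * Jconst a) + 2 * (T * weight v powr a * Jconst (a - b))"
          using TW Ta by (intro add_mono mult_mono mult_right_mono) auto
        then show "12 * (T powr a * weight v powr a * Jconst a) + 2 * Jconst (a - b) \<le> Schur_const a b * T * weight v powr a"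
          by (simp add: Schur_const_def algebra_simps)
      qed
      finally show ?thesis .
    qed
  qed measurable
  then show ?thesis by (simp add: K_def T_def)
qed

text \<open>The \<Phi>-integral with moduli inside, without truncation and without the constant
  \<open>1 / d_const a\<close>. Its finiteness at a point is a criterion for convergence there, and
  it dominates all truncations at once.\<close>

definition oscint :: "real \<times> real \<Rightarrow> real \<Rightarrow> real \<Rightarrow> (real \<times> real \<Rightarrow> complex) \<Rightarrow> real \<times> real \<Rightarrow> ennreal" where
  "oscint e t a f \<zeta> = (\<integral>\<^sup>+\<tau>. ennreal (cmod (osc e t \<zeta> \<tau>) * kern a \<tau> * cmod (f (\<zeta> + \<tau> *\<^sub>R e))) \<partial>lborel)"

lemma oscint_measurable [measurable]:
  assumes [measurable]: "f \<in> borel_measurable borel"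
  shows "oscint e t a f \<in> borel_measurable borel"
  unfolding oscint_def[abs_def] by measurable

text \<open>The outer weight is moved to the shifted point and joined to f, at the cost of
  \<open>max 1 \<bar>\<tau>\<bar> powr b\<close> and a factor below 2. The Schur test then adds the
  power a, so the total on f is \<open>a + b / 2\<close>, that is, \<open>2 * a + b\<close>
  derivatives.\<close>

lemma oscint_bound:
  assumes e: "e = (1, 0) \<or> e = (0, 1)" and a: "0 < a" "a < 1" and b: "0 \<le> b" "b < a"
    and f: "f \<in> borel_measurable borel"
    and wf: "L2 (\<lambda>\<zeta>. complex_of_real (weight \<zeta> powr (a + b / 2)) * f \<zeta>)"
  shows "(\<integral>\<^sup>+\<zeta>. (ennreal (weight \<zeta> powr (b / 2)) * oscint e t a f \<zeta>)\<^sup>2 \<partial>lborel)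
    \<le> ennreal ((2 * Schur_const a b * (1 + \<bar>t\<bar>) * norm2 (\<lambda>\<zeta>. complex_of_real (weight \<zeta> powr (a + b / 2)) * f \<zeta>))\<^sup>2)"
proof -
  note [measurable] = f
  have e1: "norm e = 1" using e by auto
  define g where "g \<zeta> = complex_of_real (weight \<zeta> powr (b / 2)) * f \<zeta>" for \<zeta>
  have [measurable]: "g \<in> borel_measurable borel" unfolding g_def by measurable
  define C where "C = Schur_const a b * (1 + \<bar>t\<bar>)"
  define n where "n = norm2 (\<lambda>\<zeta>. complex_of_real (weight \<zeta> powr (a + b / 2)) * f \<zeta>)"
  define S where "S \<zeta> = (\<integral>\<^sup>+\<tau>. ennreal (cmod (osc e t \<zeta> \<tau>) * kern a \<tau> * max 1 \<bar>\<tau>\<bar> powr b * cmod (g (\<zeta> + \<tau> *\<^sub>R e))) \<partial>lborel)" for \<zeta>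
  have [measurable]: "S \<in> borel_measurable borel" unfolding S_def by measurable
  have pt: "ennreal (weight \<zeta> powr (b / 2)) * oscint e t a f \<zeta> \<le> ennreal 2 * S \<zeta>" for \<zeta>
  proof -
    have "weight \<zeta> powr (b / 2) * (cmod (osc e t \<zeta> \<tau>) * kern a \<tau> * cmod (f (\<zeta> + \<tau> *\<^sub>R e)))
      \<le> 2 * (cmod (osc e t \<zeta> \<tau>) * kern a \<tau> * max 1 \<bar>\<tau>\<bar> powr b * cmod (g (\<zeta> + \<tau> *\<^sub>R e)))" for \<tau>
    proof -
      let ?w = "weight (\<zeta> + \<tau> *\<^sub>R e)" and ?m = "max 1 \<bar>\<tau>\<bar>"
      have "weight \<zeta> powr (b / 2) \<le> (3 * ?w * ?m\<^sup>2) powr (b / 2)"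
        using weight_shift[OF e1, of \<zeta> \<tau>] b by (intro powr_mono2) (auto simp: less_imp_le)
      also have "\<dots> = 3 powr (b / 2) * ?w powr (b / 2) * ?m powr b"
      proof -
        have "(?m\<^sup>2) powr (b / 2) = ?m powr b" by (simp add: powr_powr flip: powr_numeral)
        then show ?thesis by (simp add: powr_mult less_imp_le)
      qed
      also have "\<dots> \<le> 2 * ?w powr (b / 2) * ?m powr b"
      proof (intro mult_right_mono)
        have "3 powr (b / 2) \<le> 3 powr (1 / 2 :: real)" using a b by (intro powr_mono) auto
        also have "\<dots> \<le> 2" by (simp add: powr_half_sqrt real_le_lsqrt)
        finally show "3 powr (b / 2) \<le> 2" .
      qed auto
      finally have "weight \<zeta> powr (b / 2) * (cmod (osc e t \<zeta> \<tau>) * kern a \<tau> * cmod (f (\<zeta> + \<tau> *\<^sub>R e)))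
        \<le> (2 * ?w powr (b / 2) * ?m powr b) * (cmod (osc e t \<zeta> \<tau>) * kern a \<tau> * cmod (f (\<zeta> + \<tau> *\<^sub>R e)))"
        by (intro mult_right_mono) auto
      then show ?thesis by (simp add: g_def norm_mult ac_simps)
    qed
    then have "(\<integral>\<^sup>+\<tau>. ennreal (weight \<zeta> powr (b / 2) * (cmod (osc e t \<zeta> \<tau>) * kern a \<tau> * cmod (f (\<zeta> + \<tau> *\<^sub>R e)))) \<partial>lborel)
      \<le> (\<integral>\<^sup>+\<tau>. ennreal (2 * (cmod (osc e t \<zeta> \<tau>) * kern a \<tau> * max 1 \<bar>\<tau>\<bar> powr b * cmod (g (\<zeta> + \<tau> *\<^sub>R e)))) \<partial>lborel)"
      by (intro nn_integral_mono ennreal_leI)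
    moreover have "(\<integral>\<^sup>+\<tau>. ennreal (weight \<zeta> powr (b / 2) * (cmod (osc e t \<zeta> \<tau>) * kern a \<tau> * cmod (f (\<zeta> + \<tau> *\<^sub>R e)))) \<partial>lborel)
      = ennreal (weight \<zeta> powr (b / 2)) * oscint e t a f \<zeta>"
      unfolding oscint_def by (subst nn_integral_cmult[symmetric]) (auto simp: ennreal_mult)
    moreover have "(\<integral>\<^sup>+\<tau>. ennreal (2 * (cmod (osc e t \<zeta> \<tau>) * kern a \<tau> * max 1 \<bar>\<tau>\<bar> powr b * cmod (g (\<zeta> + \<tau> *\<^sub>R e)))) \<partial>lborel) = ennreal 2 * S \<zeta>"
      unfolding S_def by (subst nn_integral_cmult[symmetric]) (auto simp: ennreal_mult)
    ultimately show ?thesis by simp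
  qed
  have "(\<integral>\<^sup>+\<zeta>. (ennreal (weight \<zeta> powr (b / 2)) * oscint e t a f \<zeta>)\<^sup>2 \<partial>lborel) \<le> (\<integral>\<^sup>+\<zeta>. (ennreal 2)\<^sup>2 * (S \<zeta>)\<^sup>2 \<partial>lborel)"
    unfolding power_mult_distrib[symmetric] by (intro nn_integral_mono power_mono pt) simp
  also have "\<dots> = ennreal 4 * (\<integral>\<^sup>+\<zeta>. (S \<zeta>)\<^sup>2 \<partial>lborel)"
    by (subst nn_integral_cmult) (auto simp: ennreal_power)
  also have "\<dots> \<le> ennreal 4 * (ennreal (C * C) * (\<integral>\<^sup>+\<zeta>. ennreal ((weight \<zeta> powr a)\<^sup>2 * (cmod (g \<zeta>))\<^sup>2) \<partial>lborel))"
    unfolding S_def C_def by (intro mult_left_mono osc_Schur e a b) auto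
  also have "(\<integral>\<^sup>+\<zeta>. ennreal ((weight \<zeta> powr a)\<^sup>2 * (cmod (g \<zeta>))\<^sup>2) \<partial>lborel) = nn2 (\<lambda>\<zeta>. complex_of_real (weight \<zeta> powr (a + b / 2)) * f \<zeta>)"
    by (intro nn_integral_cong) (simp add: g_def norm_mult power_mult_distrib powr_add)
  also have "\<dots> = ennreal (n\<^sup>2)" using nn2_norm2[OF wf] by (simp add: n_def)
  also have "ennreal 4 * (ennreal (C * C) * ennreal (n\<^sup>2)) = ennreal ((2 * C * n)\<^sup>2)"
    by (simp del: ennreal_numeral add: C_def n_def power2_eq_square ac_simps flip: ennreal_mult)
  finally show ?thesis by (simp add: C_def n_def mult.assoc)
qed

section \<open>The principal value\<close>

definition Phi_trunc :: "real \<times> real \<Rightarrow> real \<Rightarrow> real \<Rightarrow> (real \<times> real \<Rightarrow> complex) \<Rightarrow> real \<Rightarrow> real \<times> real \<Rightarrow> complex" where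
  "Phi_trunc e t a f \<epsilon> \<zeta> = complex_of_real (1 / d_const a) *
     (\<integral>\<tau>. complex_of_real (trunc_kern a \<epsilon> \<tau>) * (osc e t \<zeta> \<tau> * f (\<zeta> + \<tau> *\<^sub>R e)) \<partial>lborel)"

definition Phi_dir :: "real \<times> real \<Rightarrow> real \<Rightarrow> real \<Rightarrow> (real \<times> real \<Rightarrow> complex) \<Rightarrow> real \<times> real \<Rightarrow> complex" where
  "Phi_dir e t a f \<zeta> = Lim (at_right 0) (\<lambda>\<epsilon>. Phi_trunc e t a f \<epsilon> \<zeta>)"

lemma Phi1_eq: "Phi1 t a f = Phi_dir (1, 0) t a f" and Phi2_eq: "Phi2 t a f = Phi_dir (0, 1) t a f"
proof -
  have v: "(fst \<zeta> + \<tau>, snd \<zeta>) = \<zeta> + \<tau> *\<^sub>R (1, 0)" "(fst \<zeta>, snd \<zeta> + \<tau>) = \<zeta> + \<tau> *\<^sub>R (0, 1)" for \<zeta> :: "real \<times> real" and \<tau>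
    by (simp_all add: prod_eq_iff)
  have i: "indicator {\<tau>. \<epsilon> \<le> \<bar>\<tau>\<bar>} \<tau> *\<^sub>R (c / complex_of_real (\<bar>\<tau>\<bar> powr (1 + a)) * w)
      = complex_of_real (trunc_kern a \<epsilon> \<tau>) * (c * w)" for \<epsilon> \<tau> c w
    by (simp add: trunc_kern_def kern_def scaleR_conv_of_real divide_simps)
  show "Phi1 t a f = Phi_dir (1, 0) t a f" "Phi2 t a f = Phi_dir (0, 1) t a f"
    by (intro ext, simp only: Phi1_def Phi2_def Phi_dir_def Phi_trunc_def set_lebesgue_integral_def v i osc_def)+
qed

text \<open>Expresses \<open>Lim\<close> by countably many values of G, so that measurability in a
  parameter can be read off. By continuity the Cauchy condition at 0 may be tested on rational
  points, and the default value in the divergent case is one fixed number, independent of G.\<close>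

lemma Lim_at_right_Cauchy:
  fixes G :: "real \<Rightarrow> complex"
  assumes G: "continuous_on {0<..} G"
  shows "Lim (at_right 0) G = (if \<forall>n::nat. \<exists>m::nat. \<forall>p\<in>\<rat>. \<forall>q\<in>\<rat>.
      0 < p \<and> p < 1 / real (Suc m) \<and> 0 < q \<and> q < 1 / real (Suc m) \<longrightarrow> cmod (G p - G q) \<le> 1 / real (Suc n)
    then lim (\<lambda>n. G (1 / real (Suc n))) else (THE l. False))"
    (is "_ = (if ?C then _ else _)")
proof (cases "\<exists>l. (G \<longlongrightarrow> l) (at_right 0)")
  case True
  then obtain l where l: "(G \<longlongrightarrow> l) (at_right 0)" by blast
  have C: ?C
  proof
    fix n
    have "\<forall>\<^sub>F x in at_right 0. dist (G x) l < 1 / (2 * real (Suc n))"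
      using l by (rule tendstoD) simp
    then obtain d where d: "d > 0" "\<And>x. 0 < x \<Longrightarrow> x < d \<Longrightarrow> dist (G x) l < 1 / (2 * real (Suc n))"
      by (auto simp: eventually_at_right_field)
    obtain m where m: "1 / real (Suc m) < d" using d(1) reals_Archimedean by (auto simp: inverse_eq_divide)
    have "cmod (G p - G q) \<le> 1 / real (Suc n)" if "0 < p" "p < 1 / real (Suc m)" "0 < q" "q < 1 / real (Suc m)" for p q
    proof -
      have "dist (G p) (G q) < 1 / (2 * real (Suc n)) + 1 / (2 * real (Suc n))"
        using dist_triangle2[of "G p" "G q" l] d(2)[of p] d(2)[of q] that m by linarith
      then show ?thesis by (simp add: dist_norm field_simps)
    qed
    then show "\<exists>m. \<forall>p\<in>\<rat>. \<forall>q\<in>\<rat>.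
      0 < p \<and> p < 1 / real (Suc m) \<and> 0 < q \<and> q < 1 / real (Suc m) \<longrightarrow> cmod (G p - G q) \<le> 1 / real (Suc n)" by blast
  qed
  have "filterlim (\<lambda>n. 1 / real (Suc n)) (at_right 0) sequentially"
    using LIMSEQ_Suc[OF lim_1_over_n] by (simp add: filterlim_at_right_to_0 filterlim_at)
  from filterlim_compose[OF l this] have "lim (\<lambda>n. G (1 / real (Suc n))) = l" by (rule limI)
  then show ?thesis using C tendsto_Lim[OF _ l] by simp
next
  case False
  have nC: "\<not> ?C"
  proof
    assume C: ?C
    \<comment> \<open>A violation at a real x would persist near x by continuity and thus occur at a
      rational point.\<close>
    have ext: "cmod (G x - G q) \<le> c"
      if c: "\<And>p. p \<in> \<rat> \<Longrightarrow> 0 < p \<Longrightarrow> p < d \<Longrightarrow> cmod (G p - G q) \<le> c" and x: "0 < x" "x < d" for x q c d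
    proof (rule ccontr)
      assume "\<not> cmod (G x - G q) \<le> c"
      moreover have "continuous_on {0<..} (\<lambda>x. cmod (G x - G q))"
        by (intro continuous_intros G)
      then have "((\<lambda>x. cmod (G x - G q)) \<longlongrightarrow> cmod (G x - G q)) (at x)"
        using x(1) by (simp add: continuous_on_def at_within_open[of _ "{0<..}"])
      ultimately have "\<forall>\<^sub>F y in at x. c < cmod (G y - G q)"
        by (intro order_tendstoD(1)) auto
      then obtain r where r: "r > 0" "\<And>y. y \<noteq> x \<Longrightarrow> dist y x < r \<Longrightarrow> c < cmod (G y - G q)"
        by (auto simp: eventually_at)
      obtain p where p: "p \<in> \<rat>" "x < p" "p < min d (x + r)"
        using Rats_dense_in_real[of x "min d (x + r)"] x r(1) by auto
      then have "c < cmod (G p - G q)" by (intro r(2)) (auto simp: dist_real_def)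
      then show False using c[of p] p x by force
    qed
    have "Cauchy (\<lambda>n. G (1 / real (Suc n)))"
    proof (rule metric_CauchyI)
      fix r :: real assume "r > 0"
      then obtain n where n: "1 / real (Suc n) < r" using reals_Archimedean by (auto simp: inverse_eq_divide)
      obtain m where m: "\<And>p q. p \<in> \<rat> \<Longrightarrow> q \<in> \<rat> \<Longrightarrow> 0 < p \<Longrightarrow> p < 1 / real (Suc m) \<Longrightarrow> 0 < q \<Longrightarrow> q < 1 / real (Suc m) \<Longrightarrow> cmod (G p - G q) \<le> 1 / real (Suc n)"
        using C by metis
      \<comment> \<open>\<open>Suc m\<close> rather than m, because the Cauchy condition asks for
        arguments strictly below \<open>1 / real (Suc m)\<close>; the points themselves are
        rational.\<close>
      have "dist (G (1 / real (Suc i))) (G (1 / real (Suc j))) < r" if "i \<ge> Suc m" "j \<ge> Suc m" for i j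
      proof -
        have "cmod (G (1 / real (Suc i)) - G (1 / real (Suc j))) \<le> 1 / real (Suc n)"
          using that by (intro m) (auto simp: divide_simps)
        then show ?thesis using n by (simp add: dist_norm)
      qed
      then show "\<exists>M. \<forall>i\<ge>M. \<forall>j\<ge>M. dist (G (1 / real (Suc i))) (G (1 / real (Suc j))) < r" by blast
    qed
    then obtain l where l: "(\<lambda>n. G (1 / real (Suc n))) \<longlonglongrightarrow> l"
      using Cauchy_convergent convergent_def by blast
    have "(G \<longlongrightarrow> l) (at_right 0)"
    proof (rule tendstoI)
      fix r :: real assume "r > 0"
      then obtain n where n: "1 / real (Suc n) < r" using reals_Archimedean by (auto simp: inverse_eq_divide)
      obtain m where m: "\<And>p q. p \<in> \<rat> \<Longrightarrow> q \<in> \<rat> \<Longrightarrow> 0 < p \<Longrightarrow> p < 1 / real (Suc m) \<Longrightarrow> 0 < q \<Longrightarrow> q < 1 / real (Suc m) \<Longrightarrow> cmod (G p - G q) \<le> 1 / real (Suc n)"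
        using C by metis
      have "cmod (G x - l) \<le> 1 / real (Suc n)" if x: "0 < x" "x < 1 / real (Suc m)" for x
      proof (rule tendsto_upperbound)
        show "(\<lambda>j. cmod (G x - G (1 / real (Suc j)))) \<longlonglongrightarrow> cmod (G x - l)"
          by (intro tendsto_intros l)
        show "\<forall>\<^sub>F j in sequentially. cmod (G x - G (1 / real (Suc j))) \<le> 1 / real (Suc n)"
        proof (rule eventually_sequentiallyI[of "Suc m"])
          fix j assume "Suc m \<le> j"
          then show "cmod (G x - G (1 / real (Suc j))) \<le> 1 / real (Suc n)"
            by (intro ext[OF _ x] m) (auto simp: divide_simps)
        qed
      qed simp
      then show "\<forall>\<^sub>F x in at_right 0. dist (G x) l < r"
        unfolding eventually_at_right_field dist_norm using n
        by (intro exI[of _ "1 / real (Suc m)"]) (auto intro: le_less_trans)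
    qed
    with False show False by blast
  qed
  \<comment> \<open>\<open>Lim\<close> is a definite description; without a limit its predicate is
    false everywhere, so it reduces to \<open>THE l. False\<close>.\<close>
  show ?thesis
    unfolding if_not_P[OF nC] using False by (simp add: Topological_Spaces.Lim_def)
qed

context
  fixes e :: "real \<times> real" and t a :: real and f :: "real \<times> real \<Rightarrow> complex"
  assumes f [measurable]: "f \<in> borel_measurable borel"
begin

lemma Phi_trunc_measurable [measurable]: "Phi_trunc e t a f \<epsilon> \<in> borel_measurable borel"
  unfolding Phi_trunc_def[abs_def] by measurable

text \<open>Valid at every point: where the truncated integrand is not integrable, its Bochner
  integral is 0 and the bound is trivial.\<close>

lemma Phi_trunc_bound:
  "ennreal (cmod (Phi_trunc e t a f \<epsilon> \<zeta>)) \<le> ennreal (1 / \<bar>d_const a\<bar>) * oscint e t a f \<zeta>"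
proof (cases "integrable lborel (\<lambda>\<tau>. complex_of_real (trunc_kern a \<epsilon> \<tau>) * (osc e t \<zeta> \<tau> * f (\<zeta> + \<tau> *\<^sub>R e)))")
  case True
  have "ennreal (cmod (\<integral>\<tau>. complex_of_real (trunc_kern a \<epsilon> \<tau>) * (osc e t \<zeta> \<tau> * f (\<zeta> + \<tau> *\<^sub>R e)) \<partial>lborel))
      \<le> (\<integral>\<^sup>+\<tau>. ennreal (norm (complex_of_real (trunc_kern a \<epsilon> \<tau>) * (osc e t \<zeta> \<tau> * f (\<zeta> + \<tau> *\<^sub>R e)))) \<partial>lborel)"
    by (rule integral_norm_bound_ennreal[OF True])
  also have "\<dots> \<le> oscint e t a f \<zeta>"
    unfolding oscint_def
  proof (intro nn_integral_mono ennreal_leI)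
    fix \<tau>
    have "trunc_kern a \<epsilon> \<tau> * (cmod (osc e t \<zeta> \<tau>) * cmod (f (\<zeta> + \<tau> *\<^sub>R e))) \<le> kern a \<tau> * (cmod (osc e t \<zeta> \<tau>) * cmod (f (\<zeta> + \<tau> *\<^sub>R e)))"
      by (intro mult_right_mono trunc_kern_le) simp
    then show "norm (complex_of_real (trunc_kern a \<epsilon> \<tau>) * (osc e t \<zeta> \<tau> * f (\<zeta> + \<tau> *\<^sub>R e))) \<le> cmod (osc e t \<zeta> \<tau>) * kern a \<tau> * cmod (f (\<zeta> + \<tau> *\<^sub>R e))"
      by (simp add: norm_mult ac_simps)
  qed
  finally have "ennreal (1 / \<bar>d_const a\<bar>) * ennreal (cmod (\<integral>\<tau>. complex_of_real (trunc_kern a \<epsilon> \<tau>) * (osc e t \<zeta> \<tau> * f (\<zeta> + \<tau> *\<^sub>R e)) \<partial>lborel))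
      \<le> ennreal (1 / \<bar>d_const a\<bar>) * oscint e t a f \<zeta>"
    by (rule mult_left_mono) simp
  then show ?thesis
    by (simp add: Phi_trunc_def norm_mult norm_divide flip: ennreal_mult)
qed (simp add: Phi_trunc_def not_integrable_integral_eq)

text \<open>With \<open>oscint\<close> finite, the limit is an absolutely convergent integral and
  needs no cancellation; dominated convergence yields its existence, and \<open>Lim\<close> then
  denotes it.\<close>

lemma Phi_trunc_tendsto:
  assumes fin: "oscint e t a f \<zeta> < \<infinity>"
  shows "((\<lambda>\<epsilon>. Phi_trunc e t a f \<epsilon> \<zeta>) \<longlongrightarrow> Phi_dir e t a f \<zeta>) (at_right 0)"
proof -
  have I: "integrable lborel (\<lambda>\<tau>. complex_of_real (kern a \<tau>) * (osc e t \<zeta> \<tau> * f (\<zeta> + \<tau> *\<^sub>R e)))"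
    unfolding integrable_iff_bounded using fin by (auto simp: oscint_def norm_mult ac_simps)
  have "((\<lambda>\<epsilon>. Phi_trunc e t a f \<epsilon> \<zeta>) \<longlongrightarrow> complex_of_real (1 / d_const a) *
     (\<integral>\<tau>. complex_of_real (kern a \<tau>) * (osc e t \<zeta> \<tau> * f (\<zeta> + \<tau> *\<^sub>R e)) \<partial>lborel)) (at_right 0)"
    unfolding Phi_trunc_def
  proof (intro tendsto_mult tendsto_const, unfold tendsto_at_iff_sequentially, intro allI impI)
    fix X :: "nat \<Rightarrow> real"
    assume "\<forall>i. X i \<in> {0<..} - {0}" "X \<longlonglongrightarrow> 0"
    then have X: "filterlim X (at_right 0) sequentially"
      unfolding filterlim_at by (intro conjI always_eventually) blast+
    show "((\<lambda>\<epsilon>. \<integral>\<tau>. complex_of_real (trunc_kern a \<epsilon> \<tau>) * (osc e t \<zeta> \<tau> * f (\<zeta> + \<tau> *\<^sub>R e)) \<partial>lborel) \<circ> X)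
      \<longlonglongrightarrow> (\<integral>\<tau>. complex_of_real (kern a \<tau>) * (osc e t \<zeta> \<tau> * f (\<zeta> + \<tau> *\<^sub>R e)) \<partial>lborel)"
      unfolding comp_def
    proof (rule integral_dominated_convergence[OF _ _ integrable_norm[OF I]])
      show "AE \<tau> in lborel. (\<lambda>n. complex_of_real (trunc_kern a (X n) \<tau>) * (osc e t \<zeta> \<tau> * f (\<zeta> + \<tau> *\<^sub>R e)))
          \<longlonglongrightarrow> complex_of_real (kern a \<tau>) * (osc e t \<zeta> \<tau> * f (\<zeta> + \<tau> *\<^sub>R e))"
        using AE_lborel_singleton[of 0]
        by eventually_elim (intro tendsto_intros filterlim_compose[OF trunc_kern_tendsto X])
      show "AE \<tau> in lborel. norm (complex_of_real (trunc_kern a (X n) \<tau>) * (osc e t \<zeta> \<tau> * f (\<zeta> + \<tau> *\<^sub>R e)))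
          \<le> norm (complex_of_real (kern a \<tau>) * (osc e t \<zeta> \<tau> * f (\<zeta> + \<tau> *\<^sub>R e)))" for n
        by (auto simp: norm_mult trunc_kern_le intro!: mult_right_mono)
    qed measurable
  qed
  then have "((\<lambda>\<epsilon>. Phi_trunc e t a f \<epsilon> \<zeta>) \<longlongrightarrow> Lim (at_right 0) (\<lambda>\<epsilon>. Phi_trunc e t a f \<epsilon> \<zeta>)) (at_right 0)"
    by (rule tendsto_Lim[OF trivial_limit_at_right_real, THEN ssubst])
       (rule \<open>((\<lambda>\<epsilon>. Phi_trunc e t a f \<epsilon> \<zeta>) \<longlongrightarrow> _) (at_right 0)\<close>)
  then show ?thesis unfolding Phi_dir_def .
qed

lemma Phi_dir_bound:
  assumes fin: "oscint e t a f \<zeta> < \<infinity>"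
  shows "ennreal (cmod (Phi_dir e t a f \<zeta>)) \<le> ennreal (1 / \<bar>d_const a\<bar>) * oscint e t a f \<zeta>"
  by (rule tendsto_upperbound[OF tendsto_ennrealI[OF tendsto_norm[OF Phi_trunc_tendsto[OF fin]]]])
     (auto intro!: always_eventually Phi_trunc_bound)

text \<open>Equivalent to absolute integrability at every positive cutoff, since lowering the cutoff
  enlarges the integrand. Quantifying over countably many cutoffs makes the set measurable.\<close>

definition trunc_fin :: "real \<times> real \<Rightarrow> bool" where
  "trunc_fin \<zeta> \<longleftrightarrow> (\<forall>n::nat. (\<integral>\<^sup>+\<tau>. ennreal (cmod (complex_of_real (trunc_kern a (1 / real (Suc n)) \<tau>) * (osc e t \<zeta> \<tau> * f (\<zeta> + \<tau> *\<^sub>R e)))) \<partial>lborel) < \<infinity>)"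

lemma trunc_fin_measurable [measurable]: "Measurable.pred borel trunc_fin"
  unfolding trunc_fin_def[abs_def] by measurable

lemma trunc_kern_mono: "\<delta> \<le> \<epsilon> \<Longrightarrow> trunc_kern a \<epsilon> \<tau> \<le> trunc_kern a \<delta> \<tau>"
  by (auto simp: trunc_kern_def indicator_def)

lemma trunc_fin_integrable:
  assumes "trunc_fin \<zeta>" and \<epsilon>: "\<epsilon> > 0"
  shows "integrable lborel (\<lambda>\<tau>. complex_of_real (trunc_kern a \<epsilon> \<tau>) * (osc e t \<zeta> \<tau> * f (\<zeta> + \<tau> *\<^sub>R e)))"
proof -
  obtain n where n: "1 / real (Suc n) < \<epsilon>" using \<epsilon> reals_Archimedean by (auto simp: inverse_eq_divide)
  have "integrable lborel (\<lambda>\<tau>. complex_of_real (trunc_kern a (1 / real (Suc n)) \<tau>) * (osc e t \<zeta> \<tau> * f (\<zeta> + \<tau> *\<^sub>R e)))"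
    unfolding integrable_iff_bounded using assms(1) by (simp add: trunc_fin_def)
  then show ?thesis
    by (rule Bochner_Integration.integrable_bound)
       (use n trunc_kern_mono[of "1 / real (Suc n)" \<epsilon>] in \<open>auto simp: norm_mult intro!: mult_right_mono\<close>)
qed

text \<open>A cutoff tending to \<epsilon> eventually agrees at each \<tau> with the cutoff at
  \<epsilon>, unless \<open>\<bar>\<tau>\<bar> = \<epsilon>\<close>, which is a null set. The
  truncation at \<delta> dominates those above \<delta>, so continuity is proved on each
  \<open>{\<delta><..}\<close> and glued.\<close>

lemma Phi_trunc_continuous:
  assumes fin: "trunc_fin \<zeta>"
  shows "continuous_on {0<..} (\<lambda>\<epsilon>. Phi_trunc e t a f \<epsilon> \<zeta>)"
proof -
  have "continuous_on {\<delta><..} (\<lambda>\<epsilon>. Phi_trunc e t a f \<epsilon> \<zeta>)" if \<delta>: "\<delta> > 0" for \<delta>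
    unfolding continuous_on_sequentially comp_def
  proof (intro allI ballI impI)
    fix X :: "nat \<Rightarrow> real" and \<epsilon>
    assume \<epsilon>: "\<epsilon> \<in> {\<delta><..}" and X: "(\<forall>n. X n \<in> {\<delta><..}) \<and> X \<longlonglongrightarrow> \<epsilon>"
    have "(\<lambda>n. \<integral>\<tau>. complex_of_real (trunc_kern a (X n) \<tau>) * (osc e t \<zeta> \<tau> * f (\<zeta> + \<tau> *\<^sub>R e)) \<partial>lborel)
      \<longlonglongrightarrow> (\<integral>\<tau>. complex_of_real (trunc_kern a \<epsilon> \<tau>) * (osc e t \<zeta> \<tau> * f (\<zeta> + \<tau> *\<^sub>R e)) \<partial>lborel)"
    proof (rule integral_dominated_convergence[OF _ _ integrable_norm[OF trunc_fin_integrable[OF fin \<delta>]]])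
      show "AE \<tau> in lborel. (\<lambda>n. complex_of_real (trunc_kern a (X n) \<tau>) * (osc e t \<zeta> \<tau> * f (\<zeta> + \<tau> *\<^sub>R e)))
          \<longlonglongrightarrow> complex_of_real (trunc_kern a \<epsilon> \<tau>) * (osc e t \<zeta> \<tau> * f (\<zeta> + \<tau> *\<^sub>R e))"
        using AE_lborel_singleton[of \<epsilon>] AE_lborel_singleton[of "- \<epsilon>"]
      proof eventually_elim
        case (elim \<tau>)
        then have ne: "\<bar>\<tau>\<bar> \<noteq> \<epsilon>" by linarith
        have "\<forall>\<^sub>F n in sequentially. trunc_kern a (X n) \<tau> = trunc_kern a \<epsilon> \<tau>"
        proof (cases "\<bar>\<tau>\<bar> < \<epsilon>")
          case True
          have "\<forall>\<^sub>F n in sequentially. \<bar>\<tau>\<bar> < X n" by (rule order_tendstoD(1)[OF _ True]) (use X in simp)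
          then show ?thesis by eventually_elim (use True in \<open>simp add: trunc_kern_def\<close>)
        next
          case False
          then have lt: "\<epsilon> < \<bar>\<tau>\<bar>" using ne by simp
          have "\<forall>\<^sub>F n in sequentially. X n < \<bar>\<tau>\<bar>" by (rule order_tendstoD(2)[OF _ lt]) (use X in simp)
          then show ?thesis by eventually_elim (use lt in \<open>simp add: trunc_kern_def\<close>)
        qed
        then have "(\<lambda>n. trunc_kern a (X n) \<tau>) \<longlonglongrightarrow> trunc_kern a \<epsilon> \<tau>" by (rule tendsto_eventually)
        then show ?case by (intro tendsto_intros)
      qed
      show "AE \<tau> in lborel. norm (complex_of_real (trunc_kern a (X n) \<tau>) * (osc e t \<zeta> \<tau> * f (\<zeta> + \<tau> *\<^sub>R e)))
          \<le> norm (complex_of_real (trunc_kern a \<delta> \<tau>) * (osc e t \<zeta> \<tau> * f (\<zeta> + \<tau> *\<^sub>R e)))" for n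
      proof (rule AE_I2)
        fix \<tau>
        have "\<delta> \<le> X n" using X by (auto intro: less_imp_le)
        then show "norm (complex_of_real (trunc_kern a (X n) \<tau>) * (osc e t \<zeta> \<tau> * f (\<zeta> + \<tau> *\<^sub>R e)))
          \<le> norm (complex_of_real (trunc_kern a \<delta> \<tau>) * (osc e t \<zeta> \<tau> * f (\<zeta> + \<tau> *\<^sub>R e)))"
          using trunc_kern_mono[of \<delta> "X n" \<tau>] by (auto simp: norm_mult intro!: mult_right_mono)
      qed
    qed measurable
    then show "(\<lambda>n. Phi_trunc e t a f (X n) \<zeta>) \<longlonglongrightarrow> Phi_trunc e t a f \<epsilon> \<zeta>"
      unfolding Phi_trunc_def by (intro tendsto_intros)
  qed
  then have "continuous_on (\<Union>\<delta>\<in>{0<..}. {\<delta><..}) (\<lambda>\<epsilon>. Phi_trunc e t a f \<epsilon> \<zeta>)"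
    by (intro continuous_on_open_UN) auto
  moreover have "(\<Union>\<delta>\<in>{0<..}. {\<delta><..}) = {0 :: real<..}"
  proof (intro subset_antisym subsetI)
    fix x :: real assume "x \<in> {0<..}"
    then show "x \<in> (\<Union>\<delta>\<in>{0<..}. {\<delta><..})" by (intro UN_I[of "x / 2"]) auto
  qed auto
  ultimately show ?thesis by simp
qed

text \<open>\<^const>\<open>L2\<close> demands Borel measurability, so the value of \<^const>\<open>Lim\<close> matters also on the null set
  where the principal value diverges.\<close>

lemma Phi_dir_measurable: "Phi_dir e t a f \<in> borel_measurable borel"
proof -
  \<comment> \<open>If one truncation fails to be integrable, so do all with a smaller cutoff. Their
    integrals are 0 by default, and 0 is then a genuine limit.\<close>
  have notfin: "Phi_dir e t a f \<zeta> = 0" if nf: "\<not> trunc_fin \<zeta>" for \<zeta>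
  proof -
    let ?i = "\<lambda>\<epsilon> \<tau>. complex_of_real (trunc_kern a \<epsilon> \<tau>) * (osc e t \<zeta> \<tau> * f (\<zeta> + \<tau> *\<^sub>R e))"
    obtain n where n: "\<not> (\<integral>\<^sup>+\<tau>. ennreal (cmod (?i (1 / real (Suc n)) \<tau>)) \<partial>lborel) < \<infinity>"
      using nf by (auto simp: trunc_fin_def)
    have "\<forall>\<^sub>F \<epsilon> in at_right 0. \<epsilon> \<in> {0<..<1 / real (Suc n)}"
      by (rule eventually_at_right_real) simp
    then have "\<forall>\<^sub>F \<epsilon> in at_right 0. Phi_trunc e t a f \<epsilon> \<zeta> = 0"
    proof eventually_elim
      case (elim \<epsilon>)
      have "\<not> integrable lborel (?i \<epsilon>)"
      proof
        assume "integrable lborel (?i \<epsilon>)"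
        then have "integrable lborel (?i (1 / real (Suc n)))"
          by (rule Bochner_Integration.integrable_bound)
             (use elim trunc_kern_mono[of \<epsilon> "1 / real (Suc n)"] in \<open>auto simp: norm_mult intro!: mult_right_mono\<close>)
        then show False using n unfolding integrable_iff_bounded by blast
      qed
      then show ?case by (simp add: Phi_trunc_def not_integrable_integral_eq)
    qed
    then have "((\<lambda>\<epsilon>. Phi_trunc e t a f \<epsilon> \<zeta>) \<longlongrightarrow> 0) (at_right 0)" by (rule tendsto_eventually)
    then show ?thesis unfolding Phi_dir_def by (rule tendsto_Lim[OF trivial_limit_at_right_real])
  qed
  define C where "C \<zeta> \<longleftrightarrow> (\<forall>n::nat. \<exists>m::nat. \<forall>p\<in>\<rat>. \<forall>q\<in>\<rat>.
      0 < p \<and> p < 1 / real (Suc m) \<and> 0 < q \<and> q < 1 / real (Suc m) \<longrightarrow>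
      cmod (Phi_trunc e t a f p \<zeta> - Phi_trunc e t a f q \<zeta>) \<le> 1 / real (Suc n))" for \<zeta>
  \<comment> \<open>The quantifiers range over naturals and rationals only, so the predicate is
    built from countably many measurable ones.\<close>
  have [measurable]: "Measurable.pred borel C"
    unfolding C_def using countable_rat by measurable
  have "Phi_dir e t a f \<zeta> = (if trunc_fin \<zeta> then
      (if C \<zeta> then lim (\<lambda>n. Phi_trunc e t a f (1 / real (Suc n)) \<zeta>) else (THE l. False)) else 0)" for \<zeta>
  proof (cases "trunc_fin \<zeta>")
    case True
    show ?thesis
      unfolding if_P[OF True] Phi_dir_def C_def by (rule Lim_at_right_Cauchy[OF Phi_trunc_continuous[OF True]])
  qed (simp add: notfin)
  then have eq: "Phi_dir e t a f = (\<lambda>\<zeta>. if trunc_fin \<zeta> then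
      (if C \<zeta> then lim (\<lambda>n. Phi_trunc e t a f (1 / real (Suc n)) \<zeta>) else (THE l. False)) else 0)"
    by (rule ext)
  show ?thesis unfolding eq by measurable
qed

end

section \<open>The commutator identity\<close>

abbreviation chirp :: "real \<Rightarrow> real \<times> real \<Rightarrow> complex" where
  "chirp t \<zeta> \<equiv> cis (t * phase \<zeta>)"

lemma chirp_mult [simp]:
  assumes "L2 f" shows "L2 (\<lambda>\<zeta>. chirp t \<zeta> * f \<zeta>)" "norm2 (\<lambda>\<zeta>. chirp t \<zeta> * f \<zeta>) = norm2 f"
proof -
  show "L2 (\<lambda>\<zeta>. chirp t \<zeta> * f \<zeta>)" by (rule L2_mult[OF assms, of _ 1]) auto
  show "norm2 (\<lambda>\<zeta>. chirp t \<zeta> * f \<zeta>) = norm2 f" by (simp add: norm2_def norm_mult)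
qed

lemma W_alt: "W t u = ifourier (\<lambda>\<zeta>. chirp t \<zeta> * fourier u \<zeta>)"
  by (simp add: W_def mult_op_def)

lemma L2_W [simp]: "L2 u \<Longrightarrow> L2 (W t u)"
  by (simp add: W_alt)

lemma fourier_W:
  assumes "L2 u" shows "AE \<zeta> in lborel. fourier (W t u) \<zeta> = chirp t \<zeta> * fourier u \<zeta>"
  unfolding W_alt using assms by (intro fourier_ifourier) simp

lemma ifourier_mult_cong:
  assumes [measurable]: "m \<in> borel_measurable borel" and "L2 f" "L2 g" "AE \<zeta> in lborel. f \<zeta> = g \<zeta>"
  shows "ifourier (\<lambda>\<zeta>. m \<zeta> * f \<zeta>) = ifourier (\<lambda>\<zeta>. m \<zeta> * g \<zeta>)"
proof -
  note [measurable] = L2_measurable[OF assms(2)] L2_measurable[OF assms(3)]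
  show ?thesis by (rule fourier_cong_AE(2)) (use assms(4) in \<open>auto elim!: eventually_mono\<close>)
qed

text \<open>Inversion holds only almost everywhere, but the outer \<open>ifourier\<close> ignores
  null sets, so the equation is one between functions.\<close>

lemma mult_op_ifourier:
  assumes "m \<in> borel_measurable borel" "L2 f"
  shows "mult_op m (ifourier f) = ifourier (\<lambda>\<zeta>. m \<zeta> * f \<zeta>)"
  unfolding mult_op_def using assms by (intro ifourier_mult_cong fourier_ifourier) auto

lemma W_ifourier: "L2 f \<Longrightarrow> W t (ifourier f) = ifourier (\<lambda>\<zeta>. chirp t \<zeta> * f \<zeta>)"
  unfolding W_def by (rule mult_op_ifourier) auto

lemma W_diff:
  assumes "L2 u" "L2 v"
  shows "AE z in lborel. W t (\<lambda>z. u z - v z) z = W t u z - W t v z"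
proof -
  have "W t (\<lambda>z. u z - v z) = ifourier (\<lambda>\<zeta>. chirp t \<zeta> * (fourier u \<zeta> - fourier v \<zeta>))"
    unfolding W_alt using assms by (intro ifourier_mult_cong fourier_diff) auto
  then show ?thesis
    unfolding W_alt using fourier_diff(2)[OF chirp_mult(1)[OF L2_fourier[OF assms(1)]] chirp_mult(1)[OF L2_fourier[OF assms(2)]], of t t]
    by (simp add: right_diff_distrib)
qed

lemma W_cmult:
  assumes "L2 u"
  shows "AE z in lborel. W t (\<lambda>z. c * u z) z = c * W t u z"
proof -
  have "W t (\<lambda>z. c * u z) = ifourier (\<lambda>\<zeta>. chirp t \<zeta> * (c * fourier u \<zeta>))"
    unfolding W_alt using assms by (intro ifourier_mult_cong fourier_cmult) auto
  then show ?thesis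
    unfolding W_alt using fourier_cmult(2)[OF chirp_mult(1)[OF L2_fourier[OF assms(1)]], of c t]
    by (simp add: mult.left_commute)
qed

lemma norm2_W_diff:
  assumes "L2 u" "L2 v"
  shows "norm2 (\<lambda>z. W t u z - W t v z) = norm2 (\<lambda>z. u z - v z)"
proof -
  have "norm2 (\<lambda>z. W t u z - W t v z) = norm2 (\<lambda>\<zeta>. chirp t \<zeta> * (fourier u \<zeta> - fourier v \<zeta>)) / (2 * pi)"
    unfolding W_alt using assms by (simp add: norm2_fourier_diff right_diff_distrib)
  also have "\<dots> = norm2 (\<lambda>z. u z - v z)"
    using assms by (subst chirp_mult(2)) (simp_all add: norm2_fourier_diff)
  finally show ?thesis .
qed

context
  fixes e :: "real \<times> real" and t a :: real and f :: "real \<times> real \<Rightarrow> complex"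
  assumes e: "e = (1, 0) \<or> e = (0, 1)" and a: "0 < a" "a < 1" and f2: "L2 f"
    and wf: "L2 (\<lambda>\<zeta>. complex_of_real (weight \<zeta> powr a) * f \<zeta>)"
begin

lemma f_measurable [measurable]: "f \<in> borel_measurable borel"
  by (rule L2_measurable[OF f2])

lemma oscint_AE_finite: "AE \<zeta> in lborel. oscint e t a f \<zeta> < \<infinity>"
proof -
  \<comment> \<open>The case \<open>b = 0\<close> of \<open>oscint_bound\<close>, with the trivial
    weight kept in the form of that statement.\<close>
  have "(\<integral>\<^sup>+\<zeta>. (ennreal (weight \<zeta> powr (0 / 2)) * oscint e t a f \<zeta>)\<^sup>2 \<partial>lborel) \<noteq> \<infinity>"
    using oscint_bound[OF e a, of 0 f t] wf a by (auto simp: top_unique)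
  then have "AE \<zeta> in lborel. (ennreal (weight \<zeta> powr (0 / 2)) * oscint e t a f \<zeta>)\<^sup>2 \<noteq> \<infinity>"
    by (intro nn_integral_PInf_AE) measurable
  then show ?thesis
    by eventually_elim (auto simp: power2_eq_square ennreal_mult_eq_top_iff less_top)
qed

text \<open>Formulated for any function dominated by \<open>oscint\<close>, since it is applied to
  the principal value, to its truncations and to their common majorant.\<close>

lemma weighted_bound:
  assumes b: "0 \<le> b" "b < a" and c: "0 \<le> c" and wf': "L2 (\<lambda>\<zeta>. complex_of_real (weight \<zeta> powr (a + b / 2)) * f \<zeta>)"
    and [measurable]: "\<Psi> \<in> borel_measurable borel"
    and \<Psi>: "AE \<zeta> in lborel. ennreal (cmod (\<Psi> \<zeta>)) \<le> ennreal c * oscint e t a f \<zeta>"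
  shows "L2 (\<lambda>\<zeta>. complex_of_real (weight \<zeta> powr (b / 2)) * \<Psi> \<zeta>)"
    "norm2 (\<lambda>\<zeta>. complex_of_real (weight \<zeta> powr (b / 2)) * \<Psi> \<zeta>)
      \<le> c * (2 * Schur_const a b * (1 + \<bar>t\<bar>) * norm2 (\<lambda>\<zeta>. complex_of_real (weight \<zeta> powr (a + b / 2)) * f \<zeta>))"
proof -
  let ?n = "2 * Schur_const a b * (1 + \<bar>t\<bar>) * norm2 (\<lambda>\<zeta>. complex_of_real (weight \<zeta> powr (a + b / 2)) * f \<zeta>)"
  have "nn2 (\<lambda>\<zeta>. complex_of_real (weight \<zeta> powr (b / 2)) * \<Psi> \<zeta>)
    \<le> (\<integral>\<^sup>+\<zeta>. ennreal (c\<^sup>2) * (ennreal (weight \<zeta> powr (b / 2)) * oscint e t a f \<zeta>)\<^sup>2 \<partial>lborel)"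
  proof (rule nn_integral_mono_AE)
    show "AE \<zeta> in lborel. ennreal ((cmod (complex_of_real (weight \<zeta> powr (b / 2)) * \<Psi> \<zeta>))\<^sup>2)
      \<le> ennreal (c\<^sup>2) * (ennreal (weight \<zeta> powr (b / 2)) * oscint e t a f \<zeta>)\<^sup>2"
      using \<Psi>
    proof eventually_elim
      case (elim \<zeta>)
      from mult_left_mono[OF elim, of "ennreal (weight \<zeta> powr (b / 2))"]
      have "ennreal (cmod (complex_of_real (weight \<zeta> powr (b / 2)) * \<Psi> \<zeta>))
          \<le> ennreal c * (ennreal (weight \<zeta> powr (b / 2)) * oscint e t a f \<zeta>)"
        by (simp add: norm_mult ennreal_mult ac_simps)
      from power_mono[OF this, of 2] show ?case
        using c by (simp add: power_mult_distrib ennreal_power)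
    qed
  qed
  also have "\<dots> = ennreal (c\<^sup>2) * (\<integral>\<^sup>+\<zeta>. (ennreal (weight \<zeta> powr (b / 2)) * oscint e t a f \<zeta>)\<^sup>2 \<partial>lborel)"
    by (rule nn_integral_cmult) measurable
  also have "\<dots> \<le> ennreal (c\<^sup>2) * ennreal (?n\<^sup>2)"
    by (intro mult_left_mono oscint_bound e a b wf') auto
  also have "\<dots> = ennreal ((c * ?n)\<^sup>2)"
    by (simp add: power_mult_distrib flip: ennreal_mult)
  finally have *: "nn2 (\<lambda>\<zeta>. complex_of_real (weight \<zeta> powr (b / 2)) * \<Psi> \<zeta>) \<le> ennreal ((c * ?n)\<^sup>2)" .
  show "L2 (\<lambda>\<zeta>. complex_of_real (weight \<zeta> powr (b / 2)) * \<Psi> \<zeta>)"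
    by (rule L2_nn2_bound(1)[OF _ *]) (use c in auto)
  show "norm2 (\<lambda>\<zeta>. complex_of_real (weight \<zeta> powr (b / 2)) * \<Psi> \<zeta>) \<le> c * ?n"
    by (rule L2_nn2_bound(2)[OF _ *]) (use c in auto)
qed

lemma Phi_dir_AE_bound:
  "AE \<zeta> in lborel. ennreal (cmod (Phi_dir e t a f \<zeta>)) \<le> ennreal (1 / \<bar>d_const a\<bar>) * oscint e t a f \<zeta>"
  using oscint_AE_finite by eventually_elim (rule Phi_dir_bound[OF f_measurable])

lemma Phi_dir_weighted:
  assumes b: "0 \<le> b" "b < a" and wf': "L2 (\<lambda>\<zeta>. complex_of_real (weight \<zeta> powr (a + b / 2)) * f \<zeta>)"
  shows "L2 (\<lambda>\<zeta>. complex_of_real (weight \<zeta> powr (b / 2)) * Phi_dir e t a f \<zeta>)"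
    "norm2 (\<lambda>\<zeta>. complex_of_real (weight \<zeta> powr (b / 2)) * Phi_dir e t a f \<zeta>)
      \<le> 1 / \<bar>d_const a\<bar> * (2 * Schur_const a b * (1 + \<bar>t\<bar>) * norm2 (\<lambda>\<zeta>. complex_of_real (weight \<zeta> powr (a + b / 2)) * f \<zeta>))"
  by (rule weighted_bound[OF b _ wf' Phi_dir_measurable[OF f_measurable] Phi_dir_AE_bound]; simp)+

lemma Phi_dir_L2: "L2 (Phi_dir e t a f)"
  using Phi_dir_weighted(1)[of 0] wf a by simp

lemma Phi_trunc_L2: "L2 (Phi_trunc e t a f \<epsilon>)"
  using weighted_bound(1)[of 0 "1 / \<bar>d_const a\<bar>" "Phi_trunc e t a f \<epsilon>"] wf a Phi_trunc_bound[OF f_measurable]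
  by simp

lemma Phi_trunc_L2_tendsto:
  assumes X: "filterlim X (at_right 0) sequentially"
  shows "(\<lambda>n. norm2 (\<lambda>\<zeta>. Phi_trunc e t a f (X n) \<zeta> - Phi_dir e t a f \<zeta>)) \<longlonglongrightarrow> 0"
proof -
  \<comment> \<open>The pointwise bound itself, made into a complex function, serves as majorant;
    \<open>enn2real\<close> alters it only on the null set where \<open>oscint\<close> is
    infinite.\<close>
  define h where "h \<zeta> = complex_of_real (1 / \<bar>d_const a\<bar> * enn2real (oscint e t a f \<zeta>))" for \<zeta>
  have [measurable]: "h \<in> borel_measurable borel" unfolding h_def by measurable
  have hb: "AE \<zeta> in lborel. ennreal (cmod (h \<zeta>)) = ennreal (1 / \<bar>d_const a\<bar>) * oscint e t a f \<zeta>"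
    using oscint_AE_finite
  proof eventually_elim
    case (elim \<zeta>)
    have "cmod (h \<zeta>) = 1 / \<bar>d_const a\<bar> * enn2real (oscint e t a f \<zeta>)"
      unfolding h_def norm_of_real by simp
    then show ?case using elim by (simp add: ennreal_mult del: times_divide_eq_left)
  qed
  have "AE \<zeta> in lborel. ennreal (cmod (h \<zeta>)) \<le> ennreal (1 / \<bar>d_const a\<bar>) * oscint e t a f \<zeta>"
    using hb by eventually_elim (rule eq_refl)
  then have h2: "L2 h"
    using weighted_bound(1)[of 0 "1 / \<bar>d_const a\<bar>" h] wf a by simp
  show ?thesis
  proof (rule L2_dominated(3)[OF h2 Phi_trunc_measurable[OF f_measurable] Phi_dir_measurable[OF f_measurable]])
    show "AE \<zeta> in lborel. (\<lambda>n. Phi_trunc e t a f (X n) \<zeta>) \<longlonglongrightarrow> Phi_dir e t a f \<zeta>"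
      using oscint_AE_finite
      by eventually_elim (rule filterlim_compose[OF Phi_trunc_tendsto[OF f_measurable] X])
    show "AE \<zeta> in lborel. cmod (Phi_trunc e t a f (X n) \<zeta>) \<le> cmod (h \<zeta>)" for n
      using hb
    proof eventually_elim
      case (elim \<zeta>)
      show ?case using Phi_trunc_bound[OF f_measurable, of e t a "X n" \<zeta>] unfolding elim[symmetric]
        by (simp add: ennreal_le_iff)
    qed
  qed
qed

end

text \<open>\<open>chirp t \<zeta> * osc e t \<zeta> \<tau>\<close> is the difference of the chirps
  at the two ends of the shift, so the truncated integral is a commutator of convolution and chirp.
  Splitting it requires both convolution integrands to be integrable, which holds almost
  everywhere.\<close>

lemma Phi_trunc_line_conv:
  assumes a: "0 < a" "a < 1" and \<epsilon>: "\<epsilon> > 0" and f: "L2 f"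
  defines "k \<equiv> \<lambda>\<tau>. complex_of_real (trunc_kern a \<epsilon> \<tau>)"
  shows "AE \<zeta> in lborel. chirp t \<zeta> * Phi_trunc e t a f \<epsilon> \<zeta>
    = complex_of_real (1 / d_const a) * (line_conv e k (\<lambda>\<zeta>. chirp t \<zeta> * f \<zeta>) \<zeta> - chirp t \<zeta> * line_conv e k f \<zeta>)"
proof -
  have k: "integrable lborel k" unfolding k_def using trunc_kern_integrable[OF a \<epsilon>] by simp
  show ?thesis
    using line_conv_AE_integrable[OF k f, of e] line_conv_AE_integrable[OF k chirp_mult(1)[OF f], of t e]
  proof eventually_elim
    case (elim \<zeta>)
    have "chirp t \<zeta> * (\<integral>\<tau>. k \<tau> * (osc e t \<zeta> \<tau> * f (\<zeta> + \<tau> *\<^sub>R e)) \<partial>lborel)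
        = (\<integral>\<tau>. chirp t \<zeta> * (k \<tau> * (osc e t \<zeta> \<tau> * f (\<zeta> + \<tau> *\<^sub>R e))) \<partial>lborel)"
      by simp
    also have "\<dots> = (\<integral>\<tau>. k \<tau> * (chirp t (\<zeta> + \<tau> *\<^sub>R e) * f (\<zeta> + \<tau> *\<^sub>R e)) - chirp t \<zeta> * (k \<tau> * f (\<zeta> + \<tau> *\<^sub>R e)) \<partial>lborel)"
    proof (rule Bochner_Integration.integral_cong[OF refl])
      fix \<tau>
      have "chirp t (\<zeta> + \<tau> *\<^sub>R e) = chirp t \<zeta> * (osc e t \<zeta> \<tau> + 1)"
        by (simp add: osc_def cis_mult algebra_simps)
      then show "chirp t \<zeta> * (k \<tau> * (osc e t \<zeta> \<tau> * f (\<zeta> + \<tau> *\<^sub>R e)))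
        = k \<tau> * (chirp t (\<zeta> + \<tau> *\<^sub>R e) * f (\<zeta> + \<tau> *\<^sub>R e)) - chirp t \<zeta> * (k \<tau> * f (\<zeta> + \<tau> *\<^sub>R e))"
        by (simp add: algebra_simps)
    qed
    also have "\<dots> = line_conv e k (\<lambda>\<zeta>. chirp t \<zeta> * f \<zeta>) \<zeta> - chirp t \<zeta> * line_conv e k f \<zeta>"
      using elim by (simp add: line_conv_def)
    finally show ?case by (simp add: Phi_trunc_def k_def)
  qed
qed

text \<open>The multiplier is \<open>d * (\<kappa> z - c)\<close>. The constant c passes through
  \<open>W t\<close>, so only \<kappa>, the symbol of the convolution, contributes to the
  commutator.\<close>

lemma stein_mult_commutator:
  assumes e: "e = (1, 0) \<or> e = (0, 1)" and a: "0 < a" "a < 1" and \<epsilon>: "\<epsilon> > 0" and u: "L2 u"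
    and wf: "L2 (\<lambda>\<zeta>. complex_of_real (weight \<zeta> powr a) * fourier u \<zeta>)"
  defines "m \<equiv> \<lambda>z. stein_mult a \<epsilon> (z \<bullet> e) / complex_of_real (d_const a)"
  shows "AE z in lborel. m z * W t u z
    = W t (\<lambda>z. m z * u z) z + ifourier (\<lambda>\<zeta>. chirp t \<zeta> * Phi_trunc e t a (fourier u) \<epsilon> \<zeta>) z"
    and "L2 v \<Longrightarrow> L2 (\<lambda>z. m z * v z)"
proof -
  define k where "k \<tau> = complex_of_real (trunc_kern a \<epsilon> \<tau>)" for \<tau>
  have k: "integrable lborel k" unfolding k_def using trunc_kern_integrable[OF a \<epsilon>] by simp
  define \<kappa> where "\<kappa> z = (\<integral>\<tau>. k \<tau> * cis (- \<tau> * (z \<bullet> e)) \<partial>lborel)" for z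
  define c where "c = (\<integral>\<tau>. k \<tau> \<partial>lborel)"
  define d where "d = complex_of_real (1 / d_const a)"
  define f where "f = fourier u"
  have f: "L2 f" unfolding f_def using u by simp
  have \<kappa>2: "L2 (\<lambda>z. \<kappa> z * v z)" if "L2 v" for v
    unfolding \<kappa>_def by (rule kappa_mult_L2(1)[OF k that])
  have m: "m z = d * (\<kappa> z - c)" for z
  proof -
    have "integrable lborel (\<lambda>\<tau>. k \<tau> * cis (- \<tau> * (z \<bullet> e)))"
      by (rule Bochner_Integration.integrable_bound[OF k]) (use k in \<open>auto simp: norm_mult\<close>)
    then have "stein_mult a \<epsilon> (z \<bullet> e) = \<kappa> z - c"
      using k by (simp add: stein_mult_def \<kappa>_def c_def right_diff_distrib flip: k_def)
    then show ?thesis by (simp add: m_def d_def)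
  qed
  have mv: "(\<lambda>z. m z * v z) = (\<lambda>z. d * (\<kappa> z * v z - c * v z))" for v
    by (simp add: m algebra_simps)
  show "L2 v \<Longrightarrow> L2 (\<lambda>z. m z * v z)" unfolding mv using \<kappa>2 by simp
  have l2: "L2 (line_conv e k f)" "L2 (line_conv e k (\<lambda>\<zeta>. chirp t \<zeta> * f \<zeta>))"
    by (intro line_conv_L2 k f chirp_mult)+
  have i1: "AE z in lborel. ifourier (line_conv e k (\<lambda>\<zeta>. chirp t \<zeta> * f \<zeta>)) z = \<kappa> z * W t u z"
    using ifourier_line_conv[OF k chirp_mult(1)[OF f], of e t] by (simp add: \<kappa>_def W_alt f_def)
  have i2: "AE z in lborel. ifourier (line_conv e k f) z = \<kappa> z * u z"
    using ifourier_line_conv[OF k f, of e] ifourier_fourier[OF u] by eventually_elim (simp add: \<kappa>_def f_def)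
  \<comment> \<open>\<open>i2\<close> is known only almost everywhere; the transform ignores null
    sets, so it can be substituted under \<open>W t\<close>.\<close>
  have "W t (\<lambda>z. \<kappa> z * u z) = W t (ifourier (line_conv e k f))"
    unfolding W_def mult_op_def
    using fourier_cong_AE(1)[OF L2_measurable[OF L2_ifourier[OF l2(1)]] L2_measurable[OF \<kappa>2[OF u]] i2] by simp
  then have i3: "W t (\<lambda>z. \<kappa> z * u z) = ifourier (\<lambda>\<zeta>. chirp t \<zeta> * line_conv e k f \<zeta>)"
    using W_ifourier[OF l2(1)] by simp
  have P2: "L2 (\<lambda>\<zeta>. chirp t \<zeta> * Phi_trunc e t a f \<epsilon> \<zeta>)"
    by (intro chirp_mult Phi_trunc_L2 e a f) (use wf in \<open>simp add: f_def\<close>)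
  have i4: "ifourier (\<lambda>\<zeta>. chirp t \<zeta> * Phi_trunc e t a f \<epsilon> \<zeta>)
    = ifourier (\<lambda>\<zeta>. d * (line_conv e k (\<lambda>\<zeta>. chirp t \<zeta> * f \<zeta>) \<zeta> - chirp t \<zeta> * line_conv e k f \<zeta>))"
  proof (rule fourier_cong_AE(2)[OF L2_measurable[OF P2] L2_measurable])
    show "L2 (\<lambda>\<zeta>. d * (line_conv e k (\<lambda>\<zeta>. chirp t \<zeta> * f \<zeta>) \<zeta> - chirp t \<zeta> * line_conv e k f \<zeta>))"
      by (intro L2_cmult L2_diff l2 chirp_mult)
    have "k = (\<lambda>\<tau>. complex_of_real (trunc_kern a \<epsilon> \<tau>))" by (rule ext) (simp add: k_def)
    then show "AE \<zeta> in lborel. chirp t \<zeta> * Phi_trunc e t a f \<epsilon> \<zeta>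
      = d * (line_conv e k (\<lambda>\<zeta>. chirp t \<zeta> * f \<zeta>) \<zeta> - chirp t \<zeta> * line_conv e k f \<zeta>)"
      unfolding d_def using Phi_trunc_line_conv[OF a \<epsilon> f, of t e] by simp
  qed
  have i5: "AE z in lborel. ifourier (\<lambda>\<zeta>. chirp t \<zeta> * Phi_trunc e t a f \<epsilon> \<zeta>) z = d * (\<kappa> z * W t u z - W t (\<lambda>z. \<kappa> z * u z) z)"
    unfolding i4 i3
    using fourier_cmult(2)[OF L2_diff[OF l2(2) chirp_mult(1)[OF l2(1), of t]], of d]
      fourier_diff(2)[OF l2(2) chirp_mult(1)[OF l2(1), of t]] i1
    by eventually_elim simp
  have "AE z in lborel. W t (\<lambda>z. m z * u z) z = d * (W t (\<lambda>z. \<kappa> z * u z) z - c * W t u z)"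
    unfolding mv
    using W_cmult[OF L2_diff[OF \<kappa>2[OF u] L2_cmult[OF u]], of t d c]
      W_diff[OF \<kappa>2[OF u] L2_cmult[OF u], of t c] W_cmult[OF u, of t c]
    by eventually_elim simp
  with i5 show "AE z in lborel. m z * W t u z
    = W t (\<lambda>z. m z * u z) z + ifourier (\<lambda>\<zeta>. chirp t \<zeta> * Phi_trunc e t a (fourier u) \<epsilon> \<zeta>) z"
    unfolding f_def
  proof eventually_elim
    case (elim z)
    show ?case unfolding elim m[of z] by (simp add: algebra_simps)
  qed
qed

text \<open>The two sides converge in different senses. On the right,
  \<open>\<bar>x\<bar> powr a * u\<close> and a multiple of \<open>oscint\<close> are majorants, so
  the limit exists in the mean. On the left no majorant for \<open>m n * W t u\<close> is available
  and only pointwise convergence is used; \<open>norm2_lim_pointwise\<close> identifies the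
  limits.\<close>

lemma commutator_identity:
  assumes e: "e = (1, 0) \<or> e = (0, 1)" and a: "0 < a" "a < 1" and u: "L2 u"
    and xu: "L2 (\<lambda>z. complex_of_real (\<bar>z \<bullet> e\<bar> powr a) * u z)"
    and wf: "L2 (\<lambda>\<zeta>. complex_of_real (weight \<zeta> powr a) * fourier u \<zeta>)"
  shows "AE z in lborel. complex_of_real (\<bar>z \<bullet> e\<bar> powr a) * W t u z
    = W t (\<lambda>z. complex_of_real (\<bar>z \<bullet> e\<bar> powr a) * u z) z + W t (ifourier (Phi_dir e t a (fourier u))) z"
proof -
  define f where "f = fourier u"
  have f: "L2 f" and wf': "L2 (\<lambda>\<zeta>. complex_of_real (weight \<zeta> powr a) * f \<zeta>)"
    using u wf by (auto simp: f_def)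
  define X where "X n = 1 / real (Suc n)" for n
  have X: "filterlim X (at_right 0) sequentially"
    unfolding X_def using LIMSEQ_Suc[OF lim_1_over_n] by (simp add: filterlim_at)
  have Xpos: "X n > 0" for n by (simp add: X_def)
  define m where "m n z = stein_mult a (X n) (z \<bullet> e) / complex_of_real (d_const a)" for n and z :: "real \<times> real"
  have [measurable]: "m n \<in> borel_measurable borel" for n unfolding m_def by measurable
  note [measurable] = L2_measurable[OF u] L2_measurable[OF xu]
  have mlim: "(\<lambda>n. m n z) \<longlonglongrightarrow> complex_of_real (\<bar>z \<bullet> e\<bar> powr a)" for z
    unfolding m_def by (rule stein_mult_tendsto[OF a X])
  define C where "C = 2 * Jconst a / \<bar>d_const a\<bar>"
  have mb: "cmod (m n z) \<le> C * \<bar>z \<bullet> e\<bar> powr a" for n z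
    using stein_mult_bound[OF a, of "X n" "z \<bullet> e"] by (simp add: m_def C_def norm_divide divide_right_mono)
  have C0: "0 \<le> C" by (simp add: C_def)
  note comm = stein_mult_commutator[OF e a Xpos u wf, folded m_def f_def]
  have mu2: "L2 (\<lambda>z. m n z * u z)" for n by (rule comm(2)[OF u])
  have mulim: "(\<lambda>n. norm2 (\<lambda>z. m n z * u z - complex_of_real (\<bar>z \<bullet> e\<bar> powr a) * u z)) \<longlonglongrightarrow> 0"
  proof (rule L2_dominated(3)[OF L2_cmult[OF xu, of "complex_of_real C"]])
    show "AE z in lborel. (\<lambda>n. m n z * u z) \<longlonglongrightarrow> complex_of_real (\<bar>z \<bullet> e\<bar> powr a) * u z"
      by (intro AE_I2 tendsto_mult tendsto_const mlim)
    show "AE z in lborel. cmod (m n z * u z) \<le> cmod (complex_of_real C * (complex_of_real (\<bar>z \<bullet> e\<bar> powr a) * u z))" for n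
      using mb C0 by (auto simp: norm_mult mult.assoc[symmetric] intro!: mult_right_mono)
  qed auto
  define P where "P n \<zeta> = chirp t \<zeta> * Phi_trunc e t a f (X n) \<zeta>" for n \<zeta>
  define P0 where "P0 \<zeta> = chirp t \<zeta> * Phi_dir e t a f \<zeta>" for \<zeta>
  note ctx = e a f wf'
  have P2: "L2 (P n)" "L2 P0" for n
    unfolding P_def P0_def by (intro chirp_mult Phi_trunc_L2[OF ctx] Phi_dir_L2[OF ctx])+
  have Plim: "(\<lambda>n. norm2 (\<lambda>\<zeta>. P n \<zeta> - P0 \<zeta>)) \<longlonglongrightarrow> 0"
    using Phi_trunc_L2_tendsto[OF ctx X, of t] Phi_trunc_L2[OF ctx, of t] Phi_dir_L2[OF ctx, of t]
    by (simp add: P_def P0_def right_diff_distrib[symmetric])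
  define Y where "Y z = W t (\<lambda>z. complex_of_real (\<bar>z \<bullet> e\<bar> powr a) * u z) z + ifourier P0 z" for z
  define F where "F n z = W t (\<lambda>z. m n z * u z) z + ifourier (P n) z" for n z
  have F2: "L2 (F n)" and Y2: "L2 Y" for n
    unfolding F_def Y_def by (intro L2_add L2_W L2_ifourier mu2 P2 xu)+
  have "(\<lambda>n. norm2 (\<lambda>z. F n z - Y z)) \<longlonglongrightarrow> 0"
  proof (rule Lim_null_comparison[OF always_eventually[OF allI]])
    fix n
    have "norm2 (\<lambda>z. F n z - Y z) = norm2 (\<lambda>z. (W t (\<lambda>z. m n z * u z) z - W t (\<lambda>z. complex_of_real (\<bar>z \<bullet> e\<bar> powr a) * u z) z)
        + (ifourier (P n) z - ifourier P0 z))"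
      by (simp add: F_def Y_def algebra_simps)
    also have "\<dots> \<le> norm2 (\<lambda>z. W t (\<lambda>z. m n z * u z) z - W t (\<lambda>z. complex_of_real (\<bar>z \<bullet> e\<bar> powr a) * u z) z)
        + norm2 (\<lambda>z. ifourier (P n) z - ifourier P0 z)"
      by (intro norm2_triangle L2_diff L2_W L2_ifourier mu2 P2 xu)
    finally show "norm (norm2 (\<lambda>z. F n z - Y z)) \<le> norm2 (\<lambda>z. m n z * u z - complex_of_real (\<bar>z \<bullet> e\<bar> powr a) * u z)
        + norm2 (\<lambda>\<zeta>. P n \<zeta> - P0 \<zeta>) / (2 * pi)"
      by (simp add: norm2_W_diff[OF mu2 xu] norm2_fourier_diff(2)[OF P2])
  next
    show "(\<lambda>n. norm2 (\<lambda>z. m n z * u z - complex_of_real (\<bar>z \<bullet> e\<bar> powr a) * u z)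
        + norm2 (\<lambda>\<zeta>. P n \<zeta> - P0 \<zeta>) / (2 * pi)) \<longlonglongrightarrow> 0"
      using tendsto_add[OF mulim tendsto_divide[OF Plim tendsto_const[of "2 * pi"]]] by simp
  qed
  moreover have "AE z in lborel. (\<lambda>n. F n z) \<longlonglongrightarrow> complex_of_real (\<bar>z \<bullet> e\<bar> powr a) * W t u z"
  proof -
    \<comment> \<open>The exceptional set depends on the cutoff; a sequence of cutoffs leaves a
      countable union of null sets.\<close>
    have "AE z in lborel. \<forall>n. m n z * W t u z = F n z"
      unfolding AE_all_countable F_def P_def by (intro allI comm(1))
    then show ?thesis
    proof eventually_elim
      case (elim z)
      have "(\<lambda>n. m n z * W t u z) \<longlonglongrightarrow> complex_of_real (\<bar>z \<bullet> e\<bar> powr a) * W t u z"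
        by (intro tendsto_mult tendsto_const mlim)
      then show ?case using elim by simp
    qed
  qed
  ultimately have "AE z in lborel. complex_of_real (\<bar>z \<bullet> e\<bar> powr a) * W t u z = Y z"
    using L2_measurable[OF L2_W[OF u, of t]]
    by (intro norm2_lim_pointwise[OF F2 Y2]) auto
  moreover have "W t (ifourier (Phi_dir e t a f)) = ifourier P0"
    unfolding P0_def by (rule W_ifourier[OF Phi_dir_L2[OF ctx]])
  ultimately show ?thesis unfolding Y_def f_def by simp
qed

section \<open>Sobolev norms and the final estimates\<close>

text \<open>M is at least 1 and \<open>weight \<zeta>\<close> at most \<open>3 * M\<^sup>2\<close>.
  The constant depends only on the lower exponent p, as raising it to q costs nothing for a base of
  at least 1. The bound \<open>p \<le> 3\<close> covers \<open>2 * a + b\<close>, and 6 dominates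
  \<open>3 powr (3 / 2)\<close>; hence the constants do not depend on s.\<close>

lemma weight_powr_le:
  assumes p: "0 \<le> p" "p \<le> 3" and q: "p \<le> q"
  shows "weight \<zeta> powr (p / 2) \<le> 6 * (1 + \<bar>fst \<zeta>\<bar> powr q + \<bar>snd \<zeta>\<bar> powr q)"
proof -
  define M where "M = max 1 (max \<bar>fst \<zeta>\<bar> \<bar>snd \<zeta>\<bar>)"
  have M: "1 \<le> M" by (simp add: M_def)
  have sq: "x\<^sup>2 \<le> M\<^sup>2" if "\<bar>x\<bar> \<le> M" for x :: real
    using that M by (simp add: abs_le_square_iff[symmetric])
  have "weight \<zeta> = 1\<^sup>2 + (fst \<zeta>)\<^sup>2 + (snd \<zeta>)\<^sup>2" by (cases \<zeta>) (simp add: weight_def norm_Pair)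
  also have "\<dots> \<le> M\<^sup>2 + M\<^sup>2 + M\<^sup>2"
    by (intro add_mono sq) (auto simp: M_def)
  finally have "weight \<zeta> \<le> 3 * M\<^sup>2" by simp
  then have "weight \<zeta> powr (p / 2) \<le> (3 * M\<^sup>2) powr (p / 2)"
    using p by (intro powr_mono2) (auto simp: less_imp_le)
  also have "\<dots> = 3 powr (p / 2) * M powr p"
  proof -
    have "(M\<^sup>2) powr (p / 2) = M powr p" using M by (simp add: powr_powr flip: powr_numeral)
    then show ?thesis by (simp add: powr_mult)
  qed
  also have "\<dots> \<le> 6 * M powr q"
  proof (intro mult_mono powr_mono q M)
    have "3 powr (p / 2) \<le> 3 powr (3 / 2 :: real)" using p by (intro powr_mono) auto
    also have "\<dots> = 3 powr (1 + 1 / 2 :: real)" by simp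
    also have "\<dots> = 3 * sqrt 3" unfolding powr_add by (simp add: powr_half_sqrt)
    also have "\<dots> \<le> 6" by (simp add: real_le_lsqrt)
    finally show "3 powr (p / 2) \<le> 6" .
  qed auto
  also have "M powr q \<le> 1 + \<bar>fst \<zeta>\<bar> powr q + \<bar>snd \<zeta>\<bar> powr q"
  proof -
    have "M = 1 \<or> M = \<bar>fst \<zeta>\<bar> \<or> M = \<bar>snd \<zeta>\<bar>" unfolding M_def by linarith
    then consider "M = 1" | "M = \<bar>fst \<zeta>\<bar>" | "M = \<bar>snd \<zeta>\<bar>" by blast
    then show ?thesis by cases auto
  qed
  finally show ?thesis by simp
qed

text \<open>Trades the isotropic weight for the two directional derivatives by a pointwise
  comparison and the triangle inequality. The constant is 6 times the \<open>2 * pi\<close> of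
  Plancherel; membership in \<open>Hs q\<close> makes both directional derivatives
  square-integrable.\<close>

lemma weighted_norm_Hs:
  assumes u: "u \<in> Hs q" and p: "0 \<le> p" "p \<le> 3" "p \<le> q"
  shows "L2 (\<lambda>\<zeta>. complex_of_real (weight \<zeta> powr (p / 2)) * fourier u \<zeta>)"
    "norm2 (\<lambda>\<zeta>. complex_of_real (weight \<zeta> powr (p / 2)) * fourier u \<zeta>)
      \<le> 12 * pi * (norm2 u + norm2 (Dx q u) + norm2 (Dy q u))"
proof -
  let ?f = "fourier u"
  have u2: "L2 u" and wq: "L2 (\<lambda>\<zeta>. complex_of_real ((1 + (norm \<zeta>)\<^sup>2) powr (q / 2)) * ?f \<zeta>)"
    using u by (auto simp: Hs_def)
  note [measurable] = L2_measurable[OF L2_fourier[OF u2]]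
  have dir: "L2 (\<lambda>\<zeta>. complex_of_real (\<bar>l \<zeta>\<bar> powr q) * ?f \<zeta>)"
    if [measurable]: "l \<in> borel_measurable borel" and le: "\<And>\<zeta>. \<bar>l \<zeta>\<bar> \<le> norm \<zeta>" for l :: "real \<times> real \<Rightarrow> real"
  proof (rule L2_bound(1)[OF wq, of _ 1])
    show "AE \<zeta> in lborel. cmod (complex_of_real (\<bar>l \<zeta>\<bar> powr q) * ?f \<zeta>)
      \<le> 1 * cmod (complex_of_real ((1 + (norm \<zeta>)\<^sup>2) powr (q / 2)) * ?f \<zeta>)"
    proof (rule AE_I2)
      fix \<zeta>
      have "\<bar>l \<zeta>\<bar> powr q \<le> (sqrt (1 + (norm \<zeta>)\<^sup>2)) powr q"
        using p le[of \<zeta>] by (intro powr_mono2 order_trans[OF le] real_le_rsqrt) auto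
      also have "\<dots> = (1 + (norm \<zeta>)\<^sup>2) powr (q / 2)"
        by (simp add: powr_half_sqrt[symmetric] powr_powr add_nonneg_nonneg)
      finally show "cmod (complex_of_real (\<bar>l \<zeta>\<bar> powr q) * ?f \<zeta>)
        \<le> 1 * cmod (complex_of_real ((1 + (norm \<zeta>)\<^sup>2) powr (q / 2)) * ?f \<zeta>)"
        by (simp add: norm_mult mult_right_mono)
    qed
  qed measurable
  have fm [measurable]: "fst \<in> borel_measurable (borel :: (real \<times> real) measure)"
    "snd \<in> borel_measurable (borel :: (real \<times> real) measure)"
    by (intro borel_measurable_continuous_onI continuous_intros)+
  have x: "L2 (\<lambda>\<zeta>. complex_of_real (\<bar>fst \<zeta>\<bar> powr q) * ?f \<zeta>)" and y: "L2 (\<lambda>\<zeta>. complex_of_real (\<bar>snd \<zeta>\<bar> powr q) * ?f \<zeta>)"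
    using norm_fst_le[of "fst _ :: real" "snd _ :: real"] norm_snd_le[of "snd _ :: real" "fst _ :: real"]
    by (auto intro!: dir fm)
  define g where "g \<zeta> = complex_of_real (cmod (?f \<zeta>) + cmod (complex_of_real (\<bar>fst \<zeta>\<bar> powr q) * ?f \<zeta>)
      + cmod (complex_of_real (\<bar>snd \<zeta>\<bar> powr q) * ?f \<zeta>))" for \<zeta>
  have cm: "L2 (\<lambda>\<zeta>. complex_of_real (cmod (h \<zeta>)))" "norm2 (\<lambda>\<zeta>. complex_of_real (cmod (h \<zeta>))) = norm2 h" if "L2 h" for h
    using that by (auto simp: L2_def norm2_def)
  have g: "L2 g" "norm2 g \<le> norm2 ?f + norm2 (\<lambda>\<zeta>. complex_of_real (\<bar>fst \<zeta>\<bar> powr q) * ?f \<zeta>) + norm2 (\<lambda>\<zeta>. complex_of_real (\<bar>snd \<zeta>\<bar> powr q) * ?f \<zeta>)"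
  proof -
    note f' = cm[OF L2_fourier[OF u2]] and x' = cm[OF x] and y' = cm[OF y]
    show "L2 g" unfolding g_def of_real_add by (intro L2_add f' x' y')
    have "norm2 g \<le> norm2 (\<lambda>\<zeta>. complex_of_real (cmod (?f \<zeta>)) + complex_of_real (cmod (complex_of_real (\<bar>fst \<zeta>\<bar> powr q) * ?f \<zeta>)))
        + norm2 (\<lambda>\<zeta>. complex_of_real (cmod (complex_of_real (\<bar>snd \<zeta>\<bar> powr q) * ?f \<zeta>)))"
      unfolding g_def of_real_add by (intro norm2_triangle L2_add f' x' y')
    also have "norm2 (\<lambda>\<zeta>. complex_of_real (cmod (?f \<zeta>)) + complex_of_real (cmod (complex_of_real (\<bar>fst \<zeta>\<bar> powr q) * ?f \<zeta>)))
      \<le> norm2 (\<lambda>\<zeta>. complex_of_real (cmod (?f \<zeta>))) + norm2 (\<lambda>\<zeta>. complex_of_real (cmod (complex_of_real (\<bar>fst \<zeta>\<bar> powr q) * ?f \<zeta>)))"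
      by (intro norm2_triangle f' x')
    finally show "norm2 g \<le> norm2 ?f + norm2 (\<lambda>\<zeta>. complex_of_real (\<bar>fst \<zeta>\<bar> powr q) * ?f \<zeta>) + norm2 (\<lambda>\<zeta>. complex_of_real (\<bar>snd \<zeta>\<bar> powr q) * ?f \<zeta>)"
      unfolding f'(2) x'(2) y'(2) by simp
  qed
  have le: "AE \<zeta> in lborel. cmod (complex_of_real (weight \<zeta> powr (p / 2)) * ?f \<zeta>) \<le> 6 * cmod (g \<zeta>)"
  proof (rule AE_I2)
    fix \<zeta>
    have "cmod (g \<zeta>) = (1 + \<bar>fst \<zeta>\<bar> powr q + \<bar>snd \<zeta>\<bar> powr q) * cmod (?f \<zeta>)"
      unfolding g_def norm_of_real by (simp add: norm_mult algebra_simps)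
    then show "cmod (complex_of_real (weight \<zeta> powr (p / 2)) * ?f \<zeta>) \<le> 6 * cmod (g \<zeta>)"
      using mult_right_mono[OF weight_powr_le[OF p, of \<zeta>], of "cmod (?f \<zeta>)"] by (simp add: norm_mult algebra_simps)
  qed
  show "L2 (\<lambda>\<zeta>. complex_of_real (weight \<zeta> powr (p / 2)) * fourier u \<zeta>)"
    by (rule L2_bound(1)[OF g(1) _ le]) measurable
  have "norm2 (\<lambda>\<zeta>. complex_of_real (weight \<zeta> powr (p / 2)) * fourier u \<zeta>) \<le> 6 * norm2 g"
    by (rule L2_bound(2)[OF g(1) _ le]; measurable; simp)
  moreover have "norm2 ?f = 2 * pi * norm2 u" by (rule norm2_fourier[OF u2])
  moreover have "norm2 (\<lambda>\<zeta>. complex_of_real (\<bar>fst \<zeta>\<bar> powr q) * ?f \<zeta>) = 2 * pi * norm2 (Dx q u)"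
    "norm2 (\<lambda>\<zeta>. complex_of_real (\<bar>snd \<zeta>\<bar> powr q) * ?f \<zeta>) = 2 * pi * norm2 (Dy q u)"
    by (simp_all add: Dx_def Dy_def mult_op_def norm2_ifourier x y)
  ultimately show "norm2 (\<lambda>\<zeta>. complex_of_real (weight \<zeta> powr (p / 2)) * fourier u \<zeta>)
      \<le> 12 * pi * (norm2 u + norm2 (Dx q u) + norm2 (Dy q u))"
    using g(2) by (simp add: algebra_simps)
qed

text \<open>The exponent used is \<open>p = 2 * a + b\<close>, since
  \<open>weight powr (p / 2)\<close> is the weight required on the datum. Dividing by
  \<open>2 * pi\<close>, the factor of \<open>ifourier\<close>, turns 2 times \<open>12 * pi\<close>
  into 12.\<close>

lemma Phi_dir_Hs_bound:
  assumes e: "e = (1, 0) \<or> e = (0, 1)" and a: "0 < a" "a < 1" and b: "0 \<le> b" "b < a"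
    and u: "u \<in> Hs q" and q: "2 * a + b \<le> q"
  shows "L2 (\<lambda>\<zeta>. complex_of_real (weight \<zeta> powr (b / 2)) * Phi_dir e t a (fourier u) \<zeta>)"
    "norm2 (\<lambda>\<zeta>. complex_of_real (weight \<zeta> powr (b / 2)) * Phi_dir e t a (fourier u) \<zeta>) / (2 * pi)
      \<le> 12 / \<bar>d_const a\<bar> * Schur_const a b * (1 + \<bar>t\<bar>) * (norm2 u + norm2 (Dx q u) + norm2 (Dy q u))"
    "L2 (\<lambda>\<zeta>. complex_of_real (weight \<zeta> powr a) * fourier u \<zeta>)"
proof -
  have u2: "L2 u" using u by (simp add: Hs_def)
  have wa: "L2 (\<lambda>\<zeta>. complex_of_real (weight \<zeta> powr (2 * a / 2)) * fourier u \<zeta>)"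
    by (rule weighted_norm_Hs(1)[OF u]) (use a b q in auto)
  then show wa': "L2 (\<lambda>\<zeta>. complex_of_real (weight \<zeta> powr a) * fourier u \<zeta>)" by simp
  have ab: "(2 * a + b) / 2 = a + b / 2" by simp
  have wb: "L2 (\<lambda>\<zeta>. complex_of_real (weight \<zeta> powr (a + b / 2)) * fourier u \<zeta>)"
    "norm2 (\<lambda>\<zeta>. complex_of_real (weight \<zeta> powr (a + b / 2)) * fourier u \<zeta>) \<le> 12 * pi * (norm2 u + norm2 (Dx q u) + norm2 (Dy q u))"
    unfolding ab[symmetric] by (intro weighted_norm_Hs u; use a b q in simp)+
  note ctx = e a L2_fourier[OF u2] wa' b wb(1)
  show "L2 (\<lambda>\<zeta>. complex_of_real (weight \<zeta> powr (b / 2)) * Phi_dir e t a (fourier u) \<zeta>)"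
    by (rule Phi_dir_weighted(1)[OF ctx])
  have "norm2 (\<lambda>\<zeta>. complex_of_real (weight \<zeta> powr (b / 2)) * Phi_dir e t a (fourier u) \<zeta>)
      \<le> 1 / \<bar>d_const a\<bar> * (2 * Schur_const a b * (1 + \<bar>t\<bar>) * norm2 (\<lambda>\<zeta>. complex_of_real (weight \<zeta> powr (a + b / 2)) * fourier u \<zeta>))"
    by (rule Phi_dir_weighted(2)[OF ctx])
  also have "\<dots> \<le> 1 / \<bar>d_const a\<bar> * (2 * Schur_const a b * (1 + \<bar>t\<bar>) * (12 * pi * (norm2 u + norm2 (Dx q u) + norm2 (Dy q u))))"
    by (intro mult_left_mono wb(2)) auto
  finally have "norm2 (\<lambda>\<zeta>. complex_of_real (weight \<zeta> powr (b / 2)) * Phi_dir e t a (fourier u) \<zeta>) / (2 * pi)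
      \<le> 1 / \<bar>d_const a\<bar> * (2 * Schur_const a b * (1 + \<bar>t\<bar>) * (12 * pi * (norm2 u + norm2 (Dx q u) + norm2 (Dy q u)))) / (2 * pi)"
    by (rule divide_right_mono) simp
  also have "\<dots> = 12 / \<bar>d_const a\<bar> * Schur_const a b * (1 + \<bar>t\<bar>) * (norm2 u + norm2 (Dx q u) + norm2 (Dy q u))"
    by simp
  finally show "norm2 (\<lambda>\<zeta>. complex_of_real (weight \<zeta> powr (b / 2)) * Phi_dir e t a (fourier u) \<zeta>) / (2 * pi)
      \<le> 12 / \<bar>d_const a\<bar> * Schur_const a b * (1 + \<bar>t\<bar>) * (norm2 u + norm2 (Dx q u) + norm2 (Dy q u))" .
qed

lemma directional_estimate:
  fixes t :: real
  assumes e: "e = (1, 0) \<or> e = (0, 1)" and a: "0 < a" "a < 1" and s: "2 * a \<le> s" and u: "u \<in> Hs s"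
    and xu: "L2 (\<lambda>z. complex_of_real (\<bar>z \<bullet> e\<bar> powr a) * u z)"
  defines "\<Phi> \<equiv> Phi_dir e t a (fourier u)"
  shows "AE z in lborel. complex_of_real (\<bar>z \<bullet> e\<bar> powr a) * W t u z
      = W t (\<lambda>z. complex_of_real (\<bar>z \<bullet> e\<bar> powr a) * u z) z + W t (ifourier \<Phi>) z"
    and "L2 \<Phi>"
    and "norm2 (ifourier \<Phi>) \<le> 12 / \<bar>d_const a\<bar> * Schur_const a 0 * (1 + \<bar>t\<bar>) * (norm2 u + norm2 (Dx s u) + norm2 (Dy s u))"
proof -
  have u2: "L2 u" using u by (simp add: Hs_def)
  note P = Phi_dir_Hs_bound(1,2)[OF e a order_refl a(1) u, of t] Phi_dir_Hs_bound(3)[OF e a order_refl a(1) u]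
  have s0: "2 * a + 0 \<le> s" using s by simp
  show "AE z in lborel. complex_of_real (\<bar>z \<bullet> e\<bar> powr a) * W t u z
      = W t (\<lambda>z. complex_of_real (\<bar>z \<bullet> e\<bar> powr a) * u z) z + W t (ifourier \<Phi>) z"
    unfolding \<Phi>_def by (rule commutator_identity[OF e a u2 xu P(3)[OF s0]])
  show L: "L2 \<Phi>" using P(1)[OF s0] by (simp add: \<Phi>_def)
  show "norm2 (ifourier \<Phi>) \<le> 12 / \<bar>d_const a\<bar> * Schur_const a 0 * (1 + \<bar>t\<bar>) * (norm2 u + norm2 (Dx s u) + norm2 (Dy s u))"
    using P(2)[OF s0] norm2_ifourier[OF L] by (simp add: \<Phi>_def)
qed

text \<open>On the Fourier side both \<open>D b\<close> and \<open>W t\<close> are multipliers and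
  commute. The transform of the commutator identity may be multiplied by
  \<open>norm \<zeta> powr b\<close> termwise: the first term stays square-integrable by hypothesis,
  the second because \<open>norm \<zeta> powr b\<close> is at most
  \<open>weight \<zeta> powr (b / 2)\<close>.\<close>

lemma directional_D_estimate:
  fixes t :: real
  assumes e: "e = (1, 0) \<or> e = (0, 1)" and a: "0 < a" "a < 1" and b: "0 < b" "b < a" and s: "2 * a \<le> s"
    and u: "u \<in> Hs s" "u \<in> Hs (b + s)"
    and xu: "L2 (\<lambda>z. complex_of_real (\<bar>z \<bullet> e\<bar> powr a) * u z)"
    and Dxu: "D_in_L2 b (\<lambda>z. complex_of_real (\<bar>z \<bullet> e\<bar> powr a) * u z)"
  defines "\<Phi> \<equiv> Phi_dir e t a (fourier u)"
  shows "AE z in lborel. D b (\<lambda>w. complex_of_real (\<bar>w \<bullet> e\<bar> powr a) * W t u w) z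
      = W t (D b (\<lambda>w. complex_of_real (\<bar>w \<bullet> e\<bar> powr a) * u w)) z + W t (D b (ifourier \<Phi>)) z"
    and "D_in_L2 b (ifourier \<Phi>)"
    and "norm2 (D b (ifourier \<Phi>)) \<le> 12 / \<bar>d_const a\<bar> * Schur_const a b * (1 + \<bar>t\<bar>)
      * (norm2 u + norm2 (Dx (b + s) u) + norm2 (Dy (b + s) u))"
proof -
  define m where "m \<zeta> = complex_of_real (norm \<zeta> powr b)" for \<zeta> :: "real \<times> real"
  have [measurable]: "m \<in> borel_measurable borel" unfolding m_def by measurable
  define g where "g z = complex_of_real (\<bar>z \<bullet> e\<bar> powr a) * u z" for z
  have u2: "L2 u" using u by (simp add: Hs_def)
  have g: "L2 g" using xu by (simp add: g_def[abs_def])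
  note dir = directional_estimate[OF e a s u(1) xu, of t, folded \<Phi>_def g_def]
  have P2: "L2 \<Phi>" by (rule dir(2))
  note [measurable] = L2_measurable[OF P2] L2_measurable[OF L2_W[OF u2, of t]]
    L2_measurable[OF L2_fourier[OF L2_ifourier[OF P2]]]
  have mg: "L2 (\<lambda>\<zeta>. m \<zeta> * fourier g \<zeta>)"
    using Dxu by (simp add: D_in_L2_def m_def g_def[abs_def])
  have q: "2 * a + b \<le> b + s" using s by simp
  note PH = Phi_dir_Hs_bound(1,2)[OF e a less_imp_le[OF b(1)] b(2) u(2) q, of t, folded \<Phi>_def]
  have mle: "AE \<zeta> in lborel. cmod (m \<zeta> * \<Phi> \<zeta>) \<le> 1 * cmod (complex_of_real (weight \<zeta> powr (b / 2)) * \<Phi> \<zeta>)"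
  proof (rule AE_I2)
    fix \<zeta>
    have "norm \<zeta> powr b \<le> (sqrt (weight \<zeta>)) powr b"
      using b by (intro powr_mono2 real_le_rsqrt) (auto simp: weight_def)
    also have "\<dots> = weight \<zeta> powr (b / 2)" by (simp add: powr_half_sqrt[symmetric] powr_powr)
    finally show "cmod (m \<zeta> * \<Phi> \<zeta>) \<le> 1 * cmod (complex_of_real (weight \<zeta> powr (b / 2)) * \<Phi> \<zeta>)"
      by (simp add: m_def norm_mult mult_right_mono)
  qed
  have mP: "L2 (\<lambda>\<zeta>. m \<zeta> * \<Phi> \<zeta>)" "norm2 (\<lambda>\<zeta>. m \<zeta> * \<Phi> \<zeta>) \<le> norm2 (\<lambda>\<zeta>. complex_of_real (weight \<zeta> powr (b / 2)) * \<Phi> \<zeta>)"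
    using L2_bound[OF PH(1) _ mle] by auto
  have FP: "AE \<zeta> in lborel. m \<zeta> * fourier (ifourier \<Phi>) \<zeta> = m \<zeta> * \<Phi> \<zeta>"
    using fourier_ifourier[OF P2] by eventually_elim simp
  have "L2 (\<lambda>\<zeta>. m \<zeta> * fourier (ifourier \<Phi>) \<zeta>)"
    by (rule L2_cong_AE(1)[OF mP(1) _ FP]) measurable
  then show "D_in_L2 b (ifourier \<Phi>)" by (simp add: D_in_L2_def m_def)
  have DP: "D b (ifourier \<Phi>) = ifourier (\<lambda>\<zeta>. m \<zeta> * \<Phi> \<zeta>)"
    unfolding D_def m_def[symmetric] by (rule mult_op_ifourier[OF _ P2]) measurable
  have "norm2 (D b (ifourier \<Phi>)) \<le> norm2 (\<lambda>\<zeta>. complex_of_real (weight \<zeta> powr (b / 2)) * \<Phi> \<zeta>) / (2 * pi)"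
    unfolding DP norm2_ifourier[OF mP(1)] by (intro divide_right_mono mP(2)) simp
  also note PH(2)
  finally show "norm2 (D b (ifourier \<Phi>)) \<le> 12 / \<bar>d_const a\<bar> * Schur_const a b * (1 + \<bar>t\<bar>)
      * (norm2 u + norm2 (Dx (b + s) u) + norm2 (Dy (b + s) u))" .
  have Dg: "W t (D b g) = ifourier (\<lambda>\<zeta>. chirp t \<zeta> * (m \<zeta> * fourier g \<zeta>))"
    unfolding D_def mult_op_def m_def[symmetric] by (rule W_ifourier[OF mg])
  have WDP: "W t (D b (ifourier \<Phi>)) = ifourier (\<lambda>\<zeta>. chirp t \<zeta> * (m \<zeta> * \<Phi> \<zeta>))"
    unfolding DP by (rule W_ifourier[OF mP(1)])
  define Y where "Y z = W t g z + W t (ifourier \<Phi>) z" for z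
  have Y2: "L2 Y" unfolding Y_def by (intro L2_add L2_W g L2_ifourier P2)
  define h where "h z = complex_of_real (\<bar>z \<bullet> e\<bar> powr a) * W t u z" for z
  have [measurable]: "h \<in> borel_measurable borel" unfolding h_def by measurable
  \<comment> \<open>h agrees almost everywhere with the square-integrable Y by the commutator
    identity, so their selected transforms coincide and the linearity of the transform can be
    applied to Y.\<close>
  have hY: "fourier h = fourier Y"
    by (rule fourier_cong_AE(1)[OF _ L2_measurable[OF Y2]]) (use dir(1) in \<open>auto simp: h_def Y_def\<close>)
  have FY: "AE \<zeta> in lborel. m \<zeta> * fourier Y \<zeta> = chirp t \<zeta> * (m \<zeta> * fourier g \<zeta>) + chirp t \<zeta> * (m \<zeta> * \<Phi> \<zeta>)"
    using fourier_add(1)[OF L2_W[OF g] L2_W[OF L2_ifourier[OF P2]], of t t] fourier_W[OF g, of t]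
      fourier_W[OF L2_ifourier[OF P2], of t] fourier_ifourier[OF P2]
    by eventually_elim (simp add: Y_def[abs_def] algebra_simps)
  note C = chirp_mult(1)[OF mg, of t] chirp_mult(1)[OF mP(1), of t]
  note [measurable] = L2_measurable[OF L2_fourier[OF Y2]]
  have "D b h = ifourier (\<lambda>\<zeta>. chirp t \<zeta> * (m \<zeta> * fourier g \<zeta>) + chirp t \<zeta> * (m \<zeta> * \<Phi> \<zeta>))"
    unfolding D_def mult_op_def m_def[symmetric] hY
    by (rule fourier_cong_AE(2)[OF _ L2_measurable[OF L2_add[OF C]] FY]) measurable
  then have "AE z in lborel. D b h z = W t (D b g) z + W t (D b (ifourier \<Phi>)) z"
    unfolding Dg WDP using fourier_add(2)[OF C] by simp
  then show "AE z in lborel. D b (\<lambda>w. complex_of_real (\<bar>w \<bullet> e\<bar> powr a) * W t u w) z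
      = W t (D b (\<lambda>w. complex_of_real (\<bar>w \<bullet> e\<bar> powr a) * u w)) z + W t (D b (ifourier \<Phi>)) z"
    by (simp add: h_def[abs_def] g_def[abs_def])
qed

theorem theorem2:
  fixes r1 r2 :: real
  assumes "0 < r1" "r1 < 1" "0 < r2" "r2 < 1"
  shows
   "(\<exists>c. \<forall>s u0 t. s \<ge> 2 * max r1 r2 \<and> u0 \<in> Z s r1 r2 \<longrightarrow>
      (AE z in lborel. complex_of_real (\<bar>fst z\<bar> powr r1) * W t u0 z =
          W t (\<lambda>w. complex_of_real (\<bar>fst w\<bar> powr r1) * u0 w) z
          + W t (ifourier (Phi1 t r1 (fourier u0))) z) \<and>
      (AE z in lborel. complex_of_real (\<bar>snd z\<bar> powr r2) * W t u0 z =
          W t (\<lambda>w. complex_of_real (\<bar>snd w\<bar> powr r2) * u0 w) z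
          + W t (ifourier (Phi2 t r2 (fourier u0))) z) \<and>
      L2 (Phi1 t r1 (fourier u0)) \<and> L2 (Phi2 t r2 (fourier u0)) \<and>
      norm2 (ifourier (Phi1 t r1 (fourier u0)))
        \<le> c * (1 + \<bar>t\<bar>) * (norm2 u0 + norm2 (Dx s u0) + norm2 (Dy s u0)) \<and>
      norm2 (ifourier (Phi2 t r2 (fourier u0)))
        \<le> c * (1 + \<bar>t\<bar>) * (norm2 u0 + norm2 (Dx s u0) + norm2 (Dy s u0)))
   \<and>
   (\<forall>\<beta>. 0 < \<beta> \<and> \<beta> < min r1 r2 \<longrightarrow>
     (\<exists>c. \<forall>s u0 t. s \<ge> 2 * max r1 r2 \<and> u0 \<in> Z s r1 r2
        \<and> D_in_L2 \<beta> (\<lambda>w. complex_of_real (\<bar>fst w\<bar> powr r1) * u0 w)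
        \<and> D_in_L2 \<beta> (\<lambda>w. complex_of_real (\<bar>snd w\<bar> powr r2) * u0 w)
        \<and> u0 \<in> Hs (\<beta> + s) \<longrightarrow>
      (AE z in lborel.
          D \<beta> (\<lambda>w. complex_of_real (\<bar>fst w\<bar> powr r1) * W t u0 w) z =
          W t (D \<beta> (\<lambda>w. complex_of_real (\<bar>fst w\<bar> powr r1) * u0 w)) z
          + W t (D \<beta> (ifourier (Phi1 t r1 (fourier u0)))) z) \<and>
      (AE z in lborel.
          D \<beta> (\<lambda>w. complex_of_real (\<bar>snd w\<bar> powr r2) * W t u0 w) z =
          W t (D \<beta> (\<lambda>w. complex_of_real (\<bar>snd w\<bar> powr r2) * u0 w)) z
          + W t (D \<beta> (ifourier (Phi2 t r2 (fourier u0)))) z) \<and>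
      D_in_L2 \<beta> (ifourier (Phi1 t r1 (fourier u0))) \<and>
      D_in_L2 \<beta> (ifourier (Phi2 t r2 (fourier u0))) \<and>
      norm2 (D \<beta> (ifourier (Phi1 t r1 (fourier u0))))
        \<le> c * (1 + \<bar>t\<bar>) * (norm2 u0 + norm2 (Dx (\<beta> + s) u0) + norm2 (Dy (\<beta> + s) u0)) \<and>
      norm2 (D \<beta> (ifourier (Phi2 t r2 (fourier u0))))
        \<le> c * (1 + \<bar>t\<bar>) * (norm2 u0 + norm2 (Dx (\<beta> + s) u0) + norm2 (Dy (\<beta> + s) u0))))"
proof -
  define K where "K a b = 12 / \<bar>d_const a\<bar> * Schur_const a b" for a b
  have ix: "z \<bullet> (1, 0) = fst z" "z \<bullet> (0, 1) = snd z" for z :: "real \<times> real"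
    by (simp_all add: inner_prod_def)
  have le: "x \<le> c * (1 + \<bar>t\<bar>) * (norm2 u + norm2 v + norm2 w)"
    if "x \<le> k * (1 + \<bar>t\<bar>) * (norm2 u + norm2 v + norm2 w)" "k \<le> c" for x k c t u v w
    using that(1) by (rule order_trans) (intro mult_right_mono that(2); simp)
  have p1: "(1, 0) = (1, 0) \<or> (1, 0) = (0 :: real, 1 :: real)" and p2: "(0, 1) = (1, 0) \<or> (0, 1) = (0 :: real, 1 :: real)"
    by auto
  note e1 = directional_estimate[OF p1 assms(1,2), folded K_def Phi1_eq, unfolded ix]
  note e2 = directional_estimate[OF p2 assms(3,4), folded K_def Phi2_eq, unfolded ix]
  note D1 = directional_D_estimate[OF p1 assms(1,2), folded K_def Phi1_eq, unfolded ix]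
  note D2 = directional_D_estimate[OF p2 assms(3,4), folded K_def Phi2_eq, unfolded ix]
  have Zs: "2 * r1 \<le> s" "2 * r2 \<le> s" "u0 \<in> Hs s"
    "L2 (\<lambda>z. complex_of_real (\<bar>fst z\<bar> powr r1) * u0 z)" "L2 (\<lambda>z. complex_of_real (\<bar>snd z\<bar> powr r2) * u0 z)"
    if "s \<ge> 2 * max r1 r2 \<and> u0 \<in> Z s r1 r2" for s u0
    using that by (auto simp: Z_def)
  show ?thesis
  proof ((rule conjI; (intro allI impI)?), goal_cases)
    case 1
    \<comment> \<open>The constant is chosen before s, the datum and t, which is possible because K
      depends on the exponents alone.\<close>
    show ?case
    proof (intro exI[of _ "max (K r1 0) (K r2 0)"] allI impI, goal_cases)
      case (1 s u0 t)
      note z = Zs[OF 1]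
      show ?case
        using e1[OF z(1,3,4), of t] e2[OF z(2,3,5), of t] by (auto intro: le)
    qed
  next
    case (2 \<beta>)
    then have b: "0 < \<beta>" "\<beta> < r1" "\<beta> < r2" by auto
    \<comment> \<open>Here the constant depends on \<beta> as well, through
      \<open>Jconst (r1 - \<beta>)\<close> and \<open>Jconst (r2 - \<beta>)\<close> in
      \<open>Schur_const\<close>.\<close>
    show ?case
    proof (intro exI[of _ "max (K r1 \<beta>) (K r2 \<beta>)"] allI impI, goal_cases)
      case (1 s u0 t)
      then have h: "s \<ge> 2 * max r1 r2 \<and> u0 \<in> Z s r1 r2" "u0 \<in> Hs (\<beta> + s)"
        "D_in_L2 \<beta> (\<lambda>w. complex_of_real (\<bar>fst w\<bar> powr r1) * u0 w)"
        "D_in_L2 \<beta> (\<lambda>w. complex_of_real (\<bar>snd w\<bar> powr r2) * u0 w)" by auto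
      note z = Zs[OF h(1)]
      show ?case
        using D1[OF b(1,2) z(1,3) h(2) z(4) h(3), of t] D2[OF b(1,3) z(2,3) h(2) z(5) h(4), of t]
        by (auto intro: le)
    qed
  qed
qed

end
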